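(* Let $c\ge 0$ and $p>0$. For integers $n>p$, let $A_n$ be the adjacency matrix of a random graph following $\mathrm{G}(n,p/n)$, and let $K_n=D_n^{-1}A_n$, where $D_n$ is the diagonal matrix whose $i$-th diagonal entry is $c+\sum_{j=1}^n(A_n)_{ij}$ if the $i$-th row of $A_n$ is not identically $0$, and is $1$ if the entire $i$-th row of $A_n$ is $0$. Then, as $n\to\infty$, the empirical spectral distribution $\mu_{K_n}$ weakly converges in probability to a nonrandom probability distribution. The weak convergence is almost sure if $n$ is replaced with any subsequence $n_j$ with $\sum_j n_j^{-1}<\infty$. The limiting distribution is symmetric and nondegenerate, and for every integer $k\ge 1$ its $k$-th moment is $$\beta_k=\mathrm{E}\, r_k(T,\emptyset,c),$$ where $T$ is a random Galton–Watson tree rooted at $\emptyset$ with offspring distribution $\mathrm{Po}(p)$ (Poisson with mean $p$).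
   Context: $\mathrm{G}(n,a)$, for $a\in[0,1]$, denotes the Erdős–Rényi distribution on simple graphs with vertex set $\{1,\dots,n\}$ in which each pair of distinct vertices is joined by an edge with probability $a$, independently of the other pairs. The adjacency matrix has $(i,j)$ entry $1$ if $\{i,j\}$ is an edge and $0$ otherwise. All the $A_n$ are defined on a common probability space. For an $n\times n$ matrix $M$ with eigenvalues $\lambda_1(M),\dots,\lambda_n(M)$ (counted with multiplicity), its empirical spectral distribution is $\mu_M=n^{-1}\sum_{i=1}^n\delta_{\lambda_i(M)}$, where $\delta_x$ is the unit point mass at $x$; the eigenvalues of $K_n$ are real. Weak convergence in probability (resp. almost sure) of $\mu_{K_n}$ to $\mu$ means that $\int g\,d\mu_{K_n}\to\int g\,d\mu$ for every bounded continuous $g:\mathbb{R}\to\mathbb{R}$ in probability (resp. that almost surely $\mu_{K_n}\to\mu$ weakly). Nondegenerate means not concentrated at a single point. For a (locally finite, simple) graph $G$ with vertex $v_0$ and $c\ge 0$, consider the following random walk on $G$ starting from $v_0$ at step $0$. Let $d(v,G)$ denote the degree of $v$ in $G$. If $d(v_0,G)\ge1$, then whenever at step $j\ge0$ the walk is (alive) at a vertex $v$ with $d(v,G)=d$, at step $j+1$ it moves to each given neighbor of $v$ with probability $1/(c+d)$, or is killed with probability $c/(c+d)$. If $d(v_0,G)=0$, the walk is killed at step $1$, regardless of the value of $c$. Then $r_k(G,v_0,c)$ is the probability that the walk is alive and at $v_0$ at step $k$. *)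

theory Defs
  imports
    "HOL-Probability.Probability"
    "Jordan_Normal_Form.Char_Poly"
    "Jordan_Normal_Form.Gauss_Jordan_Elimination"
begin

section \<open>Sparse random graphs and their matrices\<close>

text \<open>A simple graph on the vertex set \<open>{1..n}\<close> is represented by its set of edges, an edge
  being a two-element set of vertices.\<close>

definition vertex_pairs :: "nat \<Rightarrow> nat set set" where
  "vertex_pairs n = {e. e \<subseteq> {1..n} \<and> card e = 2}"

definition erdos_renyi :: "nat \<Rightarrow> real \<Rightarrow> nat set set pmf" where
  "erdos_renyi n a =
     map_pmf (\<lambda>present. {e \<in> vertex_pairs n. present e})
       (Pi_pmf (vertex_pairs n) False (\<lambda>_. bernoulli_pmf a))"

text \<open>Matrix indices start at \<open>0\<close>, so index \<open>i\<close> stands for the vertex \<open>Suc i\<close>.\<close>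

definition adjacency_matrix :: "nat \<Rightarrow> nat set set \<Rightarrow> real mat" where
  "adjacency_matrix n E = mat n n (\<lambda>(i, j). if {Suc i, Suc j} \<in> E then 1 else 0)"

definition degree_matrix :: "real \<Rightarrow> real mat \<Rightarrow> real mat" where
  "degree_matrix c A =
     mat_diag (dim_row A)
       (\<lambda>i. if row A i = 0\<^sub>v (dim_col A) then 1 else c + (\<Sum>j<dim_col A. A $$ (i, j)))"

text \<open>For \<open>c \<ge> 0\<close> and an adjacency matrix \<open>A\<close>, the diagonal of \<^term>\<open>degree_matrix c A\<close> is
  positive, so the inverse exists.\<close>

definition walk_matrix :: "real \<Rightarrow> real mat \<Rightarrow> real mat" where
  "walk_matrix c A = the (mat_inverse (degree_matrix c A)) * A"


section \<open>Empirical spectral distributions and their convergence\<close>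

text \<open>An eigenvalue \<open>x\<close> has mass (algebraic multiplicity of \<open>x\<close>) divided by the dimension.
  Only real eigenvalues are seen, so the total mass is \<open>1\<close> exactly when all complex eigenvalues
  of the matrix are real; this is the case for the matrices \<^const>\<open>walk_matrix\<close> of graphs.\<close>

definition empirical_spectral_distribution :: "real mat \<Rightarrow> real measure" where
  "empirical_spectral_distribution K =
     distr
       (point_measure {x. eigenvalue K x}
         (\<lambda>x. ennreal (real (order x (char_poly K)) / real (dim_row K))))
       borel (\<lambda>x. x)"

definition weakly_converges_in_probability ::
    "'w measure \<Rightarrow> (nat \<Rightarrow> 'w \<Rightarrow> real measure) \<Rightarrow> real measure \<Rightarrow> bool" where
  "weakly_converges_in_probability M \<nu> \<mu> \<longleftrightarrow>
     (\<forall>g :: real \<Rightarrow> real. continuous_on UNIV g \<longrightarrow> bounded (range g) \<longrightarrow>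
       (\<forall>\<epsilon> > 0.
         (\<lambda>n. measure M {w \<in> space M. \<bar>(\<integral>x. g x \<partial>\<nu> n w) - (\<integral>x. g x \<partial>\<mu>)\<bar> > \<epsilon>})
           \<longlonglongrightarrow> 0))"


section \<open>The killed random walk on a graph\<close>

text \<open>A locally finite simple graph is given by a symmetric irreflexive adjacency relation with
  finite neighbourhoods.\<close>

definition neighbours :: "('v \<Rightarrow> 'v \<Rightarrow> bool) \<Rightarrow> 'v \<Rightarrow> 'v set" where
  "neighbours adj v = {u. adj v u}"

definition degree_of :: "('v \<Rightarrow> 'v \<Rightarrow> bool) \<Rightarrow> 'v \<Rightarrow> nat" where
  "degree_of adj v = card (neighbours adj v)"

text \<open>The state \<^const>\<open>None\<close> means that the walk has been killed. With \<open>d\<close> the degree of the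
  current vertex, the walk is killed with probability \<open>c / (c + d)\<close> and otherwise goes to a
  uniform neighbour, so each neighbour has probability \<open>(d / (c + d)) * (1 / d) = 1 / (c + d)\<close>.
  A vertex of degree \<open>0\<close> can only be occupied if the walk starts there.\<close>

fun walk_step :: "('v \<Rightarrow> 'v \<Rightarrow> bool) \<Rightarrow> real \<Rightarrow> 'v option \<Rightarrow> 'v option pmf" where
  "walk_step adj c None = return_pmf None"
| "walk_step adj c (Some v) =
     (if degree_of adj v = 0 then return_pmf None
      else bernoulli_pmf (c / (c + real (degree_of adj v))) \<bind>
        (\<lambda>killed. if killed then return_pmf None
                  else map_pmf Some (pmf_of_set (neighbours adj v))))"

lemma pmf_walk_step:
  assumes "c \<ge> 0" and d: "degree_of adj v > 0"
  shows "pmf (walk_step adj c (Some v)) None = c / (c + real (degree_of adj v))"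
    and "pmf (walk_step adj c (Some v)) (Some u) =
      (if adj v u then 1 / (c + real (degree_of adj v)) else 0)"
proof -
  have fin: "finite (neighbours adj v)" and ne: "neighbours adj v \<noteq> {}"
    using d by (auto simp: degree_of_def card_gt_0_iff)
  let ?d = "real (degree_of adj v)"
  have range: "0 \<le> c / (c + ?d)" "c / (c + ?d) \<le> 1"
    using assms by (auto simp: divide_simps)
  have none: "pmf (map_pmf Some (pmf_of_set (neighbours adj v))) None = 0"
    by (auto simp: pmf_eq_0_set_pmf)
  show "pmf (walk_step adj c (Some v)) None = c / (c + ?d)"
    using d range none by (simp add: pmf_bind)
  have "pmf (map_pmf Some (pmf_of_set (neighbours adj v))) (Some u) =
      (if adj v u then 1 / ?d else 0)"
    by (subst pmf_map_inj')
       (use fin ne in \<open>auto simp: degree_of_def neighbours_def indicator_def\<close>)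
  moreover have "(1 - c / (c + ?d)) / ?d = 1 / (c + ?d)"
  proof -
    have "c + ?d \<noteq> 0" "?d \<noteq> 0"
      using assms by auto
    then show ?thesis
      by (simp add: diff_divide_eq_iff)
  qed
  ultimately show "pmf (walk_step adj c (Some v)) (Some u) =
      (if adj v u then 1 / (c + ?d) else 0)"
    using d range by (simp add: pmf_bind)
qed

primrec walk_state ::
    "('v \<Rightarrow> 'v \<Rightarrow> bool) \<Rightarrow> 'v \<Rightarrow> real \<Rightarrow> nat \<Rightarrow> 'v option pmf" where
  "walk_state adj v\<^sub>0 c 0 = return_pmf (Some v\<^sub>0)"
| "walk_state adj v\<^sub>0 c (Suc k) = walk_state adj v\<^sub>0 c k \<bind> walk_step adj c"

definition return_probability ::
    "nat \<Rightarrow> ('v \<Rightarrow> 'v \<Rightarrow> bool) \<Rightarrow> 'v \<Rightarrow> real \<Rightarrow> real" where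
  "return_probability k adj v\<^sub>0 c = pmf (walk_state adj v\<^sub>0 c k) (Some v\<^sub>0)"


section \<open>Galton--Watson trees\<close>

text \<open>Ulam--Harris labelling: individuals are finite sequences of numbers, the root is \<open>[]\<close>, and
  individual \<open>u\<close> has the \<open>N u\<close> children \<open>u @ [0], \<dots>, u @ [N u - 1]\<close>.\<close>

definition tree_vertices :: "(nat list \<Rightarrow> nat) \<Rightarrow> nat list set" where
  "tree_vertices N = {u. \<forall>v i w. u = v @ i # w \<longrightarrow> i < N v}"

definition tree_adj :: "(nat list \<Rightarrow> nat) \<Rightarrow> nat list \<Rightarrow> nat list \<Rightarrow> bool" where
  "tree_adj N u v \<longleftrightarrow>
     u \<in> tree_vertices N \<and> v \<in> tree_vertices N \<and> (\<exists>i. v = u @ [i] \<or> u = v @ [i])"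

text \<open>The offspring numbers of all potential individuals are independent with law \<open>Q\<close>.\<close>

definition galton_watson :: "nat pmf \<Rightarrow> (nat list \<Rightarrow> nat) measure" where
  "galton_watson Q = (\<Pi>\<^sub>M u \<in> UNIV. measure_pmf Q)"

end

theory Submission
  imports Defs "HOL-Real_Asymp.Real_Asymp" "Jordan_Normal_Form.Schur_Decomposition"
begin

text \<open>The matrix \<open>K\<^sub>n\<close> is self-adjoint for the inner product weighted by the degrees and
  substochastic, so its spectrum lies in \<open>[-1, 1]\<close> and weak convergence reduces to convergence of
  the normalised traces of \<open>K\<^sub>n ^ k\<close>. Changing one edge changes two rows of \<open>K\<^sub>n\<close>, hence moves
  the trace of \<open>K\<^sub>n ^ k\<close> by at most \<open>4 k\<close>, and the Efron--Stein inequality bounds the variance of the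
  normalised trace by a constant over \<open>n\<close>; Chebyshev and Borel--Cantelli do the rest.

  For the expectations, the walk is revealed step by step. A state records the finite tree visited so
  far, the current position and the number of visits to each vertex. Each step goes to a visited
  neighbour or to a new vertex; in the random graph it may also close a cycle, which costs a factor
  of order \<open>1 / n\<close>. On the Galton--Watson side the children of a vertex are exchangeable, so a new
  child may be taken to be the next unused one, at the price of a factor counting the unused
  children. Both sides thus obey the same recursion in the limit, and its initial values agree by the
  Poisson limit of binomial degrees and the Mecke equation \<open>E (N)\<^sub>j f(N) = p\<^sup>j E f(N + j)\<close>.\<close>

section \<open>Spectra of real matrices\<close>

text \<open>The obstacle is that the factors \<open>1 / (c + d)\<close> along the walk are not
  independent: all visits to a vertex see the same degree, and that degree is correlated with the
  edges already known to be present. So no factor is averaged when it arises. A past visit to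
  \<open>v\<close> only raises an exponent \<open>e v\<close>, and expectations are evaluated once,
  at \<open>k = 0\<close>, where the degrees of the explored vertices are independent up to lower
  order. In the graph, a new vertex has about \<open>n\<close> positions, each reached with
  probability \<open>p / n\<close>; in the tree it has \<open>N x - J x\<close> positions. The
  latter numbers multiply up to falling factorials, which the Mecke equation trades for powers of
  \<open>p\<close> and a shift of \<open>N v\<close> by \<open>J v\<close>, just as requiring
  \<open>J v\<close> edges at a vertex of the graph adds \<open>J v\<close> to a binomial degree.
  The limit law is not constructed from its moments: it is a subsequential weak limit along one good
  realisation of the graphs, whose spectra all lie in \<open>[-1, 1]\<close>.\<close>

definition mtrace :: "'a :: comm_semiring_1 mat \<Rightarrow> 'a" where
  "mtrace A = (\<Sum>i<dim_row A. A $$ (i, i))"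

lemma mat_mult_entry:
  assumes "A \<in> carrier_mat n m" "B \<in> carrier_mat m l" "i < n" "j < l"
  shows "(A * B) $$ (i, j) = (\<Sum>k<m. A $$ (i, k) * B $$ (k, j))"
  using assms by (auto simp: scalar_prod_def lessThan_atLeast0 intro!: sum.cong)

lemma mtrace_comm:
  assumes A: "A \<in> carrier_mat n m" and B: "B \<in> carrier_mat m n"
  shows "mtrace (A * B) = mtrace (B * A)"
proof -
  have "mtrace (A * B) = (\<Sum>i<n. \<Sum>k<m. A $$ (i, k) * B $$ (k, i))"
    unfolding mtrace_def using A B mat_mult_entry[OF A B] by (intro sum.cong) (simp_all del: index_mult_mat(1))
  also have "\<dots> = (\<Sum>k<m. \<Sum>i<n. B $$ (k, i) * A $$ (i, k))"
    by (subst sum.swap) (simp add: mult.commute)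
  also have "\<dots> = mtrace (B * A)"
    unfolding mtrace_def using A B mat_mult_entry[OF B A] by (intro sum.cong) (simp_all del: index_mult_mat(1))
  finally show ?thesis .
qed

text \<open>In the sum over \<open>l\<close>, the terms with \<open>l < i\<close> vanish by the
  first factor and those with \<open>l > i\<close> by the second, so only \<open>l = i\<close>
  reaches the diagonal. Both claims share one induction because the second uses the first.\<close>

lemma upper_triangular_pow:
  assumes B: "B \<in> carrier_mat n n" and ut: "upper_triangular B"
  shows "upper_triangular (B ^\<^sub>m k)" and "\<And>i. i < n \<Longrightarrow> (B ^\<^sub>m k) $$ (i, i) = (B $$ (i, i)) ^ k"
proof (induction k)
  case 0
  { case 1 show ?case using B by simp }
  { case 2 then show ?case using B by simp }
next
  case (Suc k)
  have Bk: "B ^\<^sub>m k \<in> carrier_mat n n" using B by simp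
  have e: "(B ^\<^sub>m Suc k) $$ (i, j) = (\<Sum>l<n. (B ^\<^sub>m k) $$ (i, l) * B $$ (l, j))" if "i < n" "j < n" for i j
    using mat_mult_entry[OF Bk B that] by (simp del: index_mult_mat)
  have z: "(B ^\<^sub>m k) $$ (i, l) = 0" if "l < i" "i < n" for i l
    using Suc(1) that Bk by (auto dest: upper_triangularD)
  have zB: "B $$ (i, l) = 0" if "l < i" "i < n" for i l
    using ut that B by (auto dest: upper_triangularD)
  { case 1
    show ?case
    proof (rule upper_triangularI)
      fix i j assume ij: "j < i" "i < dim_row (B ^\<^sub>m Suc k)"
      then have "i < n" using B by simp
      have "(B ^\<^sub>m k) $$ (i, l) * B $$ (l, j) = 0" if "l < n" for l
        using z[of l i] zB[of j l] that ij \<open>i < n\<close> by (cases "l < i") auto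
      then show "(B ^\<^sub>m Suc k) $$ (i, j) = 0" using e[of i j] ij \<open>i < n\<close> by simp
    qed }
  { case (2 i)
    have "(B ^\<^sub>m k) $$ (i, l) * B $$ (l, i) = 0" if "l < n" "l \<noteq> i" for l
      using z[of l i] zB[of i l] that 2 by (cases "l < i") auto
    then have "(\<Sum>l<n. (B ^\<^sub>m k) $$ (i, l) * B $$ (l, i)) = (\<Sum>l\<in>{i}. (B ^\<^sub>m k) $$ (i, l) * B $$ (l, i))"
      using 2 by (intro sum.mono_neutral_right) auto
    then show ?case using e[of i i] 2 Suc(2)[OF 2] by (simp add: power_Suc2 del: power_Suc index_mult_mat) }
qed

text \<open>The power is similar to the power of a Schur triangular form with diagonal
  \<open>es\<close>. That diagonal lists the eigenvalues with algebraic multiplicity, which is how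
  the empirical spectral distribution counts them.\<close>

lemma mtrace_pow_eq_sum_list:
  fixes K :: "real mat"
  assumes K: "K \<in> carrier_mat n n" and cp: "char_poly K = (\<Prod>e\<leftarrow>es. [:- e, 1:])"
  shows "mtrace (K ^\<^sub>m k) = (\<Sum>e\<leftarrow>es. e ^ k)"
proof -
  obtain B P Q where schur: "schur_decomposition K es = (B, P, Q)"
    by (cases "schur_decomposition K es") auto
  note sd = schur_decomposition[OF K cp schur]
  have sim: "similar_mat_wit K B P Q" and ut: "upper_triangular B" and diag: "diag_mat B = es"
    using sd by auto
  note w = similar_mat_witD2[OF K sim]
  have B: "B \<in> carrier_mat n n" and P: "P \<in> carrier_mat n n" and Q: "Q \<in> carrier_mat n n"
    and QP: "Q * P = 1\<^sub>m n" using w by auto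
  have Bk: "B ^\<^sub>m k \<in> carrier_mat n n" using B by simp
  have "mtrace (K ^\<^sub>m k) = mtrace ((P * B ^\<^sub>m k) * Q)"
    using similar_mat_wit_pow_id[OF sim, of k] by simp
  also have "\<dots> = mtrace (Q * (P * B ^\<^sub>m k))"
    using P Q Bk by (intro mtrace_comm) auto
  also have "Q * (P * B ^\<^sub>m k) = (Q * P) * B ^\<^sub>m k"
    using P Q Bk by (simp add: assoc_mult_mat)
  also have "\<dots> = B ^\<^sub>m k" using QP left_mult_one_mat[OF Bk] by simp
  also have "mtrace (B ^\<^sub>m k) = (\<Sum>i<n. (B $$ (i, i)) ^ k)"
    unfolding mtrace_def using Bk upper_triangular_pow(2)[OF B ut] by (intro sum.cong) auto
  also have "\<dots> = (\<Sum>e\<leftarrow>es. e ^ k)"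
    using B diag[symmetric] by (simp add: diag_mat_def sum_list_sum_nth lessThan_atLeast0)
  finally show ?thesis .
qed

text \<open>At an eigenvector, the quadratic form \<open>S\<close> in the inner product weighted by
  \<open>d\<close> is \<open>l\<close> times the positive number \<open>r\<close>; the symmetry
  hypothesis makes \<open>S\<close> equal to its own conjugate.\<close>

lemma selfadjoint_eigenvalue_real:
  fixes K :: "real mat" and d :: "nat \<Rightarrow> real"
  assumes K: "K \<in> carrier_mat n n" and d: "\<And>i. i < n \<Longrightarrow> d i > 0"
    and sym: "\<And>i j. i < n \<Longrightarrow> j < n \<Longrightarrow> d i * K $$ (i, j) = d j * K $$ (j, i)"
    and ev: "eigenvalue (map_mat complex_of_real K) l"
  shows "l \<in> \<real>"
proof -
  obtain v where v: "v \<in> carrier_vec n" "v \<noteq> 0\<^sub>v n"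
    and eq: "map_mat complex_of_real K *\<^sub>v v = l \<cdot>\<^sub>v v"
    using ev K unfolding eigenvalue_def eigenvector_def by auto
  let ?x = "\<lambda>i. vec_index v i"
  have row: "(\<Sum>j<n. complex_of_real (K $$ (i, j)) * ?x j) = l * ?x i" if "i < n" for i
  proof -
    have "vec_index (map_mat complex_of_real K *\<^sub>v v) i = (\<Sum>j<n. complex_of_real (K $$ (i, j)) * ?x j)"
      using K v that by (auto simp: scalar_prod_def lessThan_atLeast0 intro!: sum.cong)
    then show ?thesis using eq v that by simp
  qed
  define S where "S = (\<Sum>i<n. \<Sum>j<n. complex_of_real (d i * K $$ (i, j)) * (cnj (?x i) * ?x j))"
  define r where "r = (\<Sum>i<n. d i * (cmod (?x i))\<^sup>2)"
  have "S = (\<Sum>i<n. complex_of_real (d i) * cnj (?x i) * (\<Sum>j<n. complex_of_real (K $$ (i, j)) * ?x j))"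
    unfolding S_def by (simp add: sum_distrib_left algebra_simps)
  also have "\<dots> = (\<Sum>i<n. l * complex_of_real (d i * (cmod (?x i))\<^sup>2))"
    by (intro sum.cong) (auto simp: row complex_norm_square simp del: of_real_power)
  also have "\<dots> = l * complex_of_real r"
    unfolding r_def by (simp add: sum_distrib_left)
  finally have S: "S = l * complex_of_real r" .
  have "cnj S = (\<Sum>i<n. \<Sum>j<n. complex_of_real (d i * K $$ (i, j)) * (?x i * cnj (?x j)))"
    unfolding S_def by simp
  also have "\<dots> = (\<Sum>j<n. \<Sum>i<n. complex_of_real (d j * K $$ (j, i)) * (?x i * cnj (?x j)))"
    by (subst sum.swap) (intro sum.cong; use sym in force)
  also have "\<dots> = S" unfolding S_def by (simp add: mult.commute)
  finally have "cnj S = S" .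
  have nz: "r > 0"
  proof -
    obtain i where i: "i < n" "?x i \<noteq> 0"
      using v by (metis eq_vecI carrier_vecD index_zero_vec(1) index_zero_vec(2))
    have "0 < d i * (cmod (?x i))\<^sup>2" using i d by simp
    also have "\<dots> \<le> r" unfolding r_def
      using i d by (intro member_le_sum) (auto simp: less_imp_le[OF d])
    finally show ?thesis .
  qed
  have "cnj l * complex_of_real r = l * complex_of_real r"
    using \<open>cnj S = S\<close> S by simp
  then have "cnj l = l" using nz by simp
  then show ?thesis by (simp add: Reals_cnj_iff)
qed

text \<open>Over the complex numbers the polynomial splits, all its roots are real by
  self-adjointness, and the factorisation descends because the embedding of real into complex
  polynomials is injective.\<close>

lemma selfadjoint_char_poly_splits:
  fixes K :: "real mat" and d :: "nat \<Rightarrow> real"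
  assumes K: "K \<in> carrier_mat n n" and d: "\<And>i. i < n \<Longrightarrow> d i > 0"
    and sym: "\<And>i j. i < n \<Longrightarrow> j < n \<Longrightarrow> d i * K $$ (i, j) = d j * K $$ (j, i)"
  obtains es where "char_poly K = (\<Prod>e\<leftarrow>es. [:- e, 1:])" "length es = n"
proof -
  interpret map_poly_inj_idom_hom complex_of_real ..
  let ?K = "map_mat complex_of_real K"
  have KC: "?K \<in> carrier_mat n n" using K by simp
  obtain as where as: "char_poly ?K = (\<Prod>a\<leftarrow>as. [:- a, 1:])" "length as = n"
    using char_poly_factorized[OF KC] by auto
  have "a \<in> \<real>" if "a \<in> set as" for a
  proof -
    have "poly (char_poly ?K) a = 0"
      using that by (auto simp: as(1) poly_prod_list_zero_iff)
    then have "eigenvalue ?K a" using eigenvalue_root_char_poly[OF KC] by simp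
    from selfadjoint_eigenvalue_real[OF K d sym this] show ?thesis .
  qed
  then have as_Re: "as = map (complex_of_real \<circ> Re) as"
    by (induction as) auto
  have "map_poly complex_of_real (char_poly K) = char_poly ?K"
    by (rule of_real_hom.char_poly_hom[OF K, symmetric])
  also have "\<dots> = map_poly complex_of_real (\<Prod>e\<leftarrow>map Re as. [:- e, 1:])"
    unfolding as(1) by (subst as_Re) (simp add: hom_prod_list o_def)
  finally have "char_poly K = (\<Prod>e\<leftarrow>map Re as. [:- e, 1:])" by simp
  then show ?thesis using that[of "map Re as"] as(2) by simp
qed

text \<open>At a coordinate of maximal modulus, the eigenvalue equation bounds \<open>l\<close>
  times this maximum by the row sum times the same maximum.\<close>

lemma eigenvalue_abs_le_1:
  fixes K :: "real mat"
  assumes K: "K \<in> carrier_mat n n" and nn: "\<And>i j. i < n \<Longrightarrow> j < n \<Longrightarrow> K $$ (i, j) \<ge> 0"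
    and le: "\<And>i. i < n \<Longrightarrow> (\<Sum>j<n. K $$ (i, j)) \<le> 1"
    and ev: "eigenvalue K l"
  shows "\<bar>l\<bar> \<le> 1"
proof -
  obtain v where v: "v \<in> carrier_vec n" "v \<noteq> 0\<^sub>v n" and eq: "K *\<^sub>v v = l \<cdot>\<^sub>v v"
    using ev K unfolding eigenvalue_def eigenvector_def by auto
  let ?x = "\<lambda>i. vec_index v i"
  have row: "(\<Sum>j<n. K $$ (i, j) * ?x j) = l * ?x i" if "i < n" for i
  proof -
    have "vec_index (K *\<^sub>v v) i = (\<Sum>j<n. K $$ (i, j) * ?x j)"
      using K v that by (auto simp: scalar_prod_def lessThan_atLeast0 intro!: sum.cong)
    then show ?thesis using eq v that by simp
  qed
  obtain i0 where i0: "i0 < n" "?x i0 \<noteq> 0"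
    using v by (metis eq_vecI carrier_vecD index_zero_vec(1) index_zero_vec(2))
  obtain i where i: "i < n" and max: "\<And>j. j < n \<Longrightarrow> \<bar>?x j\<bar> \<le> \<bar>?x i\<bar>"
  proof -
    let ?M = "Max ((\<lambda>j. \<bar>?x j\<bar>) ` {..<n})"
    have "?M \<in> (\<lambda>j. \<bar>?x j\<bar>) ` {..<n}" using i0 by (intro Max_in) auto
    then obtain i where "i < n" "?M = \<bar>?x i\<bar>" by auto
    then show ?thesis using that[of i] by (metis Max_ge finite_imageI finite_lessThan imageI lessThan_iff)
  qed
  have pos: "\<bar>?x i\<bar> > 0" using max[OF i0(1)] i0 by linarith
  have "\<bar>l\<bar> * \<bar>?x i\<bar> = \<bar>\<Sum>j<n. K $$ (i, j) * ?x j\<bar>"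
    using row[OF i] by (simp add: abs_mult)
  also have "\<dots> \<le> (\<Sum>j<n. \<bar>K $$ (i, j) * ?x j\<bar>)" by (rule sum_abs)
  also have "\<dots> \<le> (\<Sum>j<n. K $$ (i, j) * \<bar>?x i\<bar>)"
    using nn[OF i] max by (intro sum_mono) (auto simp: abs_mult intro!: mult_left_mono)
  also have "\<dots> = (\<Sum>j<n. K $$ (i, j)) * \<bar>?x i\<bar>" by (simp add: sum_distrib_right)
  also have "\<dots> \<le> 1 * \<bar>?x i\<bar>" using le[OF i] by (intro mult_right_mono) auto
  finally show ?thesis using pos by simp
qed

lemma order_prod_linear_factors:
  fixes x :: "'a :: idom"
  shows "Polynomial.order x (\<Prod>e\<leftarrow>es. [:- e, 1:]) = count_list es x"
proof -
  have "Polynomial.order x (\<Prod>e\<leftarrow>es. [:- e, 1:]) = sum_list (map (Polynomial.order x) (map (\<lambda>e. [:- e, 1:]) es))"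
    by (rule order_prod_list) auto
  also have "\<dots> = count_list es x"
    by (induction es) (auto simp: order_linear')
  finally show ?thesis .
qed

locale split_matrix =
  fixes K :: "real mat" and n :: nat and es :: "real list"
  assumes K: "K \<in> carrier_mat n n" and n_pos: "n > 0"
    and cp: "char_poly K = (\<Prod>e\<leftarrow>es. [:- e, 1:])" and len: "length es = n"
begin

lemma eigenvalues: "{x. eigenvalue K x} = set es"
  unfolding eigenvalue_root_char_poly[OF K] cp by (auto simp: poly_prod_list_zero_iff)

lemma esd_eq: "empirical_spectral_distribution K =
  distr (point_measure (set es) (\<lambda>x. ennreal (real (count_list es x) / real n))) borel (\<lambda>x. x)"
  using K unfolding empirical_spectral_distribution_def eigenvalues
  by (simp add: cp order_prod_linear_factors)

lemma integral_esd:
  assumes "g \<in> borel_measurable borel"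
  shows "(\<integral>x. g x \<partial>empirical_spectral_distribution K) = (\<Sum>e\<leftarrow>es. g e) / real n"
proof -
  have "(\<integral>x. g x \<partial>empirical_spectral_distribution K) =
    (\<integral>x. g x \<partial>point_measure (set es) (\<lambda>x. ennreal (real (count_list es x) / real n)))"
    unfolding esd_eq using assms by (subst integral_distr) auto
  also have "\<dots> = (\<Sum>x\<in>set es. (real (count_list es x) / real n) *\<^sub>R g x)"
    by (rule lebesgue_integral_point_measure_finite) auto
  also have "\<dots> = (\<Sum>x\<in>set es. real (count_list es x) * g x) / real n"
    by (simp add: sum_divide_distrib)
  also have "(\<Sum>x\<in>set es. real (count_list es x) * g x) = (\<Sum>e\<leftarrow>es. g e)"
  proof -
    \<comment> \<open>The index set is a fixed superset \<open>A\<close>, because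
      \<open>set es\<close> itself changes during the induction on \<open>es\<close>.\<close>
    have "(\<Sum>e\<leftarrow>es. g e) = (\<Sum>x\<in>A. real (count_list es x) * g x)" if "finite A" "set es \<subseteq> A" for A
      using that(2)
    proof (induction es)
      case (Cons a es)
      have "(\<Sum>x\<in>A. real (count_list (a # es) x) * g x) =
        (\<Sum>x\<in>A. (if a = x then g x else 0) + real (count_list es x) * g x)"
        by (intro sum.cong) (auto simp: algebra_simps)
      then show ?case using Cons that(1) by (simp add: sum.distrib sum.delta')
    qed simp
    from this[of "set es"] show ?thesis by simp
  qed
  finally show ?thesis .
qed

lemma real_distribution_esd: "real_distribution (empirical_spectral_distribution K)"
proof -
  let ?P = "point_measure (set es) (\<lambda>x. ennreal (real (count_list es x) / real n))"
  have "emeasure ?P (space ?P) = (\<Sum>x\<in>set es. ennreal (real (count_list es x) / real n))"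
    by (subst emeasure_point_measure_finite) (auto simp: space_point_measure)
  also have "\<dots> = ennreal (\<Sum>x\<in>set es. real (count_list es x) / real n)"
    by (rule sum_ennreal) auto
  also have "(\<Sum>x\<in>set es. real (count_list es x) / real n) = 1"
  proof -
    have "(\<Sum>x\<in>set es. count_list es x) = n"
      using sum_count_set[of es "set es"] len by simp
    then have "(\<Sum>x\<in>set es. real (count_list es x)) = real n"
      by (metis of_nat_sum)
    then show ?thesis using n_pos by (simp flip: sum_divide_distrib)
  qed
  finally have "prob_space ?P" by (intro prob_spaceI) simp
  then interpret P: prob_space ?P .
  show ?thesis
    unfolding esd_eq real_distribution_def real_distribution_axioms_def
    by (auto intro!: P.prob_space_distr)
qed

lemma AE_esd:
  assumes "\<And>e. e \<in> set es \<Longrightarrow> Q e"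
  shows "AE x in empirical_spectral_distribution K. Q x"
proof -
  have "finite (- set es \<inter> set es)" by simp
  have "AE x in empirical_spectral_distribution K. x \<in> set es"
    unfolding esd_eq by (subst AE_distr_iff) (auto simp: AE_point_measure finite_imp_closed pred_sets1)
  then show ?thesis by (rule eventually_mono) (rule assms)
qed

end

section \<open>Substochastic kernels and the walk matrix\<close>

text \<open>Functions on the vertex set stand in for matrices, whose indices start at 0 while the
  vertices start at 1. The power \<open>kpow\<close> adds its new factor on the left, where it is
  the first step of a walk.\<close>

definition kmul :: "'v set \<Rightarrow> ('v \<Rightarrow> 'v \<Rightarrow> real) \<Rightarrow> ('v \<Rightarrow> 'v \<Rightarrow> real) \<Rightarrow> 'v \<Rightarrow> 'v \<Rightarrow> real" where
  "kmul V A B x y = (\<Sum>z\<in>V. A x z * B z y)"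

primrec kpow :: "'v set \<Rightarrow> ('v \<Rightarrow> 'v \<Rightarrow> real) \<Rightarrow> nat \<Rightarrow> 'v \<Rightarrow> 'v \<Rightarrow> real" where
  "kpow V A 0 = (\<lambda>x y. if x = y then 1 else 0)"
| "kpow V A (Suc k) = kmul V A (kpow V A k)"

definition ktrace :: "'v set \<Rightarrow> ('v \<Rightarrow> 'v \<Rightarrow> real) \<Rightarrow> real" where
  "ktrace V A = (\<Sum>x\<in>V. A x x)"

definition substochastic :: "'v set \<Rightarrow> ('v \<Rightarrow> 'v \<Rightarrow> real) \<Rightarrow> bool" where
  "substochastic V A \<longleftrightarrow> (\<forall>x\<in>V. (\<forall>y\<in>V. 0 \<le> A x y) \<and> (\<Sum>y\<in>V. A x y) \<le> 1)"

lemma kmul_assoc: "kmul V (kmul V A B) C = kmul V A (kmul V B C)"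
proof (intro ext)
  fix x y
  have "kmul V (kmul V A B) C x y = (\<Sum>z\<in>V. \<Sum>t\<in>V. A x t * B t z * C z y)"
    by (simp add: kmul_def sum_distrib_right)
  also have "\<dots> = (\<Sum>t\<in>V. \<Sum>z\<in>V. A x t * B t z * C z y)" by (rule sum.swap)
  also have "\<dots> = kmul V A (kmul V B C) x y"
    by (simp add: kmul_def sum_distrib_left mult.assoc)
  finally show "kmul V (kmul V A B) C x y = kmul V A (kmul V B C) x y" .
qed

lemma ktrace_comm: "ktrace V (kmul V A B) = ktrace V (kmul V B A)"
  unfolding ktrace_def kmul_def by (subst sum.swap) (simp add: mult.commute)

lemma substochastic_nonneg: "substochastic V A \<Longrightarrow> x \<in> V \<Longrightarrow> y \<in> V \<Longrightarrow> 0 \<le> A x y"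
  by (simp add: substochastic_def)

lemma substochastic_sum_le: "substochastic V A \<Longrightarrow> x \<in> V \<Longrightarrow> (\<Sum>y\<in>V. A x y) \<le> 1"
  by (simp add: substochastic_def)

lemma substochastic_le_1:
  assumes "finite V" "substochastic V A" "x \<in> V" "y \<in> V"
  shows "A x y \<le> 1"
proof -
  have "A x y \<le> (\<Sum>y\<in>V. A x y)"
    using assms by (intro member_le_sum) (auto simp: substochastic_def)
  then show ?thesis using substochastic_sum_le[OF assms(2,3)] by simp
qed

lemma substochastic_kmul:
  assumes A: "substochastic V A" and B: "substochastic V B"
  shows "substochastic V (kmul V A B)"
  unfolding substochastic_def
proof (intro ballI conjI)
  fix x y assume x: "x \<in> V" and y: "y \<in> V"
  show "0 \<le> kmul V A B x y" unfolding kmul_def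
    using A B x y by (intro sum_nonneg mult_nonneg_nonneg) (auto simp: substochastic_def)
next
  fix x assume x: "x \<in> V"
  have "(\<Sum>y\<in>V. kmul V A B x y) = (\<Sum>z\<in>V. A x z * (\<Sum>y\<in>V. B z y))"
    unfolding kmul_def by (subst sum.swap) (simp add: sum_distrib_left)
  also have "\<dots> \<le> (\<Sum>z\<in>V. A x z * 1)"
    using A B x by (intro sum_mono mult_left_mono) (auto simp: substochastic_def)
  also have "\<dots> \<le> 1" using A x by (simp add: substochastic_def)
  finally show "(\<Sum>y\<in>V. kmul V A B x y) \<le> 1" .
qed

lemma substochastic_kpow:
  assumes "finite V" "substochastic V A"
  shows "substochastic V (kpow V A k)"
proof (induction k)
  case 0
  show ?case using assms(1) by (auto simp: substochastic_def)
next
  case (Suc k)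
  then show ?case using assms(2) by (simp add: substochastic_kmul)
qed

text \<open>The factors \<open>A\<close> are replaced by \<open>A'\<close> one at a time. A
  replacement only involves the rows in \<open>U\<close>, and each of these costs at most 2 because
  the rows of \<open>A\<close> and \<open>A'\<close> sum to at most 1 and the remaining product has
  entries in \<open>[0, 1]\<close>. The free factor \<open>M\<close> collects the factors that are
  already replaced.\<close>

lemma ktrace_kpow_diff_le:
  assumes V: "finite V" and U: "finite U" and A: "substochastic V A" and A': "substochastic V A'"
    and eq: "\<And>x y. x \<in> V - U \<Longrightarrow> y \<in> V \<Longrightarrow> A x y = A' x y"
    and M: "substochastic V M"
  shows "\<bar>ktrace V (kmul V (kpow V A k) M) - ktrace V (kmul V (kpow V A' k) M)\<bar>
    \<le> 2 * real (card U) * real k"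
  using M
proof (induction k arbitrary: M)
  case 0
  show ?case by simp
next
  case (Suc k)
  let ?B = "kmul V (kpow V A k) M"
  have B: "substochastic V ?B"
    using substochastic_kmul[OF substochastic_kpow[OF V A] Suc.prems] .
  have "ktrace V (kmul V (kpow V A (Suc k)) M) - ktrace V (kmul V A' ?B) =
    (\<Sum>x\<in>V. \<Sum>z\<in>V. (A x z - A' x z) * ?B z x)"
    by (simp add: ktrace_def kmul_assoc) (simp add: kmul_def sum_subtractf algebra_simps)
  also have "\<dots> = (\<Sum>x\<in>V \<inter> U. \<Sum>z\<in>V. (A x z - A' x z) * ?B z x)"
    using eq by (intro sum.mono_neutral_right) (auto simp: V intro!: sum.neutral)
  also have "\<bar>\<dots>\<bar> \<le> (\<Sum>x\<in>V \<inter> U. \<Sum>z\<in>V. \<bar>(A x z - A' x z) * ?B z x\<bar>)"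
    by (rule order.trans[OF sum_abs]) (intro sum_mono sum_abs)
  also have "\<dots> \<le> (\<Sum>x\<in>V \<inter> U. \<Sum>z\<in>V. (A x z + A' x z) * 1)"
  proof (intro sum_mono)
    fix x z assume x: "x \<in> V \<inter> U" and z: "z \<in> V"
    have "\<bar>?B z x\<bar> \<le> 1"
      using substochastic_nonneg[OF B z, of x] substochastic_le_1[OF V B z, of x] x by simp
    moreover have "\<bar>A x z - A' x z\<bar> \<le> A x z + A' x z"
      using substochastic_nonneg[OF A _ z, of x] substochastic_nonneg[OF A' _ z, of x] x by simp
    ultimately show "\<bar>(A x z - A' x z) * ?B z x\<bar> \<le> (A x z + A' x z) * 1"
      unfolding abs_mult by (intro mult_mono) auto
  qed
  also have "\<dots> \<le> (\<Sum>x\<in>V \<inter> U. 2)"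
    using substochastic_sum_le[OF A] substochastic_sum_le[OF A']
    by (intro sum_mono) (fastforce simp: sum.distrib)
  also have "\<dots> \<le> 2 * real (card U)"
    using card_mono[OF U, of "V \<inter> U"] by simp
  finally have 1: "\<bar>ktrace V (kmul V (kpow V A (Suc k)) M) - ktrace V (kmul V A' ?B)\<bar> \<le> 2 * real (card U)" .
  \<comment> \<open>Cyclicity of the trace moves the replaced factor \<open>A'\<close> to the right
    end, where it is absorbed into \<open>M\<close> for the induction hypothesis.\<close>
  have rot: "ktrace V (kmul V A' (kmul V C M)) = ktrace V (kmul V C (kmul V M A'))" for C
    by (metis kmul_assoc ktrace_comm)
  have 2: "\<bar>ktrace V (kmul V A' ?B) - ktrace V (kmul V (kpow V A' (Suc k)) M)\<bar> \<le> 2 * real (card U) * real k"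
    using Suc.IH[OF substochastic_kmul[OF Suc.prems A']] by (simp add: kmul_assoc rot)
  show ?case using 1 2 by (simp add: algebra_simps)
qed

lemma kmul_delta: "finite V \<Longrightarrow> y \<in> V \<Longrightarrow> kmul V A (kpow V B 0) x y = A x y"
  by (simp add: kmul_def if_distrib cong: if_cong)

section \<open>The walk kernel of a finite graph\<close>

definition walk_weight :: "real \<Rightarrow> nat \<Rightarrow> real" where
  "walk_weight c d = (if d = 0 then 0 else 1 / (c + real d))"

lemma walk_weight_0 [simp]: "walk_weight c 0 = 0"
  by (simp add: walk_weight_def)

lemma walk_weight_nonneg: "c \<ge> 0 \<Longrightarrow> 0 \<le> walk_weight c d"
  by (simp add: walk_weight_def)

lemma walk_weight_mult_le: "c \<ge> 0 \<Longrightarrow> real d * walk_weight c d \<le> 1"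
  by (simp add: walk_weight_def)

text \<open>The value 0 at degree 0 matters here: for \<open>0 < c < 1\<close> the general formula
  would give \<open>1 / c\<close>, which exceeds 1.\<close>

lemma walk_weight_le_1: "c \<ge> 0 \<Longrightarrow> walk_weight c d \<le> 1"
  by (simp add: walk_weight_def)

definition edge_degree :: "'v set set \<Rightarrow> 'v \<Rightarrow> nat" where
  "edge_degree E v = card {e \<in> E. v \<in> e}"

definition walk_kernel :: "real \<Rightarrow> 'v set set \<Rightarrow> 'v \<Rightarrow> 'v \<Rightarrow> real" where
  "walk_kernel c E x y = (if {x, y} \<in> E then walk_weight c (edge_degree E x) else 0)"

lemma finite_vertex_pairs: "finite (vertex_pairs n)"
  by (rule finite_subset[of _ "Pow {1..n}"]) (auto simp: vertex_pairs_def)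

lemma card_vertex_pairs_le: "card (vertex_pairs n) \<le> n\<^sup>2"
proof -
  have "card (vertex_pairs n) = n choose 2"
    unfolding vertex_pairs_def using n_subsets[of "{1..n}" 2] by simp
  also have "\<dots> \<le> n * (n - 1)" by (simp add: choose_two)
  also have "\<dots> \<le> n ^ 2" by (simp add: power2_eq_square)
  finally show ?thesis .
qed

lemma doubleton_in_vertex_pairs: "{x, y} \<in> vertex_pairs n \<longleftrightarrow> x \<in> {1..n} \<and> y \<in> {1..n} \<and> x \<noteq> y"
  by (auto simp: vertex_pairs_def card_2_iff doubleton_eq_iff card_insert_if)

lemma edge_degree_eq_card_neighbours:
  assumes E: "E \<subseteq> vertex_pairs n"
  shows "edge_degree E x = card {u\<in>{1..n}. {x, u} \<in> E}"
proof -
  have "bij_betw (\<lambda>u. {x, u}) {u\<in>{1..n}. {x, u} \<in> E} {e \<in> E. x \<in> e}"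
  proof (rule bij_betwI')
    fix u u' assume "u \<in> {u\<in>{1..n}. {x, u} \<in> E}" "u' \<in> {u\<in>{1..n}. {x, u} \<in> E}"
    then have "x \<noteq> u" "x \<noteq> u'" using E doubleton_in_vertex_pairs by blast+
    then show "({x, u} = {x, u'}) = (u = u')" by (auto simp: doubleton_eq_iff)
  next
    fix e assume e: "e \<in> {e \<in> E. x \<in> e}"
    then have "card e = 2" "e \<subseteq> {1..n}" using E by (auto simp: vertex_pairs_def)
    then obtain u where "e = {x, u}" using e by (auto simp: card_2_iff)
    then show "\<exists>u\<in>{u\<in>{1..n}. {x, u} \<in> E}. e = {x, u}" using e \<open>e \<subseteq> {1..n}\<close> by auto
  qed auto
  then show ?thesis unfolding edge_degree_def by (simp add: bij_betw_same_card)
qed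

lemma sum_walk_kernel:
  assumes E: "E \<subseteq> vertex_pairs n"
  shows "(\<Sum>u\<in>{1..n}. walk_kernel c E x u) = real (edge_degree E x) * walk_weight c (edge_degree E x)"
proof -
  have "(\<Sum>u\<in>{1..n}. walk_kernel c E x u) = (\<Sum>u\<in>{u\<in>{1..n}. {x, u} \<in> E}. walk_weight c (edge_degree E x))"
    unfolding walk_kernel_def by (intro sum.mono_neutral_cong_right) auto
  then show ?thesis using edge_degree_eq_card_neighbours[OF E] by simp
qed

lemma substochastic_walk_kernel:
  assumes "c \<ge> 0" and E: "E \<subseteq> vertex_pairs n"
  shows "substochastic {1..n} (walk_kernel c E)"
  unfolding substochastic_def
  using sum_walk_kernel[OF E] walk_weight_mult_le[OF assms(1)] walk_weight_nonneg[OF assms(1)]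
  by (auto simp: walk_kernel_def)

text \<open>Row \<open>x\<close> of the kernel depends only on the edges containing
  \<open>x\<close>, so only the rows of the two endpoints of \<open>e\<close> can differ; the bound
  is \<open>2 * 2 * k\<close>.\<close>

lemma ktrace_walk_kernel_edge_diff:
  assumes c: "c \<ge> 0" and E: "E \<subseteq> vertex_pairs n" and E': "E' \<subseteq> vertex_pairs n"
    and diff: "\<And>e'. e' \<noteq> e \<Longrightarrow> e' \<in> E \<longleftrightarrow> e' \<in> E'" and e: "card e = 2"
  shows "\<bar>ktrace {1..n} (kpow {1..n} (walk_kernel c E) k) -
    ktrace {1..n} (kpow {1..n} (walk_kernel c E') k)\<bar> \<le> 4 * real k"
proof -
  let ?V = "{1..n}"
  have id: "ktrace ?V (kmul ?V B (kpow ?V A 0)) = ktrace ?V B" for A B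
    unfolding ktrace_def by (intro sum.cong kmul_delta refl) auto
  have sub: "substochastic ?V (kpow ?V (walk_kernel c E) 0)"
    using substochastic_walk_kernel[OF c E] by (intro substochastic_kpow) auto
  have fin: "finite e" using e by (auto intro: card_ge_0_finite)
  have "\<bar>ktrace ?V (kmul ?V (kpow ?V (walk_kernel c E) k) (kpow ?V (walk_kernel c E) 0)) -
      ktrace ?V (kmul ?V (kpow ?V (walk_kernel c E') k) (kpow ?V (walk_kernel c E) 0))\<bar>
    \<le> 2 * real (card e) * real k"
  proof (rule ktrace_kpow_diff_le)
    fix x y assume x: "x \<in> ?V - e"
    have "{x, y} \<noteq> e" using x by auto
    then have "{x, y} \<in> E \<longleftrightarrow> {x, y} \<in> E'" by (rule diff)
    moreover have "{e \<in> E. x \<in> e} = {e \<in> E'. x \<in> e}" using x diff by auto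
    ultimately show "walk_kernel c E x y = walk_kernel c E' x y"
      by (simp add: walk_kernel_def edge_degree_def)
  qed (use substochastic_walk_kernel[OF c] E E' sub fin in auto)
  then show ?thesis unfolding id using e by simp
qed

section \<open>From the walk kernel to \<open>walk_matrix\<close>\<close>

lemma sum_adjacency_row:
  assumes E: "E \<subseteq> vertex_pairs n" and i: "i < n"
  shows "(\<Sum>j<n. adjacency_matrix n E $$ (i, j)) = real (edge_degree E (Suc i))"
proof -
  have "(\<Sum>j<n. adjacency_matrix n E $$ (i, j)) = (\<Sum>j<n. if {Suc i, Suc j} \<in> E then 1 else 0)"
    using i by (intro sum.cong) (auto simp: adjacency_matrix_def)
  also have "\<dots> = (\<Sum>u\<in>{1..n}. if {Suc i, u} \<in> E then 1 else 0)"
    by (rule sum.reindex_bij_witness[of _ "\<lambda>u. u - 1" Suc]) auto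
  also have "\<dots> = real (card {u\<in>{1..n}. {Suc i, u} \<in> E})"
    by (subst sum.inter_filter[symmetric]) auto
  finally show ?thesis using edge_degree_eq_card_neighbours[OF E] by simp
qed

definition degree_entry :: "real \<Rightarrow> nat set set \<Rightarrow> nat \<Rightarrow> real" where
  "degree_entry c E i = (if edge_degree E (Suc i) = 0 then 1 else c + real (edge_degree E (Suc i)))"

lemma degree_entry_pos: "c \<ge> 0 \<Longrightarrow> degree_entry c E i > 0"
  by (auto simp: degree_entry_def)

lemma degree_matrix_adjacency:
  assumes E: "E \<subseteq> vertex_pairs n"
  shows "degree_matrix c (adjacency_matrix n E) = mat_diag n (degree_entry c E)"
proof -
  let ?A = "adjacency_matrix n E"
  have dim: "dim_row ?A = n" "dim_col ?A = n" by (auto simp: adjacency_matrix_def)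
  have "row ?A i = 0\<^sub>v n \<longleftrightarrow> edge_degree E (Suc i) = 0" if i: "i < n" for i
  proof -
    have "row ?A i = 0\<^sub>v n \<longleftrightarrow> (\<forall>j<n. ?A $$ (i, j) = 0)"
      using i dim by (auto simp: vec_eq_iff)
    also have "\<dots> \<longleftrightarrow> (\<Sum>j<n. ?A $$ (i, j)) = 0"
      using i by (subst sum_nonneg_eq_0_iff) (auto simp: adjacency_matrix_def)
    finally show ?thesis using sum_adjacency_row[OF E i] by simp
  qed
  then show ?thesis unfolding degree_matrix_def dim
    using sum_adjacency_row[OF E] by (intro eq_matI) (auto simp: mat_diag_def degree_entry_def)
qed

lemma mat_inverse_mat_diag:
  fixes d :: "nat \<Rightarrow> real"
  assumes d: "\<And>i. d i \<noteq> 0"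
  shows "mat_inverse (mat_diag n d) = Some (mat_diag n (\<lambda>i. 1 / d i))"
proof -
  let ?D = "mat_diag n d" and ?D' = "mat_diag n (\<lambda>i. 1 / d i)"
  have inv: "?D * ?D' = 1\<^sub>m n" "?D' * ?D = 1\<^sub>m n" using d by simp_all
  have D: "?D \<in> carrier_mat n n" and D': "?D' \<in> carrier_mat n n" by auto
  have "?D \<in> Units (ring_mat TYPE(real) n ())"
    unfolding Units_def using inv D D' by (auto simp: ring_mat_simps simp del: mat_diag_diag intro!: bexI[of _ ?D'])
  then obtain B where B: "mat_inverse ?D = Some B"
    using mat_inverse(1)[OF D, of "()"] by (cases "mat_inverse ?D") auto
  from mat_inverse(2)[OF D this] have B': "B * ?D = 1\<^sub>m n" "B \<in> carrier_mat n n" by auto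
  have "B = B * (?D * ?D')" unfolding inv using B' by simp
  also have "\<dots> = (B * ?D) * ?D'" by (rule assoc_mult_mat[OF B'(2) D D', symmetric])
  also have "\<dots> = ?D'" unfolding B' using left_mult_one_mat[OF D'] .
  finally show ?thesis using B by simp
qed

lemma walk_matrix_adjacency:
  assumes c: "c \<ge> 0" and E: "E \<subseteq> vertex_pairs n"
  shows "walk_matrix c (adjacency_matrix n E) = mat n n (\<lambda>(i, j). walk_kernel c E (Suc i) (Suc j))"
proof -
  have nz: "degree_entry c E i \<noteq> 0" for i using degree_entry_pos[OF c] by (metis less_irrefl)
  have A: "adjacency_matrix n E \<in> carrier_mat n n" by (auto simp: adjacency_matrix_def)
  have "walk_matrix c (adjacency_matrix n E) = mat_diag n (\<lambda>i. 1 / degree_entry c E i) * adjacency_matrix n E"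
    unfolding walk_matrix_def degree_matrix_adjacency[OF E] mat_inverse_mat_diag[of "degree_entry c E", OF nz] by simp
  also have "\<dots> = mat n n (\<lambda>(i, j). 1 / degree_entry c E i * adjacency_matrix n E $$ (i, j))"
    by (rule mat_diag_mult_left[OF A])
  also have "\<dots> = mat n n (\<lambda>(i, j). walk_kernel c E (Suc i) (Suc j))"
  proof (intro eq_matI; clarsimp)
    fix i j assume ij: "i < n" "j < n"
    \<comment> \<open>The conventions for isolated vertices differ, 1 in \<open>degree_entry\<close>
      and 0 in \<open>walk_weight\<close>, but where there is an edge neither is invoked.\<close>
    have "edge_degree E (Suc i) \<noteq> 0" if "{Suc i, Suc j} \<in> E"
    proof -
      have "finite {u\<in>{1..n}. {Suc i, u} \<in> E}" "Suc j \<in> {u\<in>{1..n}. {Suc i, u} \<in> E}"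
        using that ij by auto
      then show ?thesis unfolding edge_degree_eq_card_neighbours[OF E] by (metis card_gt_0_iff empty_iff less_irrefl)
    qed
    then show "adjacency_matrix n E $$ (i, j) / degree_entry c E i = walk_kernel c E (Suc i) (Suc j)"
      using ij by (auto simp: adjacency_matrix_def walk_kernel_def degree_entry_def walk_weight_def)
  qed
  finally show ?thesis .
qed

text \<open>Detailed balance: the right-hand side is symmetric in \<open>i\<close> and
  \<open>j\<close>, which makes the walk matrix self-adjoint for the weights
  \<open>degree_entry\<close>.\<close>

lemma degree_entry_walk_kernel:
  assumes c: "c \<ge> 0" and E: "E \<subseteq> vertex_pairs n"
  shows "degree_entry c E i * walk_kernel c E (Suc i) (Suc j) = (if {Suc i, Suc j} \<in> E then 1 else 0)"
proof -
  have "finite E" using E finite_vertex_pairs finite_subset by blast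
  then have "edge_degree E (Suc i) \<noteq> 0" if "{Suc i, Suc j} \<in> E"
    using that unfolding edge_degree_def by (subst card_0_eq) auto
  then show ?thesis using c by (auto simp: degree_entry_def walk_kernel_def walk_weight_def)
qed

lemma walk_matrix_pow:
  assumes K: "K = mat n n (\<lambda>(i, j). A (Suc i) (Suc j))" and ij: "i < n" "j < n"
  shows "(K ^\<^sub>m k) $$ (i, j) = kpow {1..n} A k (Suc i) (Suc j)"
  using ij
proof (induction k arbitrary: i j)
  case 0
  then show ?case using K by simp
next
  case (Suc k)
  have KC: "K \<in> carrier_mat n n" using K by simp
  \<comment> \<open>Matrix powers grow on the right and \<open>kpow\<close> grows on the
    left.\<close>
  have comm: "K ^\<^sub>m k * K = K * K ^\<^sub>m k"
  proof (induction k)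
    case (Suc k)
    then show ?case using KC assoc_mult_mat[of K n n "K ^\<^sub>m k" n K n] by simp
  qed (use KC in auto)
  have "(K * K ^\<^sub>m k) $$ (i, j) = (\<Sum>l<n. K $$ (i, l) * (K ^\<^sub>m k) $$ (l, j))"
    using KC Suc.prems by (auto simp: scalar_prod_def lessThan_atLeast0 intro!: sum.cong)
  also have "\<dots> = (\<Sum>l<n. A (Suc i) (Suc l) * kpow {1..n} A k (Suc l) (Suc j))"
    using Suc K by (intro sum.cong) auto
  also have "\<dots> = (\<Sum>u\<in>{1..n}. A (Suc i) u * kpow {1..n} A k u (Suc j))"
    by (rule sum.reindex_bij_witness[of _ "\<lambda>u. u - 1" Suc]) auto
  finally show ?case using comm by (simp add: kmul_def)
qed

section \<open>The Efron--Stein inequality\<close>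

lemma finite_set_Pi_pmf_bool [simp, intro]:
  assumes "finite S"
  shows "finite (set_pmf (Pi_pmf S dflt (\<lambda>_. q :: bool pmf)))"
  by (rule finite_subset[OF set_Pi_pmf_subset'[OF assms]]) (auto intro!: finite_PiE_dflt assms)

lemma expectation_Pi_pmf_insert_bernoulli:
  fixes f :: "('e \<Rightarrow> bool) \<Rightarrow> real"
  assumes S: "finite S" "e \<notin> S" and a: "0 \<le> a" "a \<le> 1"
  shows "measure_pmf.expectation (Pi_pmf (insert e S) dflt (\<lambda>_. bernoulli_pmf a)) f =
    measure_pmf.expectation (Pi_pmf S dflt (\<lambda>_. bernoulli_pmf a))
      (\<lambda>x. a * f (x(e := True)) + (1 - a) * f (x(e := False)))"
proof -
  let ?P = "Pi_pmf S dflt (\<lambda>_. bernoulli_pmf a)"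
  have "finite (set_pmf ?P)" using S(1) by (rule finite_set_Pi_pmf_bool)
  then have int: "integrable ?P g" for g :: "('e \<Rightarrow> bool) \<Rightarrow> real"
    by (rule integrable_measure_pmf_finite)
  have "Pi_pmf (insert e S) dflt (\<lambda>_. bernoulli_pmf a) =
    bernoulli_pmf a \<bind> (\<lambda>b. map_pmf (\<lambda>x. x(e := b)) ?P)"
    using S by (subst Pi_pmf_insert') (auto simp: map_pmf_def)
  also have "measure_pmf.expectation \<dots> f =
    (\<Sum>b\<in>UNIV. pmf (bernoulli_pmf a) b *\<^sub>R measure_pmf.expectation (map_pmf (\<lambda>x. x(e := b)) ?P) f)"
    by (rule pmf_expectation_bind) (auto simp: \<open>finite (set_pmf ?P)\<close>)
  also have "\<dots> = a * measure_pmf.expectation ?P (\<lambda>x. f (x(e := True))) +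
      (1 - a) * measure_pmf.expectation ?P (\<lambda>x. f (x(e := False)))"
    using a by (simp add: UNIV_bool)
  also have "\<dots> = measure_pmf.expectation ?P (\<lambda>x. a * f (x(e := True)) + (1 - a) * f (x(e := False)))"
    using int by simp
  finally show ?thesis .
qed

text \<open>Efron-Stein by integrating out one coordinate at a time. The factor \<open>a\<close> in
  the bound is essential: the graph has of order \<open>n^2\<close> coordinates, and only
  \<open>a = p / n\<close> brings the total down.\<close>

lemma variance_Pi_pmf_bernoulli_le:
  fixes f :: "('e \<Rightarrow> bool) \<Rightarrow> real"
  assumes "finite S" and a: "0 \<le> a" "a \<le> 1"
    and "\<And>x e. e \<in> S \<Longrightarrow> \<bar>f (x(e := True)) - f (x(e := False))\<bar> \<le> L"
  shows "measure_pmf.expectation (Pi_pmf S dflt (\<lambda>_. bernoulli_pmf a)) (\<lambda>x. (f x)\<^sup>2) -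
      (measure_pmf.expectation (Pi_pmf S dflt (\<lambda>_. bernoulli_pmf a)) f)\<^sup>2
    \<le> real (card S) * (a * L\<^sup>2)"
  using assms(1,4)
proof (induction S arbitrary: f rule: finite_induct)
  case empty
  show ?case by simp
next
  case (insert e S)
  let ?P = "Pi_pmf S dflt (\<lambda>_. bernoulli_pmf a)"
  let ?E = "measure_pmf.expectation ?P"
  define g where "g x = a * f (x(e := True)) + (1 - a) * f (x(e := False))" for x
  have int: "integrable ?P h" for h :: "('e \<Rightarrow> bool) \<Rightarrow> real"
    by (rule integrable_measure_pmf_finite[OF finite_set_Pi_pmf_bool[OF insert(1)]])
  have L: "\<bar>f (x(e := True)) - f (x(e := False))\<bar> \<le> L" for x by (rule insert.prems) simp
  have gdiff: "\<bar>g (x(e' := True)) - g (x(e' := False))\<bar> \<le> L" if e': "e' \<in> S" for x e'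
  proof -
    have ne: "e' \<noteq> e" using e' insert by auto
    have "\<bar>g (x(e' := True)) - g (x(e' := False))\<bar> =
      \<bar>a * (f (x(e := True, e' := True)) - f (x(e := True, e' := False))) +
       (1 - a) * (f (x(e := False, e' := True)) - f (x(e := False, e' := False)))\<bar>"
      unfolding g_def using ne by (simp add: fun_upd_twist algebra_simps)
    also have "\<dots> \<le> a * L + (1 - a) * L"
    proof (intro order.trans[OF abs_triangle_ineq] add_mono)
      show "\<bar>a * (f (x(e := True, e' := True)) - f (x(e := True, e' := False)))\<bar> \<le> a * L"
        unfolding abs_mult using a e' by (intro mult_mono insert.prems) auto
      show "\<bar>(1 - a) * (f (x(e := False, e' := True)) - f (x(e := False, e' := False)))\<bar> \<le> (1 - a) * L"
        unfolding abs_mult using a e' by (intro mult_mono insert.prems) auto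
    qed
    finally show ?thesis by (simp add: algebra_simps)
  qed
  \<comment> \<open>The two-point variance identity \<open>a u^2 + (1 - a) v^2 = (a u + (1 - a) v)^2
    + a (1 - a) (u - v)^2\<close>, applied for each value of the other coordinates.\<close>
  have "?E (\<lambda>x. a * (f (x(e := True)))\<^sup>2 + (1 - a) * (f (x(e := False)))\<^sup>2) =
    ?E (\<lambda>x. (g x)\<^sup>2 + a * (1 - a) * (f (x(e := True)) - f (x(e := False)))\<^sup>2)"
    unfolding g_def by (intro Bochner_Integration.integral_cong) (auto simp: power2_eq_square algebra_simps)
  also have "\<dots> \<le> ?E (\<lambda>x. (g x)\<^sup>2 + a * L\<^sup>2)"
  proof (intro integral_mono int add_left_mono)
    fix x
    have "(f (x(e := True)) - f (x(e := False)))\<^sup>2 \<le> L\<^sup>2"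
      using L[of x] by (metis abs_ge_zero power2_abs power_mono)
    then show "a * (1 - a) * (f (x(e := True)) - f (x(e := False)))\<^sup>2 \<le> a * L\<^sup>2"
      using a by (intro mult_mono) (auto intro: mult_left_le)
  qed
  also have "\<dots> = ?E (\<lambda>x. (g x)\<^sup>2) + a * L\<^sup>2" using int by simp
  finally have "?E (\<lambda>x. a * (f (x(e := True)))\<^sup>2 + (1 - a) * (f (x(e := False)))\<^sup>2) - (?E g)\<^sup>2
    \<le> real (card S) * (a * L\<^sup>2) + a * L\<^sup>2"
    using insert.IH[of g, OF gdiff] by simp
  then show ?case
    using insert.hyps a
    by (simp add: expectation_Pi_pmf_insert_bernoulli g_def[abs_def] algebra_simps)
qed

section \<open>Walks on Galton--Watson trees\<close>

text \<open>The probability that the walk from \<open>x\<close> is at the root after the given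
  number of steps, unfolded along its first step. It is total on all words, so membership of
  \<open>x\<close> in the random tree enters only when it is compared with the walk.\<close>

primrec tree_return :: "real \<Rightarrow> (nat list \<Rightarrow> nat) \<Rightarrow> nat \<Rightarrow> nat list \<Rightarrow> real" where
  "tree_return c N 0 = (\<lambda>x. if x = [] then 1 else 0)"
| "tree_return c N (Suc k) = (\<lambda>x. walk_weight c (N x + (if x = [] then 0 else 1)) *
     ((if x = [] then 0 else tree_return c N k (butlast x)) + (\<Sum>i<N x. tree_return c N k (x @ [i]))))"

text \<open>\<open>walk_state\<close> appends the last step, whereas all later recursions split off
  the first one.\<close>

lemma walk_state_Suc_start:
  "walk_state adj x c (Suc k) = walk_step adj c (Some x) \<bind>
     (\<lambda>s. case s of None \<Rightarrow> return_pmf None | Some y \<Rightarrow> walk_state adj y c k)"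
proof (induction k)
  case 0
  have "(\<lambda>s. case s of None \<Rightarrow> return_pmf None | Some y \<Rightarrow> walk_state adj y c 0) = return_pmf"
    by (auto split: option.split)
  then show ?case by (simp add: bind_return_pmf bind_return_pmf')
next
  case (Suc k)
  have *: "(case s of None \<Rightarrow> return_pmf None | Some y \<Rightarrow> walk_state adj y c k) \<bind> walk_step adj c =
    (case s of None \<Rightarrow> return_pmf None | Some y \<Rightarrow> walk_state adj y c (Suc k))" for s
    by (auto split: option.split simp: bind_return_pmf)
  have "walk_state adj x c (Suc (Suc k)) = walk_state adj x c (Suc k) \<bind> walk_step adj c"
    by simp
  also have "\<dots> = walk_step adj c (Some x) \<bind> (\<lambda>s. (case s of None \<Rightarrow> return_pmf None
      | Some y \<Rightarrow> walk_state adj y c k) \<bind> walk_step adj c)"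
    unfolding Suc by (rule bind_assoc_pmf)
  finally show ?case unfolding * .
qed

lemma pmf_walk_state_Suc:
  assumes c: "c \<ge> 0" and fin: "finite (neighbours adj x)"
  shows "pmf (walk_state adj x c (Suc k)) (Some v) =
    walk_weight c (degree_of adj x) * (\<Sum>u\<in>neighbours adj x. pmf (walk_state adj u c k) (Some v))"
proof (cases "degree_of adj x = 0")
  case True
  then show ?thesis unfolding walk_state_Suc_start by (simp add: bind_return_pmf)
next
  case False
  let ?f = "\<lambda>s. pmf (case s of None \<Rightarrow> return_pmf None | Some y \<Rightarrow> walk_state adj y c k) (Some v)"
  have "pmf (walk_state adj x c (Suc k)) (Some v) = measure_pmf.expectation (walk_step adj c (Some x)) ?f"
    unfolding walk_state_Suc_start by (rule pmf_bind)
  also have "\<dots> = (\<Sum>s\<in>Some ` neighbours adj x. pmf (walk_step adj c (Some x)) s *\<^sub>R ?f s)"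
  proof (rule integral_measure_pmf)
    fix s assume s: "s \<in> set_pmf (walk_step adj c (Some x))" "?f s \<noteq> 0"
    then obtain u where u: "s = Some u" by (cases s) auto
    have "adj x u"
      using s(1) pmf_walk_step(2)[OF c, of adj x u] False unfolding u
      by (auto simp: set_pmf_iff split: if_splits simp del: walk_step.simps)
    then show "s \<in> Some ` neighbours adj x" using u by (simp add: neighbours_def)
  qed (use fin in auto)
  also have "\<dots> = (\<Sum>u\<in>neighbours adj x. walk_weight c (degree_of adj x) * pmf (walk_state adj u c k) (Some v))"
    using False by (subst sum.reindex)
      (auto simp: pmf_walk_step(2)[OF c] neighbours_def walk_weight_def simp del: walk_step.simps intro!: sum.cong)
  finally show ?thesis by (simp add: sum_distrib_left)
qed

lemma butlast_neq_snoc: "butlast x \<noteq> x @ [i]"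
proof
  assume "butlast x = x @ [i]"
  then have "length (butlast x) = Suc (length x)" by simp
  then show False by simp
qed

lemma Nil_in_tree_vertices: "[] \<in> tree_vertices N"
  by (simp add: tree_vertices_def)

lemma snoc_in_tree_vertices: "x @ [i] \<in> tree_vertices N \<longleftrightarrow> x \<in> tree_vertices N \<and> i < N x"
proof
  assume *: "x @ [i] \<in> tree_vertices N"
  have "j < N v" if "x = v @ j # w" for v j w
    using * that unfolding tree_vertices_def by auto
  then show "x \<in> tree_vertices N \<and> i < N x"
    using * unfolding tree_vertices_def by auto
next
  assume *: "x \<in> tree_vertices N \<and> i < N x"
  have "j < N v" if "x @ [i] = v @ j # w" for v j w
    using * that by (cases w rule: rev_cases) (auto simp: tree_vertices_def)
  then show "x @ [i] \<in> tree_vertices N" unfolding tree_vertices_def by auto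
qed

lemma neighbours_tree:
  assumes x: "x \<in> tree_vertices N"
  shows "neighbours (tree_adj N) x = (if x = [] then {} else {butlast x}) \<union> (\<lambda>i. x @ [i]) ` {..<N x}"
proof -
  have "butlast x \<in> tree_vertices N" if "x \<noteq> []"
    using x snoc_in_tree_vertices[of "butlast x" "last x" N] that by simp
  moreover have "(\<exists>i. x = u @ [i]) \<longleftrightarrow> x \<noteq> [] \<and> u = butlast x" for u
    by (cases x rule: rev_cases) auto
  ultimately show ?thesis
    using x unfolding neighbours_def tree_adj_def
    by (auto simp: snoc_in_tree_vertices snoc_in_tree_vertices[of "[]", simplified] ex_disj_distrib)
qed

lemma sum_neighbours_tree:
  fixes f :: "nat list \<Rightarrow> real"
  assumes x: "x \<in> tree_vertices N"
  shows "(\<Sum>u\<in>neighbours (tree_adj N) x. f u) =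
    (if x = [] then 0 else f (butlast x)) + (\<Sum>i<N x. f (x @ [i]))"
proof -
  have "(\<Sum>u\<in>neighbours (tree_adj N) x. f u) =
    (\<Sum>u\<in>(if x = [] then {} else {butlast x}). f u) + (\<Sum>u\<in>(\<lambda>i. x @ [i]) ` {..<N x}. f u)"
    unfolding neighbours_tree[OF x] using butlast_neq_snoc[of x] by (intro sum.union_disjoint) auto
  then show ?thesis by (subst (asm) sum.reindex) (auto simp: inj_on_def)
qed

lemma degree_of_tree:
  assumes x: "x \<in> tree_vertices N"
  shows "degree_of (tree_adj N) x = N x + (if x = [] then 0 else 1)"
proof -
  have "real (degree_of (tree_adj N) x) = real (N x + (if x = [] then 0 else 1))"
    using sum_neighbours_tree[OF x, of "\<lambda>_. 1"] by (simp add: degree_of_def)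
  then show ?thesis by linarith
qed

lemma tree_return_eq_pmf:
  assumes c: "c \<ge> 0" and x: "x \<in> tree_vertices N"
  shows "tree_return c N k x = pmf (walk_state (tree_adj N) x c k) (Some [])"
  using x
proof (induction k arbitrary: x)
  case 0
  then show ?case by (auto simp: pmf_return)
next
  case (Suc k)
  have fin: "finite (neighbours (tree_adj N) x)"
    unfolding neighbours_tree[OF Suc.prems] by simp
  have IH: "tree_return c N k u = pmf (walk_state (tree_adj N) u c k) (Some [])"
    if "u \<in> neighbours (tree_adj N) x" for u
    using that by (intro Suc.IH) (auto simp: neighbours_def tree_adj_def)
  have "tree_return c N (Suc k) x = walk_weight c (degree_of (tree_adj N) x) *
    (\<Sum>u\<in>neighbours (tree_adj N) x. tree_return c N k u)"
    using degree_of_tree[OF Suc.prems] sum_neighbours_tree[OF Suc.prems, of "tree_return c N k"] by simp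
  also have "\<dots> = pmf (walk_state (tree_adj N) x c (Suc k)) (Some [])"
    unfolding pmf_walk_state_Suc[OF c fin] using IH by simp
  finally show ?case .
qed

lemma return_probability_tree:
  "c \<ge> 0 \<Longrightarrow> return_probability k (tree_adj N) [] c = tree_return c N k []"
  by (simp add: return_probability_def tree_return_eq_pmf Nil_in_tree_vertices)

lemma tree_return_bounds:
  assumes c: "c \<ge> 0"
  shows "0 \<le> tree_return c N k x \<and> tree_return c N k x \<le> 1"
proof (induction k arbitrary: x)
  case (Suc k)
  let ?S = "(if x = [] then 0 else tree_return c N k (butlast x)) + (\<Sum>i<N x. tree_return c N k (x @ [i]))"
  let ?d = "N x + (if x = [] then 0 else 1)"
  have "(\<Sum>i<N x. tree_return c N k (x @ [i])) \<le> (\<Sum>i<N x. 1)"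
    using Suc by (intro sum_mono) auto
  then have le: "?S \<le> real ?d" using Suc[of "butlast x"] by auto
  have "0 \<le> (\<Sum>i<N x. tree_return c N k (x @ [i]))"
    using Suc by (intro sum_nonneg) auto
  then have nn: "0 \<le> ?S" using Suc[of "butlast x"] by auto
  have "walk_weight c ?d * ?S \<le> walk_weight c ?d * real ?d"
    using le walk_weight_nonneg[OF c] by (intro mult_left_mono) auto
  also have "\<dots> \<le> 1" using walk_weight_mult_le[OF c, of ?d] by (simp add: mult.commute)
  finally show ?case using nn walk_weight_nonneg[OF c] by simp
qed simp

text \<open>Every step changes the depth by one. This is the source of the symmetry of the limit
  law.\<close>

lemma tree_return_odd:
  "odd (k + length x) \<Longrightarrow> tree_return c N k x = 0"
  by (induction k arbitrary: x) auto

section \<open>Measurability and finite-dimensional integrals under the Galton-Watson law\<close>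

lemma measurable_galton_watson_coord [measurable]:
  "(\<lambda>N. N v) \<in> galton_watson Q \<rightarrow>\<^sub>M count_space UNIV"
proof -
  have "(\<lambda>N. N v) \<in> galton_watson Q \<rightarrow>\<^sub>M measure_pmf Q"
    unfolding galton_watson_def by (rule measurable_component_singleton) simp
  then show ?thesis by simp
qed

lemma measurable_tree_return [measurable]:
  "(\<lambda>N. tree_return c N k x) \<in> borel_measurable (galton_watson Q)"
proof (induction k arbitrary: x)
  case (Suc k)
  \<comment> \<open>The number of summands is random; it takes countably many values, and for each
    fixed value the sum is measurable.\<close>
  have "(\<lambda>N. (\<lambda>m N. \<Sum>i<m. tree_return c N k (x @ [i])) (N x) N) \<in> borel_measurable (galton_watson Q)"
    by (rule measurable_compose_countable[OF _ measurable_galton_watson_coord])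
      (intro borel_measurable_sum Suc)
  moreover have "(\<lambda>N. walk_weight c (N x + (if x = [] then 0 else 1))) \<in> borel_measurable (galton_watson Q)"
    by (rule measurable_compose[OF measurable_galton_watson_coord]) simp
  ultimately show ?case
    using Suc[of "butlast x"] by (auto intro!: borel_measurable_times borel_measurable_add)
qed simp

lemma prob_space_galton_watson: "prob_space (galton_watson Q)"
  unfolding galton_watson_def by (intro prob_space_PiM) (rule prob_space_measure_pmf)

lemma space_galton_watson [simp]: "space (galton_watson Q) = UNIV"
  by (simp add: galton_watson_def space_PiM)

text \<open>Only the coordinates in \<open>H\<close> matter, so the infinite product is projected to
  a finite one, where independence is Fubini's theorem.\<close>

lemma galton_watson_integral_prod:
  fixes h :: "nat list \<Rightarrow> nat \<Rightarrow> real"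
  assumes H: "finite H" and h: "\<And>v. v \<in> H \<Longrightarrow> integrable (measure_pmf Q) (h v)"
  shows "integrable (galton_watson Q) (\<lambda>N. \<Prod>v\<in>H. h v (N v))"
    and "(\<integral>N. (\<Prod>v\<in>H. h v (N v)) \<partial>galton_watson Q) = (\<Prod>v\<in>H. \<integral>m. h v m \<partial>measure_pmf Q)"
proof -
  interpret product_sigma_finite "\<lambda>_ :: nat list. measure_pmf Q" ..
  have D: "distr (galton_watson Q) (\<Pi>\<^sub>M v\<in>H. measure_pmf Q) (\<lambda>N. \<lambda>v\<in>H. N v) = (\<Pi>\<^sub>M v\<in>H. measure_pmf Q)"
    using distr_PiM_reindex[of UNIV "\<lambda>_. measure_pmf Q" id H] unfolding galton_watson_def
    by (simp add: prob_space_measure_pmf)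
  have meas: "(\<lambda>N. \<lambda>v\<in>H. N v) \<in> galton_watson Q \<rightarrow>\<^sub>M (\<Pi>\<^sub>M v\<in>H. measure_pmf Q)"
    by (intro measurable_restrict) simp
  have I: "integrable (\<Pi>\<^sub>M v\<in>H. measure_pmf Q) (\<lambda>y. \<Prod>v\<in>H. h v (y v))"
    by (rule product_integrable_prod[OF H h])
  have eq: "(\<Prod>v\<in>H. h v ((\<lambda>v\<in>H. N v) v)) = (\<Prod>v\<in>H. h v (N v))" for N
    by (intro prod.cong) auto
  show "integrable (galton_watson Q) (\<lambda>N. \<Prod>v\<in>H. h v (N v))"
    using I integrable_distr[OF meas, of "\<lambda>y. \<Prod>v\<in>H. h v (y v)"] unfolding D eq by simp
  have "(\<integral>N. (\<Prod>v\<in>H. h v (N v)) \<partial>galton_watson Q) =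
    (\<integral>y. (\<Prod>v\<in>H. h v (y v)) \<partial>distr (galton_watson Q) (\<Pi>\<^sub>M v\<in>H. measure_pmf Q) (\<lambda>N. \<lambda>v\<in>H. N v))"
    using borel_measurable_integrable[OF I] by (subst integral_distr[OF meas]) (simp_all add: eq)
  also have "\<dots> = (\<Prod>v\<in>H. \<integral>m. h v m \<partial>measure_pmf Q)"
    unfolding D by (rule product_integral_prod[OF H h])
  finally show "(\<integral>N. (\<Prod>v\<in>H. h v (N v)) \<partial>galton_watson Q) = (\<Prod>v\<in>H. \<integral>m. h v m \<partial>measure_pmf Q)" .
qed

section \<open>Exchangeability of siblings\<close>

definition sibling_swap :: "nat list \<Rightarrow> nat \<Rightarrow> nat \<Rightarrow> nat list \<Rightarrow> nat list" where
  "sibling_swap x a b y =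
     (if take (length x) y = x then y[length x := Transposition.transpose a b (y ! length x)] else y)"

lemma sibling_swap_append: "sibling_swap x a b (x @ i # w) = x @ Transposition.transpose a b i # w"
  by (simp add: sibling_swap_def)

lemma length_sibling_swap [simp]: "length (sibling_swap x a b y) = length y"
  by (simp add: sibling_swap_def)

lemma sibling_swap_eq_Nil [simp]: "sibling_swap x a b y = [] \<longleftrightarrow> y = []"
  by (metis length_0_conv length_sibling_swap)

text \<open>For the word \<open>x\<close> the updated position lies just past the end of the list,
  so nothing changes: the exchanged subtrees hang strictly below \<open>x\<close>.\<close>

lemma sibling_swap_self [simp]: "sibling_swap x a b x = x"
  by (simp add: sibling_swap_def list_update_beyond)

lemma sibling_swap_other:
  assumes "\<And>i w. y \<noteq> x @ i # w"
  shows "sibling_swap x a b y = y"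
proof (cases "take (length x) y = x")
  case True
  then have "y = x @ drop (length x) y" by (metis append_take_drop_id)
  then have "drop (length x) y = []" using assms by (cases "drop (length x) y") metis+
  then show ?thesis by (simp add: sibling_swap_def list_update_beyond)
qed (simp add: sibling_swap_def)

lemma sibling_swap_cases:
  obtains (below) i w where "y = x @ i # w" | (other) "\<And>i w. y \<noteq> x @ i # w"
  by blast

lemma sibling_swap_involutive: "sibling_swap x a b (sibling_swap x a b y) = y"
  by (cases y x rule: sibling_swap_cases) (auto simp: sibling_swap_append sibling_swap_other)

lemma bij_sibling_swap: "bij (sibling_swap x a b)"
  by (rule o_bij[of "sibling_swap x a b"]) (auto simp: sibling_swap_involutive fun_eq_iff)

lemma sibling_swap_snoc:
  assumes "y \<noteq> x"
  shows "sibling_swap x a b (y @ [i]) = sibling_swap x a b y @ [i]"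
proof (cases y x rule: sibling_swap_cases)
  case (below j w)
  then show ?thesis using sibling_swap_append[of x a b j "w @ [i]"] by (simp add: sibling_swap_append)
next
  case other
  have "y @ [i] \<noteq> x @ j # w" for j w
    using other assms by (cases w rule: rev_cases) auto
  then show ?thesis using other by (simp add: sibling_swap_other)
qed

lemma sibling_swap_butlast:
  "sibling_swap x a b (butlast y) = butlast (sibling_swap x a b y)"
proof (cases y rule: rev_cases)
  case (snoc z i)
  then show ?thesis
    by (cases "z = x") (auto simp: sibling_swap_snoc sibling_swap_append)
qed (simp add: sibling_swap_def)

text \<open>Relabelling is an isomorphism of trees. Away from \<open>x\<close> the swap commutes
  with appending a child label; at \<open>x\<close> it permutes the children, which needs both
  labels to be below \<open>N x\<close>.\<close>

lemma tree_return_sibling_swap: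
  assumes a: "a < N x" and b: "b < N x"
  shows "tree_return c (N \<circ> sibling_swap x a b) k y = tree_return c N k (sibling_swap x a b y)"
proof (induction k arbitrary: y)
  case (Suc k)
  let ?s = "sibling_swap x a b"
  have "(\<Sum>i<N (?s y). tree_return c N k (?s (y @ [i]))) = (\<Sum>i<N (?s y). tree_return c N k (?s y @ [i]))"
  proof (cases "y = x")
    case True
    have "Transposition.transpose a b permutes {..<N x}"
      using a b by (intro permutes_swap_id) auto
    then have "(\<Sum>i<N x. tree_return c N k (x @ [Transposition.transpose a b i])) = (\<Sum>i<N x. tree_return c N k (x @ [i]))"
      using sum.permute[of "Transposition.transpose a b" "{..<N x}" "\<lambda>i. tree_return c N k (x @ [i])"] by (simp add: o_def)
    then show ?thesis unfolding True by (simp add: sibling_swap_append)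
  qed (simp add: sibling_swap_snoc)
  then show ?case using Suc by (simp add: sibling_swap_butlast)
qed simp

lemma measurable_galton_watson_reindex [measurable]:
  "(\<lambda>N. N \<circ> \<sigma>) \<in> galton_watson Q \<rightarrow>\<^sub>M galton_watson Q"
proof -
  have "(\<lambda>N. \<lambda>v\<in>UNIV. N (\<sigma> v)) \<in> galton_watson Q \<rightarrow>\<^sub>M (\<Pi>\<^sub>M v\<in>UNIV. measure_pmf Q)"
    by (intro measurable_restrict) simp
  then show ?thesis by (simp add: galton_watson_def o_def restrict_UNIV)
qed

text \<open>An injective relabelling of independent, identically distributed coordinates does not
  change their joint law.\<close>

lemma nn_integral_galton_watson_reindex:
  assumes \<sigma>: "inj \<sigma>" and [measurable]: "f \<in> borel_measurable (galton_watson Q)"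
  shows "(\<integral>\<^sup>+N. f (N \<circ> \<sigma>) \<partial>galton_watson Q) = (\<integral>\<^sup>+N. f N \<partial>galton_watson Q)"
proof -
  have D: "distr (galton_watson Q) (galton_watson Q) (\<lambda>N. N \<circ> \<sigma>) = galton_watson Q"
    using distr_PiM_reindex[of UNIV "\<lambda>_. measure_pmf Q" \<sigma> UNIV] \<sigma>
    unfolding galton_watson_def by (simp add: prob_space_measure_pmf o_def restrict_UNIV)
  have "(\<integral>\<^sup>+N. f N \<partial>galton_watson Q) = (\<integral>\<^sup>+N. f N \<partial>distr (galton_watson Q) (galton_watson Q) (\<lambda>N. N \<circ> \<sigma>))"
    unfolding D ..
  also have "\<dots> = (\<integral>\<^sup>+N. f (N \<circ> \<sigma>) \<partial>galton_watson Q)"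
    by (rule nn_integral_distr) measurable
  finally show ?thesis ..
qed

section \<open>Falling factorials and the Mecke equation\<close>

definition falling :: "nat \<Rightarrow> nat \<Rightarrow> nat" where
  "falling m j = (\<Prod>i<j. m - i)"

lemma falling_0 [simp]: "falling m 0 = 1"
  by (simp add: falling_def)

lemma falling_Suc: "falling m (Suc j) = falling m j * (m - j)"
  by (simp add: falling_def)

lemma falling_eq_0: "m < j \<Longrightarrow> falling m j = 0"
  unfolding falling_def by (rule prod_zero) auto

lemma falling_add: "falling (m + j) j = fact (m + j) div fact m"
proof -
  have "falling (m + j) j * fact m = fact (m + j)"
  proof (induction j)
    case (Suc j)
    have "falling (Suc (m + j)) (Suc j) = Suc (m + j) * falling (m + j) j"
      unfolding falling_def by (subst prod.lessThan_Suc_shift) simp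
    then have "falling (m + Suc j) (Suc j) * fact m = Suc (m + j) * (falling (m + j) j * fact m)"
      by (simp del: mult_Suc add: mult.assoc)
    also have "\<dots> = fact (m + Suc j)" unfolding Suc by simp
    finally show ?case .
  qed simp
  then show ?thesis by (metis fact_nonzero nonzero_mult_div_cancel_right)
qed

lemma falling_add_fact: "falling (m + j) j * fact m = fact (m + j)"
  by (simp add: falling_add dvd_div_mult_self fact_dvd)

text \<open>Pointwise, the Poisson mass at \<open>m + j\<close> times the falling factorial is
  \<open>p ^ j\<close> times the mass at \<open>m\<close>. Since the falling factorial vanishes
  below \<open>j\<close>, the sum may be restricted to \<open>{j..}\<close> and shifted.\<close>

lemma poisson_mecke:
  assumes p: "p > 0" and bdd: "\<And>m. \<bar>f m\<bar> \<le> C"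
  shows "integrable (measure_pmf (poisson_pmf p)) (\<lambda>m. real (falling m j) * f m)"
    and "(\<integral>m. real (falling m j) * f m \<partial>measure_pmf (poisson_pmf p)) =
      p ^ j * (\<integral>m. f (m + j) \<partial>measure_pmf (poisson_pmf p))"
proof -
  let ?P = "measure_pmf (poisson_pmf p)"
  have pt: "pmf (poisson_pmf p) (m + j) * real (falling (m + j) j) = p ^ j * pmf (poisson_pmf p) m" for m
  proof -
    have "real (falling (m + j) j) * fact m = fact (m + j)"
      using falling_add_fact[of m j] by (metis of_nat_fact of_nat_mult)
    then have "real (falling (m + j) j) = fact (m + j) / fact m" by (simp add: field_simps)
    then show ?thesis using p by (simp add: field_simps power_add)
  qed
  have z: "real (falling m j) = 0" if "m < j" for m using that falling_eq_0 by simp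
  have intf: "integrable ?P (\<lambda>m. f (m + j))"
    by (rule measure_pmf.integrable_const_bound[of _ C]) (use bdd in auto)
  have lhs: "integral\<^sup>L ?P h = (\<integral>m. pmf (poisson_pmf p) m * h m \<partial>count_space UNIV)" for h :: "nat \<Rightarrow> real"
    unfolding measure_pmf_eq_density by (subst integral_density) auto
  have intc: "integrable ?P h \<longleftrightarrow> integrable (count_space UNIV) (\<lambda>m. pmf (poisson_pmf p) m * h m)" for h :: "nat \<Rightarrow> real"
    unfolding measure_pmf_eq_density by (subst integrable_density) auto
  let ?g = "\<lambda>m. pmf (poisson_pmf p) m * (real (falling m j) * f m)"
  have gj: "?g (m + j) = p ^ j * (pmf (poisson_pmf p) m * f (m + j))" for m
    using pt[of m] by (simp add: mult.assoc[symmetric])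
  have bij: "bij_betw (\<lambda>m. m + j) UNIV {j..}"
    by (rule bij_betw_byWitness[of _ "\<lambda>m. m - j"]) auto
  have "integrable (count_space UNIV) (\<lambda>m. ?g (m + j))"
    unfolding gj using intf[unfolded intc] by simp
  then have "integrable (count_space {j..}) ?g"
    using integrable_bij_count_space[OF bij, of ?g] by simp
  then have "integrable (restrict_space (count_space UNIV) {j..}) ?g"
    by (simp add: restrict_count_space)
  then have "integrable (count_space UNIV) (\<lambda>m. indicator {j..} m *\<^sub>R ?g m)"
    by (subst (asm) integrable_restrict_space) auto
  moreover have ind: "indicator {j..} m *\<^sub>R ?g m = ?g m" for m
    using z[of m] by (auto simp: indicator_def)
  ultimately show "integrable ?P (\<lambda>m. real (falling m j) * f m)"
    unfolding intc ind by blast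
  have "(\<integral>m. real (falling m j) * f m \<partial>?P) = (\<integral>m. indicator {j..} m *\<^sub>R ?g m \<partial>count_space UNIV)"
    unfolding lhs ind ..
  also have "\<dots> = (\<integral>m. ?g m \<partial>count_space {j..})"
    by (subst integral_restrict_space[symmetric]) (auto simp: restrict_count_space)
  also have "\<dots> = (\<integral>m. ?g (m + j) \<partial>count_space UNIV)"
    by (rule integral_bij_count_space[OF bij, symmetric])
  also have "\<dots> = p ^ j * (\<integral>m. f (m + j) \<partial>?P)"
    unfolding gj lhs by simp
  finally show "(\<integral>m. real (falling m j) * f m \<partial>?P) = p ^ j * (\<integral>m. f (m + j) \<partial>?P)" .
qed

definition canonical_tree :: "nat list set \<Rightarrow> (nat list \<Rightarrow> nat) \<Rightarrow> bool" where
  "canonical_tree H J \<longleftrightarrow> finite H \<and> [] \<in> H \<and> (\<forall>x i. x @ [i] \<in> H \<longleftrightarrow> x \<in> H \<and> i < J x) \<and>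
     (\<forall>x. x \<notin> H \<longrightarrow> J x = 0)"

lemma canonical_tree_prefix:
  assumes "canonical_tree H J"
  shows "x @ w \<in> H \<Longrightarrow> x \<in> H"
proof (induction w rule: rev_induct)
  case (snoc i w)
  then have "x @ w \<in> H" using assms unfolding canonical_tree_def append_assoc[symmetric] by blast
  then show ?case by (rule snoc.IH)
qed simp

lemma canonical_tree_child:
  assumes "canonical_tree H J" "x @ i # w \<in> H"
  shows "i < J x"
  using canonical_tree_prefix[OF assms(1), of "x @ [i]" w] assms by (auto simp: canonical_tree_def)

lemma canonical_tree_butlast:
  assumes "canonical_tree H J" "x \<in> H"
  shows "butlast x \<in> H"
  using canonical_tree_prefix[OF assms(1), of "butlast x" "[last x]"] assms(2) by (cases "x = []") auto

lemma canonical_tree_insert: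
  assumes H: "canonical_tree H J" and x: "x \<in> H"
  shows "canonical_tree (insert (x @ [J x]) H) (J(x := Suc (J x)))"
  unfolding canonical_tree_def
proof (intro conjI allI impI)
  let ?z = "x @ [J x]"
  have snoc: "\<And>y i. y @ [i] \<in> H \<longleftrightarrow> y \<in> H \<and> i < J y" and z0: "\<And>y. y \<notin> H \<Longrightarrow> J y = 0"
    using H by (auto simp: canonical_tree_def)
  have znot: "?z \<notin> H" using snoc by simp
  fix y i
  show "y @ [i] \<in> insert ?z H \<longleftrightarrow> y \<in> insert ?z H \<and> i < (J(x := Suc (J x))) y"
    using snoc[of y i] z0[OF znot] znot x by auto
qed (use H x in \<open>auto simp: canonical_tree_def\<close>)

text \<open>Every vertex except the root is a child of exactly one vertex. It identifies the power
  of \<open>p\<close> from the \<open>card H - 1\<close> edges in the graph with the product of the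
  powers \<open>p ^ J v\<close> from the Mecke equation.\<close>

lemma canonical_tree_sum_card:
  assumes H: "canonical_tree H J"
  shows "card H = Suc (\<Sum>v\<in>H. J v)"
proof -
  have fin: "finite H" and nil: "[] \<in> H" and snoc: "\<And>y i. y @ [i] \<in> H \<longleftrightarrow> y \<in> H \<and> i < J y"
    using H by (auto simp: canonical_tree_def)
  have "bij_betw (\<lambda>(v, i). v @ [i]) (SIGMA v:H. {..<J v}) (H - {[]})"
  proof (rule bij_betw_byWitness[of _ "\<lambda>y. (butlast y, last y)"])
    show "(\<lambda>y. (butlast y, last y)) ` (H - {[]}) \<subseteq> (SIGMA v:H. {..<J v})"
    proof safe
      fix y assume y: "y \<in> H" "y \<noteq> []"
      then have "butlast y @ [last y] \<in> H" by simp
      then show "butlast y \<in> H" "last y < J (butlast y)" using snoc by blast+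
    qed
  qed (use snoc in auto)
  then have "card (H - {[]}) = (\<Sum>v\<in>H. J v)"
    using fin by (simp add: bij_betw_same_card[symmetric] card_SigmaI)
  then show ?thesis using fin nil by (metis card_Suc_Diff1)
qed

text \<open>The product of the \<open>falling (N v) (J v)\<close> counts the ways in which \<open>H\<close> can be embedded in the tree of
  \<open>N\<close> when the children are chosen freely; it vanishes unless \<open>H\<close> itself is part of that tree.\<close>

definition gw_weight :: "real \<Rightarrow> (nat list \<Rightarrow> nat) \<Rightarrow> nat list set \<Rightarrow> (nat list \<Rightarrow> nat) \<Rightarrow> (nat list \<Rightarrow> nat) \<Rightarrow> real" where
  "gw_weight c J H e N =
     (\<Prod>v\<in>H. real (falling (N v) (J v)) * walk_weight c (N v + (if v = [] then 0 else 1)) ^ e v)"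

text \<open>The expected contribution of all walks with a given past: \<open>gw_weight\<close> holds
  the factors of the steps already made, kept as powers since all visits to \<open>v\<close> share
  the same \<open>N v\<close>, and \<open>tree_return\<close> completes the walk in \<open>k\<close>
  further steps.\<close>

definition gw_state :: "real \<Rightarrow> real \<Rightarrow> (nat list \<Rightarrow> nat) \<Rightarrow> nat list set \<Rightarrow> (nat list \<Rightarrow> nat) \<Rightarrow> nat list \<Rightarrow> nat \<Rightarrow> real" where
  "gw_state c p J H e x k =
     (\<integral>N. gw_weight c J H e N * tree_return c N k x \<partial>galton_watson (poisson_pmf p))"

lemma walk_weight_pow_abs_le: "c \<ge> 0 \<Longrightarrow> \<bar>walk_weight c d ^ j\<bar> \<le> 1"
  using walk_weight_nonneg[of c d] walk_weight_le_1[of c d] by (simp add: power_le_one)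

lemma gw_weight_nonneg: "c \<ge> 0 \<Longrightarrow> 0 \<le> gw_weight c J H e N"
  unfolding gw_weight_def by (intro prod_nonneg) (auto simp: walk_weight_nonneg)

text \<open>Independence of the offspring numbers splits the integral into one factor for each
  vertex of \<open>H\<close>, and the Mecke equation evaluates each of them. The walk weights are at
  most 1, hence the bound 1 in its application.\<close>

lemma
  assumes c: "c \<ge> 0" and p: "p > 0" and H: "finite H"
  shows integrable_gw_weight: "integrable (galton_watson (poisson_pmf p)) (gw_weight c J H e)"
    and integral_gw_weight: "(\<integral>N. gw_weight c J H e N \<partial>galton_watson (poisson_pmf p)) =
      (\<Prod>v\<in>H. p ^ J v * (\<integral>m. walk_weight c (m + J v + (if v = [] then 0 else 1)) ^ e v \<partial>measure_pmf (poisson_pmf p)))"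
proof -
  note P = poisson_mecke[OF p, of "\<lambda>m. walk_weight c (m + (if v = [] then 0 else 1)) ^ e v" 1 for v, OF walk_weight_pow_abs_le[OF c]]
  note G = galton_watson_integral_prod[OF H, of "poisson_pmf p"
    "\<lambda>v m. real (falling m (J v)) * walk_weight c (m + (if v = [] then 0 else 1)) ^ e v", OF P(1)]
  show "integrable (galton_watson (poisson_pmf p)) (gw_weight c J H e)"
    using G(1) unfolding gw_weight_def[abs_def] .
  show "(\<integral>N. gw_weight c J H e N \<partial>galton_watson (poisson_pmf p)) =
      (\<Prod>v\<in>H. p ^ J v * (\<integral>m. walk_weight c (m + J v + (if v = [] then 0 else 1)) ^ e v \<partial>measure_pmf (poisson_pmf p)))"
    unfolding gw_weight_def[abs_def] G(2) by (intro prod.cong refl P(2))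
qed

lemma integrable_gw_state:
  assumes c: "c \<ge> 0" and p: "p > 0" and H: "finite H"
  shows "integrable (galton_watson (poisson_pmf p)) (\<lambda>N. gw_weight c J H e N * tree_return c N k x)"
proof (rule Bochner_Integration.integrable_bound[OF integrable_gw_weight[OF c p H, of J e]])
  show "(\<lambda>N. gw_weight c J H e N * tree_return c N k x) \<in> borel_measurable (galton_watson (poisson_pmf p))"
    using integrable_gw_weight[OF c p H, of J e] by (intro borel_measurable_times) auto
  show "AE N in galton_watson (poisson_pmf p). norm (gw_weight c J H e N * tree_return c N k x) \<le> norm (gw_weight c J H e N)"
    using tree_return_bounds[OF c] gw_weight_nonneg[OF c]
    by (intro always_eventually allI) (auto simp: abs_mult intro!: mult_left_le)
qed

lemma gw_state_0:
  assumes "c \<ge> 0" "p > 0" "finite H"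
  shows "gw_state c p J H e x 0 = (if x = [] then
    (\<Prod>v\<in>H. p ^ J v * (\<integral>m. walk_weight c (m + J v + (if v = [] then 0 else 1)) ^ e v \<partial>measure_pmf (poisson_pmf p))) else 0)"
  unfolding gw_state_def by (auto simp: integral_gw_weight[OF assms])

lemma gw_weight_update_exponent:
  assumes "finite H" "x \<in> H"
  shows "gw_weight c J H (e(x := Suc (e x))) N =
    gw_weight c J H e N * walk_weight c (N x + (if x = [] then 0 else 1))"
proof -
  have "gw_weight c J H (e(x := Suc (e x))) N = (\<Prod>v\<in>H.
    (real (falling (N v) (J v)) * walk_weight c (N v + (if v = [] then 0 else 1)) ^ e v) *
    (if v = x then walk_weight c (N x + (if x = [] then 0 else 1)) else 1))"
    unfolding gw_weight_def by (intro prod.cong) auto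
  then show ?thesis using assms by (simp add: prod.distrib gw_weight_def prod.delta)
qed

text \<open>The new vertex contributes the factor 1, having neither used children nor visits, while
  the falling factorial at \<open>x\<close> gains its next factor.\<close>

lemma gw_weight_insert:
  assumes H: "canonical_tree H J" and x: "x \<in> H" and e: "\<And>y. y \<notin> H \<Longrightarrow> e y = 0"
  shows "gw_weight c (J(x := Suc (J x))) (insert (x @ [J x]) H) e N = gw_weight c J H e N * real (N x - J x)"
proof -
  let ?z = "x @ [J x]"
  have z: "?z \<notin> H" and fin: "finite H" using H by (auto simp: canonical_tree_def)
  have Jz: "J ?z = 0" using H z by (auto simp: canonical_tree_def)
  have "gw_weight c (J(x := Suc (J x))) (insert ?z H) e N = gw_weight c (J(x := Suc (J x))) H e N"
    unfolding gw_weight_def using fin z Jz e[OF z] x by (subst prod.insert) auto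
  also have "\<dots> = (\<Prod>v\<in>H.
    (real (falling (N v) (J v)) * walk_weight c (N v + (if v = [] then 0 else 1)) ^ e v) *
    (if v = x then real (N x - J x) else 1))"
    unfolding gw_weight_def by (intro prod.cong) (auto simp: falling_Suc)
  also have "\<dots> = gw_weight c J H e N * real (N x - J x)"
    using fin x by (simp add: prod.distrib gw_weight_def prod.delta)
  finally show ?thesis .
qed

lemma gw_weight_eq_0:
  assumes "finite H" "x \<in> H" "N x < J x"
  shows "gw_weight c J H e N = 0"
  unfolding gw_weight_def
proof (rule prod_zero[OF assms(1)])
  show "\<exists>v\<in>H. real (falling (N v) (J v)) * walk_weight c (N v + (if v = [] then 0 else 1)) ^ e v = 0"
    using assms(2) falling_eq_0[OF assms(3)] by (intro bexI[of _ x]) simp_all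
qed

text \<open>Swapping the subtrees below \<open>x @ [i]\<close> and \<open>x @ [J x]\<close> preserves the law and fixes \<open>H\<close>.\<close>

lemma integral_gw_weight_new_children:
  assumes c: "c \<ge> 0" and p: "p > 0" and H: "canonical_tree H J" and x: "x \<in> H"
  shows "(\<integral>N. gw_weight c J H e N * (\<Sum>i\<in>{J x..<N x}. tree_return c N k (x @ [i])) \<partial>galton_watson (poisson_pmf p)) =
    (\<integral>N. gw_weight c J H e N * real (N x - J x) * tree_return c N k (x @ [J x]) \<partial>galton_watson (poisson_pmf p))"
proof -
  let ?G = "galton_watson (poisson_pmf p)" and ?W = "gw_weight c J H e"
  have fin: "finite H" using H by (simp add: canonical_tree_def)
  have [measurable]: "?W \<in> borel_measurable ?G" using integrable_gw_weight[OF c p fin] by blast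
  \<comment> \<open>The random range of summation is moved into the integrand as an indicator, so
    that nonnegative integrals can be exchanged with a sum over all \<open>i\<close> without
    integrability conditions.\<close>
  define f where "f i N = (if J x \<le> i \<and> i < N x then ennreal (?W N * tree_return c N k (x @ [i])) else 0)" for i N
  define g where "g i N = (if J x \<le> i \<and> i < N x then ennreal (?W N * tree_return c N k (x @ [J x])) else 0)" for i N
  have [measurable]: "f i \<in> borel_measurable ?G" "g i \<in> borel_measurable ?G" for i
    unfolding f_def g_def by measurable
  have swap: "(\<integral>\<^sup>+N. f i N \<partial>?G) = (\<integral>\<^sup>+N. g i N \<partial>?G)" for i
  proof (cases "J x \<le> i")
    case True
    let ?s = "sibling_swap x i (J x)"
    have fixH: "?s y = y" if "y \<in> H" for y
    proof (cases y x rule: sibling_swap_cases)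
      case (below j w)
      then have "j < J x" using canonical_tree_child[OF H] that by blast
      \<comment> \<open>Labels used below \<open>x\<close> inside \<open>H\<close> are smaller than
        \<open>J x\<close>, hence smaller than both exchanged labels.\<close>
      then have "Transposition.transpose i (J x) j = j" using True by (intro transpose_apply_other) auto
      then show ?thesis unfolding below by (simp add: sibling_swap_append)
    qed (rule sibling_swap_other)
    have W: "?W (N \<circ> ?s) = ?W N" for N
      unfolding gw_weight_def by (intro prod.cong) (auto simp: fixH)
    have "f i (N \<circ> ?s) = g i N" for N
    proof (cases "i < N x")
      case less: True
      have "tree_return c (N \<circ> ?s) k (x @ [i]) = tree_return c N k (?s (x @ [i]))"
        using less True by (intro tree_return_sibling_swap) auto
      then show ?thesis using less True by (simp add: f_def g_def W sibling_swap_append)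
    qed (simp add: f_def g_def)
    then show ?thesis
      using nn_integral_galton_watson_reindex[OF bij_is_inj[OF bij_sibling_swap], of "f i" "poisson_pmf p" x i "J x"] by simp
  qed (simp add: f_def g_def)
  have S: "(\<Sum>i. f i N) = ennreal (?W N * (\<Sum>i\<in>{J x..<N x}. tree_return c N k (x @ [i])))"
    "(\<Sum>i. g i N) = ennreal (?W N * real (N x - J x) * tree_return c N k (x @ [J x]))" for N
  proof -
    have "(\<Sum>i. f i N) = (\<Sum>i\<in>{J x..<N x}. f i N)" by (rule suminf_finite) (auto simp: f_def)
    also have "\<dots> = (\<Sum>i\<in>{J x..<N x}. ennreal (?W N * tree_return c N k (x @ [i])))"
      by (intro sum.cong) (auto simp: f_def)
    also have "\<dots> = ennreal (\<Sum>i\<in>{J x..<N x}. ?W N * tree_return c N k (x @ [i]))"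
      using gw_weight_nonneg[OF c] tree_return_bounds[OF c] by (intro sum_ennreal mult_nonneg_nonneg) auto
    finally show "(\<Sum>i. f i N) = ennreal (?W N * (\<Sum>i\<in>{J x..<N x}. tree_return c N k (x @ [i])))"
      by (simp add: sum_distrib_left)
    have "(\<Sum>i. g i N) = (\<Sum>i\<in>{J x..<N x}. g i N)" by (rule suminf_finite) (auto simp: g_def)
    also have "\<dots> = (\<Sum>i\<in>{J x..<N x}. ennreal (?W N * tree_return c N k (x @ [J x])))"
      by (intro sum.cong) (auto simp: g_def)
    also have "\<dots> = ennreal (\<Sum>i\<in>{J x..<N x}. ?W N * tree_return c N k (x @ [J x]))"
      using gw_weight_nonneg[OF c] tree_return_bounds[OF c] by (intro sum_ennreal mult_nonneg_nonneg) auto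
    finally show "(\<Sum>i. g i N) = ennreal (?W N * real (N x - J x) * tree_return c N k (x @ [J x]))"
      by (simp add: mult_ac)
  qed
  have [measurable]: "(\<lambda>N. \<Sum>i\<in>{J x..<N x}. tree_return c N k (x @ [i])) \<in> borel_measurable ?G"
  proof -
    have "(\<lambda>N. (\<lambda>m N. \<Sum>i\<in>{J x..<m}. tree_return c N k (x @ [i])) (N x) N) \<in> borel_measurable ?G"
      by (rule measurable_compose_countable[OF _ measurable_galton_watson_coord])
        (intro borel_measurable_sum measurable_tree_return)
    then show ?thesis .
  qed
  have "(\<integral>N. ?W N * (\<Sum>i\<in>{J x..<N x}. tree_return c N k (x @ [i])) \<partial>?G) = enn2real (\<integral>\<^sup>+N. (\<Sum>i. f i N) \<partial>?G)"
    unfolding S using gw_weight_nonneg[OF c] tree_return_bounds[OF c]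
    by (intro integral_eq_nn_integral) (auto intro!: mult_nonneg_nonneg sum_nonneg)
  also have "(\<integral>\<^sup>+N. (\<Sum>i. f i N) \<partial>?G) = (\<integral>\<^sup>+N. (\<Sum>i. g i N) \<partial>?G)"
    by (simp add: nn_integral_suminf swap)
  also have "enn2real \<dots> = (\<integral>N. ?W N * real (N x - J x) * tree_return c N k (x @ [J x]) \<partial>?G)"
    unfolding S using gw_weight_nonneg[OF c] tree_return_bounds[OF c]
    by (intro integral_eq_nn_integral[symmetric]) (auto intro!: mult_nonneg_nonneg)
  finally show ?thesis .
qed

lemma gw_state_Suc:
  assumes c: "c \<ge> 0" and p: "p > 0" and H: "canonical_tree H J" and x: "x \<in> H"
    and e: "\<And>y. y \<notin> H \<Longrightarrow> e y = 0"
  shows "gw_state c p J H e x (Suc k) =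
    (if x = [] then 0 else gw_state c p J H (e(x := Suc (e x))) (butlast x) k) +
    (\<Sum>i<J x. gw_state c p J H (e(x := Suc (e x))) (x @ [i]) k) +
    gw_state c p (J(x := Suc (J x))) (insert (x @ [J x]) H) (e(x := Suc (e x))) (x @ [J x]) k"
proof -
  let ?G = "galton_watson (poisson_pmf p)" and ?e = "e(x := Suc (e x))"
  let ?W = "gw_weight c J H ?e" and ?t = "\<lambda>N. tree_return c N k"
  have fin: "finite H" using H by (simp add: canonical_tree_def)
  have e': "\<And>y. y \<notin> H \<Longrightarrow> ?e y = 0" using e x by auto
  have new: "gw_weight c (J(x := Suc (J x))) (insert (x @ [J x]) H) ?e N = ?W N * real (N x - J x)" for N
    by (rule gw_weight_insert[OF H x e'])
  have pt: "gw_weight c J H e N * tree_return c N (Suc k) x =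
    (if x = [] then 0 else ?W N * ?t N (butlast x)) + (\<Sum>i<J x. ?W N * ?t N (x @ [i])) +
    ?W N * (\<Sum>i\<in>{J x..<N x}. ?t N (x @ [i]))" for N
  \<comment> \<open>If \<open>x\<close> has fewer children than \<open>H\<close> uses, both weights
    vanish; otherwise the children can be split at \<open>J x\<close>.\<close>
  proof (cases "N x < J x")
    case True
    then show ?thesis using gw_weight_eq_0[OF fin x, of N J c e] gw_weight_eq_0[OF fin x, of N J c ?e] True by simp
  next
    case False
    then have "(\<Sum>i<N x. ?t N (x @ [i])) = (\<Sum>i<J x. ?t N (x @ [i])) + (\<Sum>i\<in>{J x..<N x}. ?t N (x @ [i]))"
      by (simp add: lessThan_atLeast0 sum.atLeastLessThan_concat)
    then show ?thesis
      by (simp add: gw_weight_update_exponent[OF fin x] sum_distrib_left[symmetric] algebra_simps)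
  qed
  note int = integrable_gw_state[OF c p fin]
  have int1: "integrable ?G (\<lambda>N. (if x = [] then 0 else ?W N * ?t N (butlast x)) + (\<Sum>i<J x. ?W N * ?t N (x @ [i])))"
    using int by (cases "x = []") (auto intro!: Bochner_Integration.integrable_add Bochner_Integration.integrable_sum)
  have int2: "integrable ?G (\<lambda>N. ?W N * (\<Sum>i\<in>{J x..<N x}. ?t N (x @ [i])))"
  proof -
    have "integrable ?G (\<lambda>N. gw_weight c J H e N * tree_return c N (Suc k) x -
       ((if x = [] then 0 else ?W N * ?t N (butlast x)) + (\<Sum>i<J x. ?W N * ?t N (x @ [i]))))"
      by (intro Bochner_Integration.integrable_diff int int1)
    then show ?thesis unfolding pt by simp
  qed
  have "gw_state c p J H e x (Suc k) =
    (\<integral>N. (if x = [] then 0 else ?W N * ?t N (butlast x)) + (\<Sum>i<J x. ?W N * ?t N (x @ [i])) \<partial>?G) +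
    (\<integral>N. ?W N * (\<Sum>i\<in>{J x..<N x}. ?t N (x @ [i])) \<partial>?G)"
    unfolding gw_state_def pt by (rule Bochner_Integration.integral_add[OF int1 int2])
  also have "(\<integral>N. ?W N * (\<Sum>i\<in>{J x..<N x}. ?t N (x @ [i])) \<partial>?G) =
    gw_state c p (J(x := Suc (J x))) (insert (x @ [J x]) H) ?e (x @ [J x]) k"
    unfolding gw_state_def new by (rule integral_gw_weight_new_children[OF c p H x])
  also have "(\<integral>N. (if x = [] then 0 else ?W N * ?t N (butlast x)) + (\<Sum>i<J x. ?W N * ?t N (x @ [i])) \<partial>?G) =
    (if x = [] then 0 else gw_state c p J H ?e (butlast x) k) + (\<Sum>i<J x. gw_state c p J H ?e (x @ [i]) k)"
    using int by (cases "x = []") (simp_all add: gw_state_def)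
  finally show ?thesis .
qed

section \<open>Binomial degrees and disjoint sets of edges\<close>

lemma expectation_nat_suminf:
  fixes g :: "nat \<Rightarrow> real"
  assumes g: "\<And>j. \<bar>g j\<bar> \<le> C"
  shows "measure_pmf.expectation P g = (\<Sum>j. pmf P j * g j)"
proof -
  have "integrable (measure_pmf P) g"
    by (rule measure_pmf.integrable_const_bound[of _ C]) (use g in auto)
  then have "integrable (count_space UNIV) (\<lambda>j. pmf P j * g j)"
    unfolding measure_pmf_eq_density by (subst (asm) integrable_density) auto
  moreover have "measure_pmf.expectation P g = (\<integral>j. pmf P j * g j \<partial>count_space UNIV)"
    unfolding measure_pmf_eq_density by (subst integral_density) auto
  ultimately show ?thesis by (simp add: integral_count_space_nat)
qed

lemma binomial_coeff_scaled_tendsto: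
  "(\<lambda>n. real ((n - m) choose j) * (p / real n) ^ j) \<longlonglongrightarrow> p ^ j / fact j"
proof -
  have fac: "(\<lambda>n. (real n - real m - real i) / real n) \<longlonglongrightarrow> 1" for i
    by real_asymp
  have "(\<lambda>n. (\<Prod>i<j. (real n - real m - real i) / real n) * (p ^ j / fact j)) \<longlonglongrightarrow> (\<Prod>i<j. 1) * (p ^ j / fact j)"
    by (intro tendsto_mult tendsto_prod fac tendsto_const)
  moreover have "\<forall>\<^sub>F n in sequentially. (\<Prod>i<j. (real n - real m - real i) / real n) * (p ^ j / fact j) =
    real ((n - m) choose j) * (p / real n) ^ j"
    using eventually_ge_at_top[of "m + j + 1"]
  proof eventually_elim
    case (elim n)
    have "real ((n - m) choose j) = (\<Prod>i<j. real (n - m) - real i) / fact j"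
      by (simp add: binomial_gbinomial gbinomial_prod_rev atLeast0LessThan)
    moreover have "real (n - m) = real n - real m" using elim by simp
    ultimately show ?case
      using elim by (simp add: prod_dividef power_divide)
  qed
  ultimately show ?thesis by (simp add: tendsto_cong)
qed

text \<open>The \<open>m\<close> removed trials stand for the vertices that are already placed.
  Together with the \<open>j\<close> successes they change the number of factors
  \<open>1 - p / n\<close> by the fixed amount \<open>m + j\<close>, and each such factor tends to
  1.\<close>

lemma pmf_binomial_poisson_limit:
  assumes p: "p > 0"
  shows "(\<lambda>n. pmf (binomial_pmf (n - m) (p / real n)) j) \<longlonglongrightarrow> pmf (poisson_pmf p) j"
proof -
  have e: "(\<lambda>n. (1 + (- p) / real n) ^ n) \<longlonglongrightarrow> exp (- p)"
    by (rule tendsto_exp_limit_sequentially)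
  have "(\<lambda>n. 1 - p / real n) \<longlonglongrightarrow> 1" by real_asymp
  then have d: "(\<lambda>n. (1 - p / real n) ^ (m + j)) \<longlonglongrightarrow> 1 ^ (m + j)" by (intro tendsto_power)
  have "(\<lambda>n. real ((n - m) choose j) * (p / real n) ^ j * ((1 + (- p) / real n) ^ n / (1 - p / real n) ^ (m + j)))
    \<longlonglongrightarrow> p ^ j / fact j * (exp (- p) / 1 ^ (m + j))"
    by (intro tendsto_mult tendsto_divide binomial_coeff_scaled_tendsto e d) auto
  moreover have "\<forall>\<^sub>F n in sequentially. real ((n - m) choose j) * (p / real n) ^ j *
      ((1 + (- p) / real n) ^ n / (1 - p / real n) ^ (m + j)) = pmf (binomial_pmf (n - m) (p / real n)) j"
    using eventually_ge_at_top[of "m + j + 1"] eventually_gt_at_top[of "nat \<lceil>p\<rceil>"]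
  proof eventually_elim
    case (elim n)
    then have n: "real n > p" by linarith
    then have q: "0 \<le> p / real n" "p / real n < 1" using p by auto
    have "(1 - p / real n) ^ n = (1 - p / real n) ^ (n - m - j) * (1 - p / real n) ^ (m + j)"
      using elim by (simp add: power_add[symmetric])
    moreover have "(1 - p / real n) ^ (m + j) \<noteq> 0" using q n p by simp
    moreover have "1 + (- p) / real n = 1 - p / real n" by simp
    ultimately have "(1 + (- p) / real n) ^ n / (1 - p / real n) ^ (m + j) = (1 - p / real n) ^ (n - m - j)"
      by (metis nonzero_mult_div_cancel_right)
    then show ?case using q by (simp add: pmf_binomial)
  qed
  ultimately show ?thesis using p by (simp add: tendsto_cong)
qed

text \<open>Pointwise convergence of the masses is upgraded by Tannery's theorem. The dominating
  series has terms \<open>C * p ^ j / fact j\<close>, from \<open>n choose j\<close> being at most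
  \<open>n ^ j / fact j\<close>.\<close>

lemma expectation_binomial_poisson_limit:
  fixes g :: "nat \<Rightarrow> real"
  assumes p: "p > 0" and g: "\<And>j. \<bar>g j\<bar> \<le> C"
  shows "(\<lambda>n. measure_pmf.expectation (binomial_pmf (n - m) (p / real n)) g)
    \<longlonglongrightarrow> measure_pmf.expectation (poisson_pmf p) g"
  unfolding expectation_nat_suminf[OF g]
proof -
  have C: "C \<ge> 0" using g[of 0] by linarith
  have sumb: "summable (\<lambda>j. p ^ j / fact j * C)"
    using summable_exp[of p] by (intro summable_mult2) (simp add: field_simps)
  have bound: "norm (pmf (binomial_pmf (n - m) (p / real n)) j * g j) \<le> p ^ j / fact j * C" if n: "real n > p" for n j
  proof -
    have q: "0 \<le> p / real n" "p / real n \<le> 1" using p n by auto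
    have "pmf (binomial_pmf (n - m) (p / real n)) j \<le> real ((n - m) choose j) * (p / real n) ^ j * 1"
      using q by (simp add: pmf_binomial mult_left_le power_le_one)
    also have "real ((n - m) choose j) \<le> real n ^ j / fact j"
    proof -
      have "fact j * real ((n - m) choose j) \<le> real n ^ j"
      proof (cases "j \<le> n - m")
        case True
        have "fact j * ((n - m) choose j) \<le> (n - m) ^ j"
          using binomial_fact_pow[of "n - m" j] by (simp add: mult.commute)
        also have "\<dots> \<le> n ^ j" by (intro power_mono) auto
        finally have "real (fact j * ((n - m) choose j)) \<le> real (n ^ j)" by (simp only: of_nat_le_iff)
        then show ?thesis by simp
      qed (simp add: binomial_eq_0)
      then show ?thesis by (simp add: field_simps)
    qed
    also have "real n ^ j / fact j * (p / real n) ^ j * 1 = p ^ j / fact j"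
      using n p by (simp add: power_divide)
    finally have "pmf (binomial_pmf (n - m) (p / real n)) j \<le> p ^ j / fact j"
      using q by (simp add: mult_right_mono)
    then show ?thesis unfolding real_norm_def abs_mult using g[of j] p C by (intro mult_mono) auto
  qed
  have ev: "\<forall>\<^sub>F n in sequentially. real n > p"
    using eventually_gt_at_top[of "nat \<lceil>p\<rceil>"] by eventually_elim linarith
  show "(\<lambda>n. \<Sum>j. pmf (binomial_pmf (n - m) (p / real n)) j * g j) \<longlonglongrightarrow> (\<Sum>j. pmf (poisson_pmf p) j * g j)"
  proof (rule tannerys_theorem[THEN conjunct2, THEN conjunct2, OF _ _ sumb])
    show "\<And>j. (\<lambda>n. pmf (binomial_pmf (n - m) (p / real n)) j * g j) \<longlonglongrightarrow> pmf (poisson_pmf p) j * g j"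
      by (intro tendsto_mult pmf_binomial_poisson_limit p tendsto_const)
    show "\<forall>\<^sub>F (j, n) in at_top \<times>\<^sub>F sequentially. norm (pmf (binomial_pmf (n - m) (p / real n)) j * g j) \<le> p ^ j / fact j * C"
      using eventually_prodI[OF always_eventually ev, of "\<lambda>_. True" at_top]
      by (rule eventually_mono) (use bound in auto)
  qed auto
qed

section \<open>Independence over disjoint sets of edges\<close>

lemma expectation_pair_pmf_prod:
  fixes f :: "'a \<Rightarrow> real" and g :: "'b \<Rightarrow> real"
  assumes P: "finite (set_pmf P)" and Q: "finite (set_pmf Q)"
  shows "measure_pmf.expectation (pair_pmf P Q) (\<lambda>(x, y). f x * g y) =
    measure_pmf.expectation P f * measure_pmf.expectation Q g"
proof -
  have "measure_pmf.expectation (pair_pmf P Q) (\<lambda>(x, y). f x * g y) =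
    measure_pmf.expectation (P \<bind> (\<lambda>x. map_pmf (Pair x) Q)) (\<lambda>(x, y). f x * g y)"
    by (simp add: pair_pmf_def map_pmf_def)
  also have "\<dots> = (\<Sum>x\<in>set_pmf P. pmf P x *\<^sub>R measure_pmf.expectation (map_pmf (Pair x) Q) (\<lambda>(x, y). f x * g y))"
    using P Q by (intro pmf_expectation_bind) auto
  also have "\<dots> = (\<Sum>x\<in>set_pmf P. pmf P x *\<^sub>R f x) * measure_pmf.expectation Q g"
    by (simp add: sum_distrib_right mult.assoc)
  also have "(\<Sum>x\<in>set_pmf P. pmf P x *\<^sub>R f x) = measure_pmf.expectation P f"
    using P by (intro integral_measure_pmf[symmetric]) auto
  finally show ?thesis .
qed

text \<open>Both functions take the whole configuration, but each reads only its own block; this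
  form allows products to be split without introducing restricted configurations.\<close>

lemma expectation_Pi_pmf_union:
  fixes f g :: "('e \<Rightarrow> 'b) \<Rightarrow> real"
  assumes A: "finite A" and B: "finite B" and AB: "A \<inter> B = {}"
    and fin: "\<And>S. finite S \<Longrightarrow> finite (set_pmf (Pi_pmf S dflt p))"
    and f: "\<And>x y. (\<And>e. e \<in> A \<Longrightarrow> x e = y e) \<Longrightarrow> f x = f y"
    and g: "\<And>x y. (\<And>e. e \<in> B \<Longrightarrow> x e = y e) \<Longrightarrow> g x = g y"
  shows "measure_pmf.expectation (Pi_pmf (A \<union> B) dflt p) (\<lambda>x. f x * g x) =
    measure_pmf.expectation (Pi_pmf A dflt p) f * measure_pmf.expectation (Pi_pmf B dflt p) g"
proof -
  have "Pi_pmf (A \<union> B) dflt p =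
    map_pmf (\<lambda>(x, y) e. if e \<in> A then x e else y e) (pair_pmf (Pi_pmf A dflt p) (Pi_pmf B dflt p))"
    by (rule Pi_pmf_union[OF A B AB])
  then have "measure_pmf.expectation (Pi_pmf (A \<union> B) dflt p) (\<lambda>x. f x * g x) =
    measure_pmf.expectation (pair_pmf (Pi_pmf A dflt p) (Pi_pmf B dflt p))
      (\<lambda>(x, y). f (\<lambda>e. if e \<in> A then x e else y e) * g (\<lambda>e. if e \<in> A then x e else y e))"
    by (simp add: case_prod_unfold)
  also have "\<dots> = measure_pmf.expectation (pair_pmf (Pi_pmf A dflt p) (Pi_pmf B dflt p)) (\<lambda>(x, y). f x * g y)"
  proof (intro Bochner_Integration.integral_cong refl, clarify)
    fix x y
    have "f (\<lambda>e. if e \<in> A then x e else y e) = f x" by (rule f) simp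
    moreover have "g (\<lambda>e. if e \<in> A then x e else y e) = g y" by (rule g) (use AB in auto)
    ultimately show "f (\<lambda>e. if e \<in> A then x e else y e) * g (\<lambda>e. if e \<in> A then x e else y e) = f x * g y"
      by simp
  qed
  also have "\<dots> = measure_pmf.expectation (Pi_pmf A dflt p) f * measure_pmf.expectation (Pi_pmf B dflt p) g"
    by (rule expectation_pair_pmf_prod) (use fin A B in auto)
  finally show ?thesis .
qed

lemma expectation_Pi_pmf_bernoulli_all:
  fixes S :: "'e set"
  assumes S: "finite S" and F: "F \<subseteq> S" and a: "0 \<le> a" "a \<le> 1"
  shows "measure_pmf.expectation (Pi_pmf S False (\<lambda>_. bernoulli_pmf a)) (\<lambda>x. of_bool (\<forall>e\<in>F. x e)) = a ^ card F"
proof -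
  have finF: "finite F" using S F finite_subset by blast
  have "measure_pmf.expectation (Pi_pmf (F \<union> (S - F)) False (\<lambda>_. bernoulli_pmf a)) (\<lambda>x. of_bool (\<forall>e\<in>F. x e) * 1 :: real) =
    measure_pmf.expectation (Pi_pmf F False (\<lambda>_. bernoulli_pmf a)) (\<lambda>x. of_bool (\<forall>e\<in>F. x e)) *
    measure_pmf.expectation (Pi_pmf (S - F) False (\<lambda>_. bernoulli_pmf a)) (\<lambda>_. 1)"
    using S finF by (intro expectation_Pi_pmf_union[where f = "\<lambda>x. of_bool (\<forall>e\<in>F. x e)" and g = "\<lambda>_. 1"]) auto
  also have "F \<union> (S - F) = S" using F by auto
  also have "measure_pmf.expectation (Pi_pmf F False (\<lambda>_. bernoulli_pmf a)) (\<lambda>x. of_bool (\<forall>e\<in>F. x e) :: real) =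
    (\<Prod>e\<in>F. measure_pmf.expectation (bernoulli_pmf a) of_bool)"
  proof -
    have "(\<lambda>x :: 'e \<Rightarrow> bool. of_bool (\<forall>e\<in>F. x e) :: real) = (\<lambda>x. \<Prod>e\<in>F. of_bool (x e))"
      using finF by (auto simp: fun_eq_iff)
    then show ?thesis
      using finF by (simp only:) (intro expectation_prod_Pi_pmf; auto intro!: integrable_measure_pmf_finite)
  qed
  finally show ?thesis using a by simp
qed

text \<open>The blocks are split off one at a time, the ground set shrinking to
  \<open>S - B v\<close>; within a block the number of present elements is binomial.\<close>

lemma expectation_Pi_pmf_bernoulli_blocks:
  fixes S :: "'e set" and g :: "'v \<Rightarrow> nat \<Rightarrow> real"
  assumes H: "finite H" and S: "finite S" and a: "0 \<le> a" "a \<le> 1"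
    and F: "F \<subseteq> S" and B: "\<And>v. v \<in> H \<Longrightarrow> B v \<subseteq> S" "\<And>v. v \<in> H \<Longrightarrow> B v \<inter> F = {}"
    and disj: "disjoint_family_on B H"
  shows "measure_pmf.expectation (Pi_pmf S False (\<lambda>_. bernoulli_pmf a))
      (\<lambda>x. of_bool (\<forall>e\<in>F. x e) * (\<Prod>v\<in>H. g v (card {e\<in>B v. x e}))) =
    a ^ card F * (\<Prod>v\<in>H. measure_pmf.expectation (binomial_pmf (card (B v)) a) (g v))"
  using H S F B disj
proof (induction H arbitrary: S rule: finite_induct)
  case empty
  then show ?case using expectation_Pi_pmf_bernoulli_all[OF _ _ a] by simp
next
  case (insert v H)
  let ?P = "\<lambda>S. Pi_pmf S False (\<lambda>_. bernoulli_pmf a)"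
  let ?R = "\<lambda>x. of_bool (\<forall>e\<in>F. x e) * (\<Prod>v\<in>H. g v (card {e\<in>B v. x e}))"
  have Bv: "B v \<subseteq> S" "B v \<inter> F = {}" "finite (B v)"
    using insert.prems(3,4) finite_subset[OF _ insert.prems(1)] by auto
  have other: "B w \<inter> B v = {}" if "w \<in> H" for w
    using insert.prems(5) insert.hyps(2) that by (auto simp: disjoint_family_on_def)
  have "(\<lambda>x. of_bool (\<forall>e\<in>F. x e) * (\<Prod>v\<in>insert v H. g v (card {e\<in>B v. x e}))) =
    (\<lambda>x. g v (card {e\<in>B v. x e}) * ?R x)"
    using insert.hyps by (simp add: fun_eq_iff mult_ac)
  moreover have "measure_pmf.expectation (?P (B v \<union> (S - B v))) (\<lambda>x. g v (card {e\<in>B v. x e}) * ?R x) =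
    measure_pmf.expectation (?P (B v)) (\<lambda>x. g v (card {e\<in>B v. x e})) * measure_pmf.expectation (?P (S - B v)) ?R"
  proof (rule expectation_Pi_pmf_union)
    show "g v (card {e\<in>B v. x e}) = g v (card {e\<in>B v. y e})" if "\<And>e. e \<in> B v \<Longrightarrow> x e = y e" for x y
    proof -
      have "{e\<in>B v. x e} = {e\<in>B v. y e}" using that by auto
      then show ?thesis by simp
    qed
    show "?R x = ?R y" if eq: "\<And>e. e \<in> S - B v \<Longrightarrow> x e = y e" for x y
    proof -
      have "x e = y e" if "e \<in> F" for e using eq that insert.prems(2) Bv by auto
      moreover have "{e\<in>B w. x e} = {e\<in>B w. y e}" if "w \<in> H" for w
        using eq other[OF that] insert.prems(3)[of w] that by fastforce
      ultimately show ?thesis by (auto cong: prod.cong)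
    qed
  qed (use insert.prems Bv in auto)
  moreover have "B v \<union> (S - B v) = S" using Bv by auto
  moreover have "measure_pmf.expectation (?P (B v)) (\<lambda>x. g v (card {e\<in>B v. x e})) =
    measure_pmf.expectation (binomial_pmf (card (B v)) a) (g v)"
    using a by (subst binomial_pmf_altdef'[OF Bv(3) refl, where dflt = False]) auto
  moreover have "measure_pmf.expectation (?P (S - B v)) ?R =
    a ^ card F * (\<Prod>v\<in>H. measure_pmf.expectation (binomial_pmf (card (B v)) a) (g v))"
  proof (rule insert.IH)
    show "disjoint_family_on B H" using insert.prems(5) by (auto simp: disjoint_family_on_def)
    show "F \<subseteq> S - B v" using insert.prems(2) Bv(2) by blast
    show "B w \<subseteq> S - B v" if "w \<in> H" for w using insert.prems(3)[of w] other[OF that] that by auto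
  qed (use insert.prems(1,4) in auto)
  ultimately show ?case using insert.hyps by (simp add: mult_ac)
qed

section \<open>Trees placed in a random graph\<close>

lemma expectation_erdos_renyi:
  fixes f :: "nat set set \<Rightarrow> real"
  shows "measure_pmf.expectation (erdos_renyi n a) f =
    measure_pmf.expectation (Pi_pmf (vertex_pairs n) False (\<lambda>_. bernoulli_pmf a))
      (\<lambda>x. f {e \<in> vertex_pairs n. x e})"
  by (simp add: erdos_renyi_def)

lemma set_erdos_renyi_subset: "E \<in> set_pmf (erdos_renyi n a) \<Longrightarrow> E \<subseteq> vertex_pairs n"
  by (auto simp: erdos_renyi_def)

lemma integrable_erdos_renyi [simp]:
  fixes f :: "_ \<Rightarrow> real"
  shows "integrable (measure_pmf (erdos_renyi n a)) f"
proof (rule integrable_measure_pmf_finite)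
  show "finite (set_pmf (erdos_renyi n a))"
    by (rule finite_subset[of _ "Pow (vertex_pairs n)"]) (use set_erdos_renyi_subset finite_vertex_pairs in blast)+
qed

lemma expectation_erdos_renyi_cong:
  fixes f g :: "_ \<Rightarrow> real"
  assumes "\<And>E. E \<subseteq> vertex_pairs n \<Longrightarrow> f E = g E"
  shows "measure_pmf.expectation (erdos_renyi n a) f = measure_pmf.expectation (erdos_renyi n a) g"
  by (intro integral_cong_AE) (auto intro!: AE_pmfI assms set_erdos_renyi_subset)

lemma expectation_erdos_renyi_mono:
  fixes f g :: "_ \<Rightarrow> real"
  assumes "\<And>E. E \<subseteq> vertex_pairs n \<Longrightarrow> f E \<le> g E"
  shows "measure_pmf.expectation (erdos_renyi n a) f \<le> measure_pmf.expectation (erdos_renyi n a) g"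
  by (intro integral_mono_AE) (auto intro!: AE_pmfI assms set_erdos_renyi_subset)

lemma expectation_erdos_renyi_edges:
  assumes F: "F \<subseteq> vertex_pairs n" and a: "0 \<le> a" "a \<le> 1"
  shows "measure_pmf.expectation (erdos_renyi n a) (\<lambda>E. of_bool (F \<subseteq> E) :: real) = a ^ card F"
proof -
  have "F \<subseteq> {e \<in> vertex_pairs n. x e} \<longleftrightarrow> (\<forall>e\<in>F. x e)" for x using F by auto
  then show ?thesis
    unfolding expectation_erdos_renyi using expectation_Pi_pmf_bernoulli_all[OF finite_vertex_pairs F a] by simp
qed

definition tree_edges :: "(nat list \<Rightarrow> nat) \<Rightarrow> nat list set \<Rightarrow> nat set set" where
  "tree_edges \<phi> H = (\<lambda>y. {\<phi> y, \<phi> (butlast y)}) ` (H - {[]})"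

definition placement :: "nat \<Rightarrow> nat list set \<Rightarrow> (nat list \<Rightarrow> nat) \<Rightarrow> bool" where
  "placement n H \<phi> \<longleftrightarrow> inj_on \<phi> H \<and> \<phi> ` H \<subseteq> {1..n}"

context
  fixes H J n \<phi>
  assumes H: "canonical_tree H J" and pl: "placement n H \<phi>"
begin

lemma placed_facts:
  shows "finite H" "[] \<in> H" "\<And>y i. y @ [i] \<in> H \<longleftrightarrow> y \<in> H \<and> i < J y" "\<And>y. y \<in> H \<Longrightarrow> butlast y \<in> H"
    "inj_on \<phi> H" "\<And>y. y \<in> H \<Longrightarrow> \<phi> y \<in> {1..n}"
  using H pl canonical_tree_butlast[OF H] by (auto simp: canonical_tree_def placement_def)

lemma placed_eq_iff: "y \<in> H \<Longrightarrow> z \<in> H \<Longrightarrow> \<phi> y = \<phi> z \<longleftrightarrow> y = z"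
  using placed_facts(5) by (auto simp: inj_on_def)

lemma butlast_neq: "y \<noteq> [] \<Longrightarrow> butlast y \<noteq> (y :: nat list)"
proof
  assume "y \<noteq> []" "butlast y = y"
  then have "length y - 1 = length y" by (metis length_butlast)
  then show False using \<open>y \<noteq> []\<close> by (cases y) auto
qed

lemma tree_edges_subset: "tree_edges \<phi> H \<subseteq> vertex_pairs n"
proof
  fix f assume "f \<in> tree_edges \<phi> H"
  then obtain y where y: "y \<in> H" "y \<noteq> []" "f = {\<phi> y, \<phi> (butlast y)}" by (auto simp: tree_edges_def)
  then show "f \<in> vertex_pairs n"
    using placed_facts(4,6) placed_eq_iff[of y "butlast y"] butlast_neq[of y]
    by (auto simp: doubleton_in_vertex_pairs)
qed

lemma tree_edge_iff:
  assumes "x \<in> H" "y \<in> H"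
  shows "{\<phi> x, \<phi> y} \<in> tree_edges \<phi> H \<longleftrightarrow> (x \<noteq> [] \<and> y = butlast x) \<or> (\<exists>i<J x. y = x @ [i])"
proof
  assume "{\<phi> x, \<phi> y} \<in> tree_edges \<phi> H"
  then obtain z where z: "z \<in> H" "z \<noteq> []" "{\<phi> x, \<phi> y} = {\<phi> z, \<phi> (butlast z)}" by (auto simp: tree_edges_def)
  then have "(x = z \<and> y = butlast z) \<or> (x = butlast z \<and> y = z)"
    using assms placed_facts(4)[OF z(1)] placed_eq_iff by (auto simp: doubleton_eq_iff)
  then show "(x \<noteq> [] \<and> y = butlast x) \<or> (\<exists>i<J x. y = x @ [i])"
  proof
    assume *: "x = butlast z \<and> y = z"
    then have "y = x @ [last z]" using z by simp
    then show ?thesis using placed_facts(3)[of x "last z"] assms by auto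
  qed (use z in auto)
next
  assume "(x \<noteq> [] \<and> y = butlast x) \<or> (\<exists>i<J x. y = x @ [i])"
  then show "{\<phi> x, \<phi> y} \<in> tree_edges \<phi> H"
    using assms by (auto simp: tree_edges_def insert_commute image_iff intro: bexI[of _ x] bexI[of _ y])
qed

lemma inj_on_tree_edges: "inj_on (\<lambda>y. {\<phi> y, \<phi> (butlast y)}) (H - {[]})"
proof (rule inj_onI)
  fix y z assume y: "y \<in> H - {[]}" and z: "z \<in> H - {[]}" and eq: "{\<phi> y, \<phi> (butlast y)} = {\<phi> z, \<phi> (butlast z)}"
  then have "y = z \<or> (y = butlast z \<and> butlast y = z)"
    using placed_facts(4) placed_eq_iff by (auto simp: doubleton_eq_iff)
  \<comment> \<open>Otherwise each of the two words would be shorter than the other.\<close>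
  moreover have "\<not> (y = butlast z \<and> butlast y = z)"
  proof
    assume "y = butlast z \<and> butlast y = z"
    then have "length y = length z - 1" "length z = length y - 1" by (metis length_butlast)+
    then show False using z y by (cases y; cases z) auto
  qed
  ultimately show "y = z" by blast
qed

lemma card_tree_edges: "card (tree_edges \<phi> H) = card H - 1"
  unfolding tree_edges_def card_image[OF inj_on_tree_edges] using placed_facts(1,2) by simp

lemma card_tree_edges_at:
  assumes v: "v \<in> H"
  shows "card {f \<in> tree_edges \<phi> H. \<phi> v \<in> f} = J v + (if v = [] then 0 else 1)"
proof -
  let ?Y = "{y \<in> H - {[]}. y = v \<or> butlast y = v}"
  have "{f \<in> tree_edges \<phi> H. \<phi> v \<in> f} = (\<lambda>y. {\<phi> y, \<phi> (butlast y)}) ` ?Y"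
    using v placed_facts(4) placed_eq_iff by (auto simp: tree_edges_def)
  moreover have "card ((\<lambda>y. {\<phi> y, \<phi> (butlast y)}) ` ?Y) = card ?Y"
    by (rule card_image[OF inj_on_subset[OF inj_on_tree_edges]]) auto
  ultimately have "card {f \<in> tree_edges \<phi> H. \<phi> v \<in> f} = card ?Y" by (simp only:)
  also have "?Y = (if v = [] then {} else {v}) \<union> (\<lambda>i. v @ [i]) ` {..<J v}"
  proof (rule equalityI; rule subsetI)
    fix y assume "y \<in> ?Y"
    then show "y \<in> (if v = [] then {} else {v}) \<union> (\<lambda>i. v @ [i]) ` {..<J v}"
      using placed_facts(3)[of v "last y"] by (cases y rule: rev_cases) auto
  qed (use v placed_facts(3) placed_facts(3)[of "[]", simplified] in \<open>auto split: if_splits\<close>)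
  also have "card \<dots> = J v + (if v = [] then 0 else 1)"
    by (subst card_Un_disjoint) (auto simp: card_image inj_on_def)
  finally show ?thesis .
qed

text \<open>The pairs from a placed vertex to vertices that are not placed. These sets are disjoint
  for different \<open>v\<close> and avoid the tree edges, which makes the outer degrees independent
  binomial variables.\<close>

definition outer_edges :: "nat list \<Rightarrow> nat set set" where
  "outer_edges v = (\<lambda>u. {\<phi> v, u}) ` ({1..n} - \<phi> ` H)"

text \<open>The pairs that would create a cycle or correlate two degrees. Their number is bounded
  independently of \<open>n\<close>; the intersection with \<open>vertex_pairs n\<close> discards
  the singletons that arise from \<open>x = y\<close>.\<close>

definition inner_pairs :: "nat set set" where
  "inner_pairs = (\<lambda>(x, y). {\<phi> x, \<phi> y}) ` (H \<times> H) \<inter> vertex_pairs n - tree_edges \<phi> H"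

lemma card_inner_pairs: "card inner_pairs \<le> card H * card H"
proof -
  have "card inner_pairs \<le> card ((\<lambda>(x, y). {\<phi> x, \<phi> y}) ` (H \<times> H))"
    unfolding inner_pairs_def using placed_facts(1) by (intro card_mono) auto
  also have "\<dots> \<le> card (H \<times> H)" using placed_facts(1) by (intro card_image_le) auto
  finally show ?thesis by (simp add: card_cartesian_product)
qed

lemma finite_inner_pairs: "finite inner_pairs"
  unfolding inner_pairs_def using placed_facts(1) by auto

lemma card_outer_edges:
  assumes v: "v \<in> H" shows "card (outer_edges v) = n - card H"
proof -
  have "inj_on (\<lambda>u. {\<phi> v, u}) ({1..n} - \<phi> ` H)"
    using v by (auto simp: inj_on_def doubleton_eq_iff)
  then have "card (outer_edges v) = card ({1..n} - \<phi> ` H)"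
    unfolding outer_edges_def by (rule card_image)
  also have "\<dots> = n - card (\<phi> ` H)"
    using placed_facts(1,6) by (subst card_Diff_subset) auto
  finally show ?thesis using card_image[OF placed_facts(5)] by simp
qed

lemma outer_edges_subset: "v \<in> H \<Longrightarrow> outer_edges v \<subseteq> vertex_pairs n"
  using placed_facts(6)[of v] by (auto simp: outer_edges_def doubleton_in_vertex_pairs)

lemma outer_edges_disjoint_tree: "outer_edges v \<inter> tree_edges \<phi> H = {}"
  using placed_facts(4) by (auto simp: outer_edges_def tree_edges_def doubleton_eq_iff)

lemma disjoint_outer_edges: "disjoint_family_on outer_edges H"
  unfolding disjoint_family_on_def
  using placed_eq_iff by (auto simp: outer_edges_def doubleton_eq_iff)

lemma pairs_at_placed:
  assumes v: "v \<in> H" and f: "f \<in> vertex_pairs n" "\<phi> v \<in> f"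
  shows "f \<in> tree_edges \<phi> H \<or> f \<in> inner_pairs \<or> f \<in> outer_edges v"
proof -
  have "card f = 2" "f \<subseteq> {1..n}" using f by (auto simp: vertex_pairs_def)
  then obtain u where u: "f = {\<phi> v, u}" using f by (auto simp: card_2_iff)
  show ?thesis
  proof (cases "u \<in> \<phi> ` H")
    case True
    then obtain y where "y \<in> H" "u = \<phi> y" by auto
    then have "f \<in> (\<lambda>(x, y). {\<phi> x, \<phi> y}) ` (H \<times> H)" using u v by auto
    then show ?thesis using f by (auto simp: inner_pairs_def)
  next
    case False
    then show ?thesis using u \<open>f \<subseteq> {1..n}\<close> by (auto simp: outer_edges_def)
  qed
qed

text \<open>Without inner pairs, a degree is a deterministic part, the degree inside the tree, plus
  a count of outer edges. The former is the shift by \<open>J v\<close> that the Mecke equation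
  produces on the tree side.\<close>

lemma edge_degree_placed:
  assumes v: "v \<in> H" and E: "E \<subseteq> vertex_pairs n" and tree: "tree_edges \<phi> H \<subseteq> E" and inner: "E \<inter> inner_pairs = {}"
  shows "edge_degree E (\<phi> v) = J v + (if v = [] then 0 else 1) + card {f \<in> outer_edges v. f \<in> E}"
proof -
  have fin: "finite E" using E finite_vertex_pairs finite_subset by blast
  have "{f \<in> E. \<phi> v \<in> f} = {f \<in> tree_edges \<phi> H. \<phi> v \<in> f} \<union> {f \<in> outer_edges v. f \<in> E}"
    using pairs_at_placed[OF v] E tree inner by (auto simp: outer_edges_def)
  moreover have "finite {f \<in> tree_edges \<phi> H. \<phi> v \<in> f}" "finite {f \<in> outer_edges v. f \<in> E}"
    using tree finite_subset[OF _ fin] by auto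
  moreover have "{f \<in> tree_edges \<phi> H. \<phi> v \<in> f} \<inter> {f \<in> outer_edges v. f \<in> E} = {}"
    using outer_edges_disjoint_tree[of v] by auto
  ultimately show ?thesis
    unfolding edge_degree_def by (simp add: card_Un_disjoint card_tree_edges_at[OF v])
qed

end

section \<open>Convergence of the expected traces\<close>

text \<open>The counterpart of \<open>gw_state\<close> for one fixed placement. Since the
  \<open>card H - 1\<close> tree edges must be present, its size is at most of order
  \<open>n\<close> to the power \<open>- (card H - 1)\<close>. No falling factorials appear: summing
  over placements plays their role.\<close>

definition er_state :: "real \<Rightarrow> nat \<Rightarrow> real \<Rightarrow> nat list set \<Rightarrow> (nat list \<Rightarrow> nat) \<Rightarrow> (nat list \<Rightarrow> nat) \<Rightarrow> nat list \<Rightarrow> nat \<Rightarrow> real" where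
  "er_state c n a H \<phi> e x k = measure_pmf.expectation (erdos_renyi n a)
     (\<lambda>E. of_bool (tree_edges \<phi> H \<subseteq> E) * (\<Prod>v\<in>H. walk_weight c (edge_degree E (\<phi> v)) ^ e v) *
       kpow {1..n} (walk_kernel c E) k (\<phi> x) (\<phi> []))"

lemma prod_walk_weight_bounds:
  assumes "c \<ge> 0"
  shows "0 \<le> (\<Prod>v\<in>H. walk_weight c (d v) ^ e v)" "(\<Prod>v\<in>H. walk_weight c (d v) ^ e v) \<le> 1"
  using assms by (auto intro!: prod_nonneg prod_le_1 simp: walk_weight_nonneg walk_weight_le_1 power_le_one)

text \<open>One additional edge raises the number of required edges from \<open>card H - 1\<close>
  to \<open>card H\<close>. This is the gain of a factor \<open>a\<close> in both error
  bounds.\<close>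

lemma card_insert_tree_edges:
  assumes H: "canonical_tree H J" and pl: "placement n H \<phi>" and f: "f \<notin> tree_edges \<phi> H"
  shows "card (insert f (tree_edges \<phi> H)) = card H"
proof -
  note pf = placed_facts[OF H pl]
  have "finite (tree_edges \<phi> H)" unfolding tree_edges_def using pf(1) by auto
  moreover have "card H \<noteq> 0" using pf(1,2) by auto
  ultimately show ?thesis using f card_tree_edges[OF H pl] by simp
qed

text \<open>The error comes from edges between placed vertices that are not tree edges.\<close>

lemma er_state_0:
  assumes c: "c \<ge> 0" and a: "0 \<le> a" "a \<le> 1" and H: "canonical_tree H J" and pl: "placement n H \<phi>"
  shows "\<bar>er_state c n a H \<phi> e [] 0 - a ^ (card H - 1) * (\<Prod>v\<in>H. measure_pmf.expectation (binomial_pmf (n - card H) a)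
      (\<lambda>m. walk_weight c (m + J v + (if v = [] then 0 else 1)) ^ e v))\<bar> \<le> real (card H) ^ 2 * a ^ card H"
proof -
  note pf = placed_facts[OF H pl]
  let ?T = "tree_edges \<phi> H" and ?I = "inner_pairs H n \<phi>" and ?O = "outer_edges H n \<phi>"
  let ?E = "measure_pmf.expectation (erdos_renyi n a)"
  define g where "g v m = walk_weight c (m + J v + (if v = [] then 0 else 1)) ^ e v" for v m
  define X where "X E = of_bool (?T \<subseteq> E) * (\<Prod>v\<in>H. walk_weight c (edge_degree E (\<phi> v)) ^ e v)" for E
  \<comment> \<open>\<open>Y\<close> replaces each true degree by the tree degree plus the number of
    outer edges. It differs from \<open>X\<close> only if some inner pair is an edge, and then by at
    most 1.\<close>
  define Y where "Y E = of_bool (?T \<subseteq> E) * (\<Prod>v\<in>H. g v (card {f \<in> ?O v. f \<in> E}))" for E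
  have X: "er_state c n a H \<phi> e [] 0 = ?E X" by (simp add: er_state_def X_def[abs_def])
  have g01: "0 \<le> (\<Prod>v\<in>H. g v (m v))" "(\<Prod>v\<in>H. g v (m v)) \<le> 1" for m
    unfolding g_def by (rule prod_walk_weight_bounds[OF c])+
  have diff: "\<bar>X E - Y E\<bar> \<le> (\<Sum>f\<in>?I. of_bool (insert f ?T \<subseteq> E))" if E: "E \<subseteq> vertex_pairs n" for E
  proof (cases "?T \<subseteq> E")
    case T: True
    show ?thesis
    proof (cases "E \<inter> ?I = {}")
      case True
      have "X E = Y E"
        using edge_degree_placed[OF H pl _ E T True] by (auto simp: X_def Y_def g_def add_ac intro!: prod.cong)
      then show ?thesis by (simp add: sum_nonneg)
    next
      case False
      then obtain f where f: "f \<in> E" "f \<in> ?I" by auto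
      have "\<bar>X E - Y E\<bar> \<le> 1"
        using prod_walk_weight_bounds[OF c, of "\<lambda>v. edge_degree E (\<phi> v)" e H] g01[of "\<lambda>v. card {f \<in> ?O v. f \<in> E}"] T
        by (simp add: X_def Y_def abs_le_iff)
      also have "1 = (of_bool (insert f ?T \<subseteq> E) :: real)" using f T by simp
      also have "\<dots> \<le> (\<Sum>f\<in>?I. of_bool (insert f ?T \<subseteq> E))"
        using f finite_inner_pairs[OF H pl] by (intro member_le_sum) auto
      finally show ?thesis .
    qed
  qed (auto simp: X_def Y_def sum_nonneg)
  have "\<bar>?E X - ?E Y\<bar> = \<bar>?E (\<lambda>E. X E - Y E)\<bar>" by simp
  also have "\<dots> \<le> ?E (\<lambda>E. \<bar>X E - Y E\<bar>)" by (rule integral_abs_bound)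
  also have "\<dots> \<le> ?E (\<lambda>E. \<Sum>f\<in>?I. of_bool (insert f ?T \<subseteq> E))"
    by (rule expectation_erdos_renyi_mono) (rule diff)
  also have "\<dots> = (\<Sum>f\<in>?I. ?E (\<lambda>E. of_bool (insert f ?T \<subseteq> E)))"
    by (rule Bochner_Integration.integral_sum) simp
  also have "\<dots> = (\<Sum>f\<in>?I. a ^ card H)"
  proof (intro sum.cong refl)
    fix f assume f: "f \<in> ?I"
    then have "f \<in> vertex_pairs n" "f \<notin> ?T" by (auto simp: inner_pairs_def[OF H pl])
    then show "?E (\<lambda>E. of_bool (insert f ?T \<subseteq> E)) = a ^ card H"
      using tree_edges_subset[OF H pl] a card_insert_tree_edges[OF H pl]
      by (subst expectation_erdos_renyi_edges) auto
  qed
  also have "\<dots> \<le> real (card H * card H) * a ^ card H"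
    using card_inner_pairs[OF H pl] a by (simp add: mult_right_mono flip: of_nat_mult)
  finally have 1: "\<bar>?E X - ?E Y\<bar> \<le> real (card H) ^ 2 * a ^ card H" by (simp add: power2_eq_square)
  \<comment> \<open>The expectation of \<open>Y\<close> is explicit, because the tree edges and the
    sets of outer edges form disjoint blocks.\<close>
  have "?E Y = measure_pmf.expectation (Pi_pmf (vertex_pairs n) False (\<lambda>_. bernoulli_pmf a))
      (\<lambda>x. of_bool (\<forall>e\<in>?T. x e) * (\<Prod>v\<in>H. g v (card {f \<in> ?O v. x f})))"
    unfolding expectation_erdos_renyi
  proof (intro Bochner_Integration.integral_cong refl)
    fix x
    have "?T \<subseteq> {e \<in> vertex_pairs n. x e} \<longleftrightarrow> (\<forall>e\<in>?T. x e)" using tree_edges_subset[OF H pl] by auto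
    moreover have "{f \<in> ?O v. f \<in> {e \<in> vertex_pairs n. x e}} = {f \<in> ?O v. x f}" if "v \<in> H" for v
      using outer_edges_subset[OF H pl that] by auto
    ultimately show "Y {e \<in> vertex_pairs n. x e} = of_bool (\<forall>e\<in>?T. x e) * (\<Prod>v\<in>H. g v (card {f \<in> ?O v. x f}))"
      by (simp add: Y_def)
  qed
  also have "\<dots> = a ^ card ?T * (\<Prod>v\<in>H. measure_pmf.expectation (binomial_pmf (card (?O v)) a) (g v))"
    using outer_edges_subset[OF H pl] outer_edges_disjoint_tree[OF H pl]
    by (intro expectation_Pi_pmf_bernoulli_blocks pf finite_vertex_pairs a tree_edges_subset[OF H pl] disjoint_outer_edges[OF H pl]) auto
  also have "\<dots> = a ^ (card H - 1) * (\<Prod>v\<in>H. measure_pmf.expectation (binomial_pmf (n - card H) a) (g v))"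
    using card_outer_edges[OF H pl] card_tree_edges[OF H pl] by simp
  finally show ?thesis using 1 unfolding X g_def by simp
qed

lemma kpow_walk_kernel_bounds:
  assumes "c \<ge> 0" "E \<subseteq> vertex_pairs n" "x \<in> {1..n}" "y \<in> {1..n}"
  shows "0 \<le> kpow {1..n} (walk_kernel c E) k x y" "kpow {1..n} (walk_kernel c E) k x y \<le> 1"
proof -
  have s: "substochastic {1..n} (kpow {1..n} (walk_kernel c E) k)"
    by (rule substochastic_kpow[OF finite_atLeastAtMost substochastic_walk_kernel[OF assms(1,2)]])
  show "0 \<le> kpow {1..n} (walk_kernel c E) k x y" "kpow {1..n} (walk_kernel c E) k x y \<le> 1"
    by (rule substochastic_nonneg[OF s assms(3,4)], rule substochastic_le_1[OF finite_atLeastAtMost s assms(3,4)])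
qed

lemma tree_edges_insert:
  assumes H: "canonical_tree H J" and x: "x \<in> H"
  shows "tree_edges (\<phi>(x @ [J x] := u)) (insert (x @ [J x]) H) = insert {\<phi> x, u} (tree_edges \<phi> H)"
proof -
  let ?z = "x @ [J x]" and ?\<phi> = "\<phi>(x @ [J x] := u)"
  have z: "?z \<notin> H" using H by (auto simp: canonical_tree_def)
  have "insert ?z H - {[]} = insert ?z (H - {[]})" by auto
  then have "tree_edges ?\<phi> (insert ?z H) = insert {?\<phi> ?z, ?\<phi> (butlast ?z)} ((\<lambda>y. {?\<phi> y, ?\<phi> (butlast y)}) ` (H - {[]}))"
    by (simp add: tree_edges_def)
  also have "(\<lambda>y. {?\<phi> y, ?\<phi> (butlast y)}) ` (H - {[]}) = tree_edges \<phi> H"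
    unfolding tree_edges_def
  proof (intro image_cong refl)
    fix y assume "y \<in> H - {[]}"
    then have "y \<noteq> ?z" "butlast y \<noteq> ?z" using z canonical_tree_butlast[OF H, of y] by auto
    then show "{?\<phi> y, ?\<phi> (butlast y)} = {\<phi> y, \<phi> (butlast y)}" by simp
  qed
  also have "{?\<phi> ?z, ?\<phi> (butlast ?z)} = {\<phi> x, u}" using x z by auto
  finally show ?thesis .
qed

text \<open>The error comes from steps that close a cycle.\<close>

lemma er_state_Suc:
  assumes c: "c \<ge> 0" and a: "0 \<le> a" "a \<le> 1" and H: "canonical_tree H J" and pl: "placement n H \<phi>"
    and x: "x \<in> H" and e: "\<And>y. y \<notin> H \<Longrightarrow> e y = 0"
  shows "\<bar>er_state c n a H \<phi> e x (Suc k) -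
    ((if x = [] then 0 else er_state c n a H \<phi> (e(x := Suc (e x))) (butlast x) k) +
     (\<Sum>i<J x. er_state c n a H \<phi> (e(x := Suc (e x))) (x @ [i]) k) +
     (\<Sum>u\<in>{1..n} - \<phi> ` H. er_state c n a (insert (x @ [J x]) H) (\<phi>(x @ [J x] := u))
        (e(x := Suc (e x))) (x @ [J x]) k))\<bar> \<le> real (card H) * a ^ card H"
proof -
  note pf = placed_facts[OF H pl]
  let ?T = "tree_edges \<phi> H" and ?V = "{1..n}" and ?z = "x @ [J x]" and ?e = "e(x := Suc (e x))"
  let ?E = "measure_pmf.expectation (erdos_renyi n a)"
  have znot: "?z \<notin> H" using H by (auto simp: canonical_tree_def)
  have ez: "?e ?z = 0" using e[OF znot] by simp
  define W where "W E = (\<Prod>v\<in>H. walk_weight c (edge_degree E (\<phi> v)) ^ ?e v)" for E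
  define q where "q E u = kpow ?V (walk_kernel c E) k u (\<phi> [])" for E u
  define t where "t E u = of_bool (?T \<subseteq> E) * of_bool ({\<phi> x, u} \<in> E) * W E * q E u" for E u
  \<comment> \<open>The neighbours of \<open>x\<close> inside the explored tree: its parent and its
    used children.\<close>
  define N where "N = {y. (x \<noteq> [] \<and> y = butlast x) \<or> (\<exists>i<J x. y = x @ [i])}"
  have N_sum: "(\<Sum>y\<in>N. h y) = (if x = [] then 0 else h (butlast x)) + (\<Sum>i<J x. h (x @ [i]))" for h :: "nat list \<Rightarrow> real"
  proof -
    have "N = (if x = [] then {} else {butlast x}) \<union> (\<lambda>i. x @ [i]) ` {..<J x}"
      by (auto simp: N_def)
    moreover have "(\<Sum>y\<in>(if x = [] then {} else {butlast x}) \<union> (\<lambda>i. x @ [i]) ` {..<J x}. h y) =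
      (\<Sum>y\<in>(if x = [] then {} else {butlast x}). h y) + (\<Sum>y\<in>(\<lambda>i. x @ [i]) ` {..<J x}. h y)"
      using butlast_neq_snoc[of x] by (intro sum.union_disjoint) auto
    moreover have "(\<Sum>y\<in>(\<lambda>i. x @ [i]) ` {..<J x}. h y) = (\<Sum>i<J x. h (x @ [i]))"
      by (subst sum.reindex) (auto simp: inj_on_def)
    ultimately show ?thesis by simp
  qed
  have NH: "N \<subseteq> H" using pf(3,4) x by (auto simp: N_def)
  have W01: "0 \<le> W E" "W E \<le> 1" for E unfolding W_def by (rule prod_walk_weight_bounds[OF c])+
  have W_upd: "W E = (\<Prod>v\<in>H. walk_weight c (edge_degree E (\<phi> v)) ^ e v) * walk_weight c (edge_degree E (\<phi> x))" for E
  proof -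
    have "W E = (\<Prod>v\<in>H. walk_weight c (edge_degree E (\<phi> v)) ^ e v *
        (if v = x then walk_weight c (edge_degree E (\<phi> x)) else 1))"
      unfolding W_def by (intro prod.cong) auto
    then show ?thesis using x pf(1) by (simp add: prod.distrib prod.delta)
  qed
  \<comment> \<open>The next vertex is a tree neighbour of \<open>x\<close>, another placed vertex,
    or a vertex not yet placed. The middle sum is the error term.\<close>
  have split: "of_bool (?T \<subseteq> E) * (\<Prod>v\<in>H. walk_weight c (edge_degree E (\<phi> v)) ^ e v) *
      kpow ?V (walk_kernel c E) (Suc k) (\<phi> x) (\<phi> []) =
    (\<Sum>y\<in>N. t E (\<phi> y)) + (\<Sum>y\<in>H - N. t E (\<phi> y)) + (\<Sum>u\<in>?V - \<phi> ` H. t E u)" for E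
  proof -
    have "of_bool (?T \<subseteq> E) * (\<Prod>v\<in>H. walk_weight c (edge_degree E (\<phi> v)) ^ e v) *
      kpow ?V (walk_kernel c E) (Suc k) (\<phi> x) (\<phi> []) = (\<Sum>u\<in>?V. t E u)"
      unfolding kpow.simps kmul_def sum_distrib_left
      by (intro sum.cong) (auto simp: t_def q_def walk_kernel_def W_upd)
    also have "\<dots> = (\<Sum>u\<in>\<phi> ` H. t E u) + (\<Sum>u\<in>?V - \<phi> ` H. t E u)"
      using pf(1,6) by (subst sum.subset_diff[of "\<phi> ` H"]) auto
    also have "(\<Sum>u\<in>\<phi> ` H. t E u) = (\<Sum>y\<in>H. t E (\<phi> y))"
      using pf(5) by (subst sum.reindex) auto
    also have "\<dots> = (\<Sum>y\<in>N. t E (\<phi> y)) + (\<Sum>y\<in>H - N. t E (\<phi> y))"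
      using NH pf(1) by (subst sum.subset_diff[of N]) auto
    finally show ?thesis .
  qed
  have tN: "?E (\<lambda>E. t E (\<phi> y)) = er_state c n a H \<phi> ?e y k" if "y \<in> N" for y
  proof -
    have "{\<phi> x, \<phi> y} \<in> ?T"
      using that NH tree_edge_iff[OF H pl x, of y] by (auto simp: N_def)
    then show ?thesis unfolding er_state_def t_def W_def q_def
      by (intro Bochner_Integration.integral_cong refl) (auto simp: of_bool_def)
  qed
  have tnew: "?E (\<lambda>E. t E u) = er_state c n a (insert ?z H) (\<phi>(?z := u)) ?e ?z k" if "u \<in> ?V - \<phi> ` H" for u
  proof -
    have "(\<Prod>v\<in>insert ?z H. walk_weight c (edge_degree E ((\<phi>(?z := u)) v)) ^ ?e v) = W E" for E
    proof -
      have "(\<Prod>v\<in>insert ?z H. walk_weight c (edge_degree E ((\<phi>(?z := u)) v)) ^ ?e v) =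
        (\<Prod>v\<in>H. walk_weight c (edge_degree E ((\<phi>(?z := u)) v)) ^ ?e v)"
        using znot pf(1) ez by (subst prod.insert) simp_all
      also have "\<dots> = W E" unfolding W_def using znot by (intro prod.cong) auto
      finally show ?thesis .
    qed
    then show ?thesis unfolding er_state_def t_def q_def tree_edges_insert[OF H x]
      by (intro Bochner_Integration.integral_cong refl) (auto simp: of_bool_def)
  qed
  have trest: "0 \<le> ?E (\<lambda>E. t E (\<phi> y)) \<and> ?E (\<lambda>E. t E (\<phi> y)) \<le> a ^ card H" if y: "y \<in> H - N" for y
  proof
    have q01: "0 \<le> q E (\<phi> y)" "q E (\<phi> y) \<le> 1" if "E \<subseteq> vertex_pairs n" for E
      unfolding q_def using kpow_walk_kernel_bounds[OF c that] pf(2,6) y by auto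
    show "0 \<le> ?E (\<lambda>E. t E (\<phi> y))"
      using expectation_erdos_renyi_mono[of n "\<lambda>_. 0" "\<lambda>E. t E (\<phi> y)" a] W01 q01 by (simp add: t_def)
    have notT: "{\<phi> x, \<phi> y} \<notin> ?T" using y tree_edge_iff[OF H pl x, of y] by (auto simp: N_def)
    have t_le: "t E (\<phi> y) \<le> of_bool (insert {\<phi> x, \<phi> y} ?T \<subseteq> E)" if "E \<subseteq> vertex_pairs n" for E
      using mult_le_one[OF W01(2) q01[OF that], of E] by (auto simp: t_def of_bool_def)
    show "?E (\<lambda>E. t E (\<phi> y)) \<le> a ^ card H"
    proof (cases "{\<phi> x, \<phi> y} \<in> vertex_pairs n")
      case True
      have "?E (\<lambda>E. t E (\<phi> y)) \<le> ?E (\<lambda>E. of_bool (insert {\<phi> x, \<phi> y} ?T \<subseteq> E))"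
        by (rule expectation_erdos_renyi_mono) (rule t_le)
      also have "\<dots> = a ^ card (insert {\<phi> x, \<phi> y} ?T)"
        using True tree_edges_subset[OF H pl] a by (intro expectation_erdos_renyi_edges) auto
      finally show ?thesis unfolding card_insert_tree_edges[OF H pl notT] .
    next
      \<comment> \<open>This is the case \<open>y = x\<close>: the graph has no loops.\<close>
      case False
      have "?E (\<lambda>E. t E (\<phi> y)) = ?E (\<lambda>E. 0)"
        using False by (intro expectation_erdos_renyi_cong) (auto simp: t_def)
      then show ?thesis using a by simp
    qed
  qed
  have "er_state c n a H \<phi> e x (Suc k) =
    (\<Sum>y\<in>N. ?E (\<lambda>E. t E (\<phi> y))) + (\<Sum>y\<in>H - N. ?E (\<lambda>E. t E (\<phi> y))) + (\<Sum>u\<in>?V - \<phi> ` H. ?E (\<lambda>E. t E u))"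
    unfolding er_state_def split by (simp add: Bochner_Integration.integral_sum)
  also have "(\<Sum>y\<in>N. ?E (\<lambda>E. t E (\<phi> y))) = (\<Sum>y\<in>N. er_state c n a H \<phi> ?e y k)"
    using tN by simp
  also have "(\<Sum>u\<in>?V - \<phi> ` H. ?E (\<lambda>E. t E u)) =
    (\<Sum>u\<in>?V - \<phi> ` H. er_state c n a (insert ?z H) (\<phi>(?z := u)) ?e ?z k)"
    using tnew by (intro sum.cong) auto
  finally have eq: "er_state c n a H \<phi> e x (Suc k) - ((\<Sum>y\<in>N. er_state c n a H \<phi> ?e y k) +
     (\<Sum>u\<in>?V - \<phi> ` H. er_state c n a (insert ?z H) (\<phi>(?z := u)) ?e ?z k)) = (\<Sum>y\<in>H - N. ?E (\<lambda>E. t E (\<phi> y)))"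
    by linarith
  have "\<bar>\<Sum>y\<in>H - N. ?E (\<lambda>E. t E (\<phi> y))\<bar> = (\<Sum>y\<in>H - N. ?E (\<lambda>E. t E (\<phi> y)))"
    using trest by (intro abs_of_nonneg sum_nonneg) auto
  also have "\<dots> \<le> (\<Sum>y\<in>H - N. a ^ card H)" using trest by (intro sum_mono) auto
  also have "\<dots> = real (card (H - N)) * a ^ card H" by simp
  also have "\<dots> \<le> real (card H) * a ^ card H"
    using a pf(1) by (intro mult_right_mono) (auto intro!: card_mono)
  finally show ?thesis using eq unfolding N_sum by simp
qed

text \<open>Convergence along this filter is convergence in \<open>n\<close>, uniformly in the placement of \<open>H\<close>.\<close>

definition placed_filter :: "nat list set \<Rightarrow> (nat \<times> (nat list \<Rightarrow> nat)) filter" where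
  "placed_filter H = inf (filtercomap fst sequentially) (principal {(n, \<phi>). placement n H \<phi>})"

lemma eventually_placed_filter:
  "eventually P (placed_filter H) \<longleftrightarrow> (\<forall>\<^sub>F n in sequentially. \<forall>\<phi>. placement n H \<phi> \<longrightarrow> P (n, \<phi>))"
proof -
  have "eventually P (placed_filter H) \<longleftrightarrow> (\<exists>Q. eventually Q sequentially \<and> (\<forall>z. Q (fst z) \<longrightarrow> z \<in> {(n, \<phi>). placement n H \<phi>} \<longrightarrow> P z))"
    unfolding placed_filter_def eventually_inf_principal eventually_filtercomap by simp
  also have "\<dots> \<longleftrightarrow> (\<forall>\<^sub>F n in sequentially. \<forall>\<phi>. placement n H \<phi> \<longrightarrow> P (n, \<phi>))"
  proof
    assume "\<exists>Q. eventually Q sequentially \<and> (\<forall>z. Q (fst z) \<longrightarrow> z \<in> {(n, \<phi>). placement n H \<phi>} \<longrightarrow> P z)"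
    then obtain Q where Q: "eventually Q sequentially" "\<And>z. Q (fst z) \<Longrightarrow> z \<in> {(n, \<phi>). placement n H \<phi>} \<Longrightarrow> P z" by blast
    from Q(1) show "\<forall>\<^sub>F n in sequentially. \<forall>\<phi>. placement n H \<phi> \<longrightarrow> P (n, \<phi>)"
      by eventually_elim (use Q(2) in auto)
  next
    assume "\<forall>\<^sub>F n in sequentially. \<forall>\<phi>. placement n H \<phi> \<longrightarrow> P (n, \<phi>)"
    then show "\<exists>Q. eventually Q sequentially \<and> (\<forall>z. Q (fst z) \<longrightarrow> z \<in> {(n, \<phi>). placement n H \<phi>} \<longrightarrow> P z)"
      by (intro exI[of _ "\<lambda>n. \<forall>\<phi>. placement n H \<phi> \<longrightarrow> P (n, \<phi>)"]) auto
  qed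
  finally show ?thesis .
qed

lemma tendsto_placed_filter_fst:
  assumes "h \<longlonglongrightarrow> L"
  shows "((\<lambda>z. h (fst z)) \<longlongrightarrow> L) (placed_filter H)"
proof -
  have "filterlim fst sequentially (placed_filter H)"
    unfolding placed_filter_def by (rule filterlim_mono[OF filterlim_filtercomap order_refl inf_le1])
  then show ?thesis by (rule filterlim_compose[OF assms])
qed

lemma tendsto_by_error_bound:
  fixes f g h :: "'a \<Rightarrow> real"
  assumes "(f \<longlongrightarrow> L) F" and "eventually (\<lambda>z. \<bar>g z - f z\<bar> \<le> h z) F" and "(h \<longlongrightarrow> 0) F"
  shows "(g \<longlongrightarrow> L) F"
proof -
  have "((\<lambda>z. g z - f z) \<longlongrightarrow> 0) F"
    by (rule Lim_null_comparison[OF _ assms(3)]) (use assms(2) in simp)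
  from tendsto_add[OF this assms(1)] show ?thesis by simp
qed

text \<open>The scaling makes up for \<open>m - 1\<close> edges, so \<open>m\<close> required edges
  leave a factor \<open>1 / n\<close>.\<close>

lemma scaled_power_tendsto_0:
  assumes "m > 0"
  shows "(\<lambda>n. real n ^ (m - 1) * (C * (p / real n) ^ m)) \<longlonglongrightarrow> 0"
proof -
  have "(\<lambda>n. C * p ^ m * (1 / real n)) \<longlonglongrightarrow> C * p ^ m * 0"
    by (intro tendsto_mult tendsto_const lim_1_over_n)
  moreover have "\<forall>\<^sub>F n in sequentially. C * p ^ m * (1 / real n) = real n ^ (m - 1) * (C * (p / real n) ^ m)"
    using eventually_gt_at_top[of 0]
  proof eventually_elim
    case (elim n)
    have "real n ^ m = real n ^ (m - 1) * real n"
      using assms by (metis Suc_diff_1 power_Suc2)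
    then show ?case using elim by (simp add: power_divide)
  qed
  ultimately show ?thesis by (simp add: tendsto_cong)
qed

text \<open>The factor \<open>real n ^ (card H - 1)\<close> compensates the probability of the tree
  edges. Uniformity in the placement is indispensable for the induction: a step to a new vertex sums
  about \<open>n\<close> states of the larger tree, each contributing about \<open>L / n\<close>,
  and their errors must be small simultaneously.\<close>

lemma er_state_limit:
  assumes c: "c \<ge> 0" and p: "p > 0"
  shows "canonical_tree H J \<Longrightarrow> x \<in> H \<Longrightarrow> (\<And>y. y \<notin> H \<Longrightarrow> e y = 0) \<Longrightarrow>
    ((\<lambda>z. real (fst z) ^ (card H - 1) * er_state c (fst z) (p / real (fst z)) H (snd z) e x k)
      \<longlongrightarrow> gw_state c p J H e x k) (placed_filter H)"
proof (induction k arbitrary: H J e x)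
  case (0 H J e x)
  note H = 0(1)
  have fin: "finite H" and nil: "[] \<in> H" using H by (auto simp: canonical_tree_def)
  have ev: "\<forall>\<^sub>F n in sequentially. real n > p"
    using eventually_gt_at_top[of "nat \<lceil>p\<rceil>"] by eventually_elim linarith
  show ?case
  proof (cases "x = []")
    case False
    have "er_state c n a H \<phi> e x 0 = 0" if "placement n H \<phi>" for n a \<phi>
      using placed_eq_iff[OF H that 0(2) nil] False by (simp add: er_state_def)
    then have "\<forall>\<^sub>F z in placed_filter H. real (fst z) ^ (card H - 1) * er_state c (fst z) (p / real (fst z)) H (snd z) e x 0 = 0"
      by (auto simp: eventually_placed_filter)
    then show ?thesis using False gw_state_0[OF c p fin] by (simp add: tendsto_eventually)
  next
    case True
    define g where "g v m = walk_weight c (m + J v + (if v = [] then 0 else 1)) ^ e v" for v m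
    define B where "B n = (\<Prod>v\<in>H. measure_pmf.expectation (binomial_pmf (n - card H) (p / real n)) (g v))" for n
    have m: "card H > 0" using fin nil by (auto simp: card_gt_0_iff)
    have B: "B \<longlonglongrightarrow> (\<Prod>v\<in>H. measure_pmf.expectation (poisson_pmf p) (g v))"
      unfolding B_def g_def
      by (intro tendsto_prod expectation_binomial_poisson_limit[OF p, where C = 1] walk_weight_pow_abs_le[OF c])
    have "(\<lambda>n. real n ^ (card H - 1) * ((p / real n) ^ (card H - 1) * B n)) \<longlonglongrightarrow>
      p ^ (card H - 1) * (\<Prod>v\<in>H. measure_pmf.expectation (poisson_pmf p) (g v))"
    proof -
      have "\<forall>\<^sub>F n in sequentially. p ^ (card H - 1) * B n = real n ^ (card H - 1) * ((p / real n) ^ (card H - 1) * B n)"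
        using eventually_gt_at_top[of 0] by eventually_elim (simp add: power_divide)
      from tendsto_cong[OF this] tendsto_mult[OF tendsto_const B] show ?thesis by blast
    qed
    \<comment> \<open>The edges are regrouped by their upper endpoint, as on the tree side.\<close>
    also have "p ^ (card H - 1) = (\<Prod>v\<in>H. p ^ J v)"
      using canonical_tree_sum_card[OF H] by (simp add: power_sum)
    also have "(\<Prod>v\<in>H. p ^ J v) * (\<Prod>v\<in>H. measure_pmf.expectation (poisson_pmf p) (g v)) = gw_state c p J H e x 0"
      unfolding gw_state_0[OF c p fin] g_def using True by (simp add: prod.distrib)
    finally have lim: "(\<lambda>n. real n ^ (card H - 1) * ((p / real n) ^ (card H - 1) * B n)) \<longlonglongrightarrow> gw_state c p J H e x 0" .
    show ?thesis
    proof (rule tendsto_by_error_bound[OF tendsto_placed_filter_fst[OF lim] _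
          tendsto_placed_filter_fst[OF scaled_power_tendsto_0[OF m, of "real (card H) ^ 2" p]]])
      show "\<forall>\<^sub>F z in placed_filter H. \<bar>real (fst z) ^ (card H - 1) * er_state c (fst z) (p / real (fst z)) H (snd z) e x 0 -
          real (fst z) ^ (card H - 1) * ((p / real (fst z)) ^ (card H - 1) * B (fst z))\<bar>
        \<le> real (fst z) ^ (card H - 1) * ((real (card H))\<^sup>2 * (p / real (fst z)) ^ card H)"
        unfolding eventually_placed_filter using ev
      proof (eventually_elim, intro allI impI)
        fix n \<phi> assume n: "real n > p" and pl: "placement n H \<phi>"
        have a: "0 \<le> p / real n" "p / real n \<le> 1" using n p by auto
        show "\<bar>real (fst (n, \<phi>)) ^ (card H - 1) * er_state c (fst (n, \<phi>)) (p / real (fst (n, \<phi>))) H (snd (n, \<phi>)) e x 0 -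
          real (fst (n, \<phi>)) ^ (card H - 1) * ((p / real (fst (n, \<phi>))) ^ (card H - 1) * B (fst (n, \<phi>)))\<bar>
        \<le> real (fst (n, \<phi>)) ^ (card H - 1) * ((real (card H))\<^sup>2 * (p / real (fst (n, \<phi>))) ^ card H)"
          using er_state_0[OF c a H pl, of e] unfolding fst_conv snd_conv right_diff_distrib[symmetric] abs_mult True B_def g_def
          by (intro mult_mono) auto
      qed
    qed
  qed
next
  case (Suc k H J e x)
  note H = Suc.prems(1) and x = Suc.prems(2) and e = Suc.prems(3)
  have fin: "finite H" and nil: "[] \<in> H" and snoc: "\<And>y i. y @ [i] \<in> H \<longleftrightarrow> y \<in> H \<and> i < J y"
    using H by (auto simp: canonical_tree_def)
  have m: "card H > 0" using fin nil by (auto simp: card_gt_0_iff)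
  let ?z = "x @ [J x]" and ?e = "e(x := Suc (e x))" and ?J = "J(x := Suc (J x))"
  let ?H = "insert ?z H" and ?A = "\<lambda>n. p / real n"
  have znot: "?z \<notin> H" using snoc by simp
  have e': "\<And>y. y \<notin> H \<Longrightarrow> ?e y = 0" using e x by auto
  have ev: "\<forall>\<^sub>F n in sequentially. real n > p"
    using eventually_gt_at_top[of "nat \<lceil>p\<rceil>"] by eventually_elim linarith
  define L where "L = gw_state c p ?J ?H ?e ?z k"
  define S where "S n \<phi> y = real n ^ (card H - 1) * er_state c n (?A n) H \<phi> ?e y k" for n \<phi> y
  \<comment> \<open>The induction hypothesis for \<open>?H\<close> is scaled by
    \<open>n ^ card H\<close>, one power more than here, so \<open>U\<close> is close to an average
    of its terms over the position \<open>u\<close>.\<close>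
  define U where "U n \<phi> = (\<Sum>u\<in>{1..n} - \<phi> ` H. real n ^ (card H - 1) * er_state c n (?A n) ?H (\<phi>(?z := u)) ?e ?z k)" for n \<phi>
  have S: "((\<lambda>z. S (fst z) (snd z) y) \<longlongrightarrow> gw_state c p J H ?e y k) (placed_filter H)" if "y \<in> H" for y
    unfolding S_def by (rule Suc.IH[OF H that e'])
  have U: "((\<lambda>z. U (fst z) (snd z)) \<longlongrightarrow> L) (placed_filter H)"
  proof (rule tendstoI)
    fix \<epsilon> :: real assume \<epsilon>: "\<epsilon> > 0"
    have card': "card ?H - 1 = card H" using fin znot by simp
    have "((\<lambda>z. real (fst z) ^ (card ?H - 1) * er_state c (fst z) (?A (fst z)) ?H (snd z) ?e ?z k) \<longlongrightarrow> L) (placed_filter ?H)"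
      unfolding L_def using e' by (intro Suc.IH canonical_tree_insert[OF H x]) auto
    then have "\<forall>\<^sub>F z in placed_filter ?H. dist (real (fst z) ^ (card ?H - 1) * er_state c (fst z) (?A (fst z)) ?H (snd z) ?e ?z k) L < \<epsilon> / 2"
      using \<epsilon> by (intro tendstoD) auto
    then have ev1: "\<forall>\<^sub>F n in sequentially. \<forall>\<phi>. placement n ?H \<phi> \<longrightarrow> \<bar>real n ^ card H * er_state c n (?A n) ?H \<phi> ?e ?z k - L\<bar> < \<epsilon> / 2"
      unfolding eventually_placed_filter card' by (simp add: dist_real_def)
    have "(\<lambda>n. real (card H) * \<bar>L\<bar> * (1 / real n)) \<longlonglongrightarrow> real (card H) * \<bar>L\<bar> * 0"
      by (intro tendsto_mult tendsto_const lim_1_over_n)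
    then have ev2: "\<forall>\<^sub>F n in sequentially. real (card H) * \<bar>L\<bar> * (1 / real n) < \<epsilon> / 2"
      using \<epsilon> by (intro order_tendstoD) auto
    show "\<forall>\<^sub>F z in placed_filter H. dist (U (fst z) (snd z)) L < \<epsilon>"
      unfolding eventually_placed_filter using ev1 ev2 eventually_gt_at_top[of 0]
    proof (eventually_elim, intro allI impI)
      fix n \<phi>
      assume n1: "\<forall>\<phi>. placement n ?H \<phi> \<longrightarrow> \<bar>real n ^ card H * er_state c n (?A n) ?H \<phi> ?e ?z k - L\<bar> < \<epsilon> / 2"
        and n2: "real (card H) * \<bar>L\<bar> * (1 / real n) < \<epsilon> / 2" and n0: "0 < n" and pl: "placement n H \<phi>"
      let ?R = "{1..n} - \<phi> ` H" and ?s = "\<lambda>u. real n ^ card H * er_state c n (?A n) ?H (\<phi>(?z := u)) ?e ?z k"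
      have pl': "placement n ?H (\<phi>(?z := u))" if "u \<in> ?R" for u
        using pl that znot unfolding placement_def inj_on_def by (auto split: if_splits)
      have cardR: "real (card ?R) = real n - real (card H)"
      proof -
        have sub: "\<phi> ` H \<subseteq> {1..n}" and inj: "inj_on \<phi> H" using pl by (auto simp: placement_def)
        have "card ?R = n - card H" using fin sub card_image[OF inj] by (subst card_Diff_subset) auto
        moreover have "card H \<le> n" using card_mono[OF _ sub] card_image[OF inj] by simp
        ultimately show ?thesis by simp
      qed
      have nm: "real n ^ (card H - 1) = real n ^ card H / real n"
        using n0 m by (metis Suc_diff_1 nonzero_mult_div_cancel_right of_nat_0_less_iff order_less_irrefl power_Suc2)
      \<comment> \<open>The sum has only \<open>n - card H\<close> terms; the \<open>card H\<close>
        missing ones give the correction \<open>card H * L / n\<close>.\<close>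
      have eq: "U n \<phi> - L = (\<Sum>u\<in>?R. (?s u - L) / real n) - real (card H) * L / real n"
      proof -
        have "U n \<phi> = (\<Sum>u\<in>?R. ?s u / real n)" unfolding U_def nm by (intro sum.cong) auto
        moreover have "(\<Sum>u\<in>?R. (?s u - L) / real n) = (\<Sum>u\<in>?R. ?s u / real n) - real (card ?R) * (L / real n)"
          by (simp add: diff_divide_distrib sum_subtractf)
        ultimately show ?thesis using n0 unfolding cardR by (simp add: field_simps)
      qed
      have "\<bar>U n \<phi> - L\<bar> \<le> (\<Sum>u\<in>?R. \<bar>(?s u - L) / real n\<bar>) + \<bar>real (card H) * L / real n\<bar>"
        unfolding eq by (rule order.trans[OF abs_triangle_ineq4 add_right_mono[OF sum_abs]])
      also have "\<dots> < \<epsilon> / 2 + \<epsilon> / 2"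
      proof (rule add_le_less_mono)
        have "(\<Sum>u\<in>?R. \<bar>(?s u - L) / real n\<bar>) \<le> (\<Sum>u\<in>?R. (\<epsilon> / 2) / real n)"
        proof (rule sum_mono)
          fix u assume "u \<in> ?R"
          from n1[rule_format, OF pl'[OF this]]
          have "\<bar>?s u - L\<bar> \<le> \<epsilon> / 2" by (rule less_imp_le)
          from divide_right_mono[OF this, of "real n"]
          show "\<bar>(?s u - L) / real n\<bar> \<le> (\<epsilon> / 2) / real n" by (simp only: abs_divide abs_of_nat of_nat_0_le_iff)
        qed
        also have "\<dots> = real (card ?R) * ((\<epsilon> / 2) / real n)" by simp
        also have "\<dots> \<le> real n * ((\<epsilon> / 2) / real n)"
          unfolding cardR using \<epsilon> by (intro mult_right_mono) auto
        also have "\<dots> = \<epsilon> / 2" using n0 by simp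
        finally show "(\<Sum>u\<in>?R. \<bar>(?s u - L) / real n\<bar>) \<le> \<epsilon> / 2" .
        show "\<bar>real (card H) * L / real n\<bar> < \<epsilon> / 2" using n2 by (simp add: abs_mult)
      qed
      finally show "dist (U (fst (n, \<phi>)) (snd (n, \<phi>))) L < \<epsilon>" by (simp add: dist_real_def)
    qed
  qed
  have bl: "butlast x \<in> H" using canonical_tree_butlast[OF H x] .
  have lim: "((\<lambda>z. (if x = [] then 0 else S (fst z) (snd z) (butlast x)) + (\<Sum>i<J x. S (fst z) (snd z) (x @ [i])) + U (fst z) (snd z))
    \<longlongrightarrow> gw_state c p J H e x (Suc k)) (placed_filter H)"
  proof -
    have eq: "gw_state c p J H e x (Suc k) = (if x = [] then 0 else gw_state c p J H ?e (butlast x) k) +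
        (\<Sum>i<J x. gw_state c p J H ?e (x @ [i]) k) + L"
      unfolding L_def by (rule gw_state_Suc[OF c p H x]) (rule e)
    have "((\<lambda>z. if x = [] then 0 else S (fst z) (snd z) (butlast x)) \<longlongrightarrow>
        (if x = [] then 0 else gw_state c p J H ?e (butlast x) k)) (placed_filter H)"
      using S[OF bl] by (cases "x = []") auto
    moreover have "((\<lambda>z. \<Sum>i<J x. S (fst z) (snd z) (x @ [i])) \<longlongrightarrow>
        (\<Sum>i<J x. gw_state c p J H ?e (x @ [i]) k)) (placed_filter H)"
      using snoc x by (intro tendsto_sum S) simp
    ultimately show ?thesis unfolding eq by (intro tendsto_add U)
  qed
  show ?case
  proof (rule tendsto_by_error_bound[OF lim _
        tendsto_placed_filter_fst[OF scaled_power_tendsto_0[OF m, of "real (card H)" p]]])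
    show "\<forall>\<^sub>F z in placed_filter H. \<bar>real (fst z) ^ (card H - 1) * er_state c (fst z) (p / real (fst z)) H (snd z) e x (Suc k) -
        ((if x = [] then 0 else S (fst z) (snd z) (butlast x)) + (\<Sum>i<J x. S (fst z) (snd z) (x @ [i])) + U (fst z) (snd z))\<bar>
      \<le> real (fst z) ^ (card H - 1) * (real (card H) * (p / real (fst z)) ^ card H)"
      unfolding eventually_placed_filter using ev
    proof (eventually_elim, intro allI impI)
      fix n \<phi> assume n: "real n > p" and pl: "placement n H \<phi>"
      have a: "0 \<le> p / real n" "p / real n \<le> 1" using n p by auto
      let ?X = "(if x = [] then 0 else er_state c n (?A n) H \<phi> ?e (butlast x) k) +
         (\<Sum>i<J x. er_state c n (?A n) H \<phi> ?e (x @ [i]) k) +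
         (\<Sum>u\<in>{1..n} - \<phi> ` H. er_state c n (?A n) ?H (\<phi>(?z := u)) ?e ?z k)"
      have eq: "(if x = [] then 0 else S n \<phi> (butlast x)) + (\<Sum>i<J x. S n \<phi> (x @ [i])) + U n \<phi> = real n ^ (card H - 1) * ?X"
        unfolding S_def U_def by (simp add: sum_distrib_left distrib_left)
      show "\<bar>real (fst (n, \<phi>)) ^ (card H - 1) * er_state c (fst (n, \<phi>)) (p / real (fst (n, \<phi>))) H (snd (n, \<phi>)) e x (Suc k) -
        ((if x = [] then 0 else S (fst (n, \<phi>)) (snd (n, \<phi>)) (butlast x)) + (\<Sum>i<J x. S (fst (n, \<phi>)) (snd (n, \<phi>)) (x @ [i])) + U (fst (n, \<phi>)) (snd (n, \<phi>)))\<bar>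
      \<le> real (fst (n, \<phi>)) ^ (card H - 1) * (real (card H) * (p / real (fst (n, \<phi>))) ^ card H)"
        unfolding fst_conv snd_conv eq right_diff_distrib[symmetric] abs_mult power_abs abs_of_nat
        by (rule mult_left_mono[OF er_state_Suc[where k = k and e = e, OF c a H pl x e]]) simp_all
    qed
  qed
qed

text \<open>The recursion is started from the tree that consists of the root alone. Placing the root
  at \<open>v\<close> gives the diagonal entry at \<open>v\<close>, and uniformity in the placement
  lets the \<open>n\<close> entries be averaged.\<close>

lemma expectation_trace_limit:
  assumes c: "c \<ge> 0" and p: "p > 0"
  shows "(\<lambda>n. measure_pmf.expectation (erdos_renyi n (p / real n))
      (\<lambda>E. ktrace {1..n} (kpow {1..n} (walk_kernel c E) k) / real n))
    \<longlonglongrightarrow> (\<integral>N. tree_return c N k [] \<partial>galton_watson (poisson_pmf p))"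
proof (rule tendstoI)
  fix \<epsilon> :: real assume \<epsilon>: "\<epsilon> > 0"
  let ?L = "\<integral>N. tree_return c N k [] \<partial>galton_watson (poisson_pmf p)"
  have "canonical_tree {[]} (\<lambda>_. 0)" by (simp add: canonical_tree_def)
  from er_state_limit[OF c p this, of "[]" "\<lambda>_. 0" k]
  have "((\<lambda>z. er_state c (fst z) (p / real (fst z)) {[]} (snd z) (\<lambda>_. 0) [] k) \<longlongrightarrow> ?L) (placed_filter {[]})"
    by (simp add: gw_state_def gw_weight_def)
  from tendstoD[OF this, of "\<epsilon> / 2"] \<epsilon>
  have ev: "\<forall>\<^sub>F n in sequentially. \<forall>\<phi>. placement n {[]} \<phi> \<longrightarrow> \<bar>er_state c n (p / real n) {[]} \<phi> (\<lambda>_. 0) [] k - ?L\<bar> < \<epsilon> / 2"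
    by (simp add: eventually_placed_filter dist_real_def)
  show "\<forall>\<^sub>F n in sequentially. dist (measure_pmf.expectation (erdos_renyi n (p / real n))
      (\<lambda>E. ktrace {1..n} (kpow {1..n} (walk_kernel c E) k) / real n)) ?L < \<epsilon>"
    using ev eventually_gt_at_top[of 0]
  proof eventually_elim
    case (elim n)
    let ?m = "\<lambda>v. measure_pmf.expectation (erdos_renyi n (p / real n)) (\<lambda>E. kpow {1..n} (walk_kernel c E) k v v)"
    have m: "\<bar>?m v - ?L\<bar> < \<epsilon> / 2" if "v \<in> {1..n}" for v
    proof -
      have pl: "placement n {[]} (\<lambda>_. v)" using that by (simp add: placement_def)
      show ?thesis using elim(1)[rule_format, OF pl] by (simp add: er_state_def tree_edges_def)
    qed
    have eq: "measure_pmf.expectation (erdos_renyi n (p / real n))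
      (\<lambda>E. ktrace {1..n} (kpow {1..n} (walk_kernel c E) k) / real n) - ?L = (\<Sum>v\<in>{1..n}. (?m v - ?L) / real n)"
      using elim(2) unfolding ktrace_def
      by (simp add: Bochner_Integration.integral_sum sum_subtractf sum_divide_distrib diff_divide_distrib)
    have "\<bar>measure_pmf.expectation (erdos_renyi n (p / real n))
      (\<lambda>E. ktrace {1..n} (kpow {1..n} (walk_kernel c E) k) / real n) - ?L\<bar> \<le> (\<Sum>v\<in>{1..n}. \<bar>(?m v - ?L) / real n\<bar>)"
      unfolding eq by (rule sum_abs)
    also have "\<dots> \<le> (\<Sum>v\<in>{1..n}. (\<epsilon> / 2) / real n)"
    proof (rule sum_mono)
      fix v assume "v \<in> {1..n}"
      from divide_right_mono[OF less_imp_le[OF m[OF this]], of "real n"]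
      show "\<bar>(?m v - ?L) / real n\<bar> \<le> (\<epsilon> / 2) / real n" by (simp only: abs_divide abs_of_nat of_nat_0_le_iff)
    qed
    also have "\<dots> < \<epsilon>" using elim(2) \<epsilon> by simp
    finally show ?case by (simp add: dist_real_def)
  qed
qed

section \<open>Moments and weak convergence\<close>

definition graph_esd :: "real \<Rightarrow> nat \<Rightarrow> nat set set \<Rightarrow> real measure" where
  "graph_esd c n E = empirical_spectral_distribution (walk_matrix c (adjacency_matrix n E))"

definition graph_moment :: "real \<Rightarrow> nat \<Rightarrow> nat \<Rightarrow> nat set set \<Rightarrow> real" where
  "graph_moment c k n E = ktrace {1..n} (kpow {1..n} (walk_kernel c E) k) / real n"

definition unit_supported :: "real measure \<Rightarrow> bool" where
  "unit_supported \<mu> \<longleftrightarrow> real_distribution \<mu> \<and> (AE x in \<mu>. \<bar>x\<bar> \<le> 1)"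

lemma
  assumes c: "c \<ge> 0" and n: "n > 0" and E: "E \<subseteq> vertex_pairs n"
  shows unit_supported_graph_esd: "unit_supported (graph_esd c n E)"
    and moment_graph_esd: "(\<integral>x. x ^ k \<partial>graph_esd c n E) = graph_moment c k n E"
proof -
  define K where "K = walk_matrix c (adjacency_matrix n E)"
  have K_eq: "K = mat n n (\<lambda>(i, j). walk_kernel c E (Suc i) (Suc j))"
    unfolding K_def by (rule walk_matrix_adjacency[OF c E])
  have KC: "K \<in> carrier_mat n n" unfolding K_eq by simp
  have sub: "substochastic {1..n} (walk_kernel c E)" by (rule substochastic_walk_kernel[OF c E])
  have shift: "(\<Sum>j<n. f (Suc j)) = (\<Sum>u\<in>{1..n}. f u)" for f :: "nat \<Rightarrow> real"
    by (rule sum.reindex_bij_witness[of _ "\<lambda>u. u - 1" Suc]) auto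
  have sym: "degree_entry c E i * K $$ (i, j) = degree_entry c E j * K $$ (j, i)" if "i < n" "j < n" for i j
    using that degree_entry_walk_kernel[OF c E, of i j] degree_entry_walk_kernel[OF c E, of j i]
    unfolding K_eq by (simp add: insert_commute)
  obtain es where es: "char_poly K = (\<Prod>e\<leftarrow>es. [:- e, 1:])" "length es = n"
    using selfadjoint_char_poly_splits[OF KC degree_entry_pos[OF c] sym] by metis
  interpret split_matrix K n es by unfold_locales (use KC n es in auto)
  have le1: "\<bar>e\<bar> \<le> 1" if "e \<in> set es" for e
  proof (rule eigenvalue_abs_le_1[OF KC])
    show "K $$ (i, j) \<ge> 0" if "i < n" "j < n" for i j
      using that substochastic_nonneg[OF sub, of "Suc i" "Suc j"] unfolding K_eq by simp
    show "(\<Sum>j<n. K $$ (i, j)) \<le> 1" if "i < n" for i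
      using that substochastic_sum_le[OF sub, of "Suc i"] shift[of "walk_kernel c E (Suc i)"] unfolding K_eq by simp
    show "eigenvalue K e" using that eigenvalues by blast
  qed
  show "unit_supported (graph_esd c n E)"
    unfolding unit_supported_def graph_esd_def K_def[symmetric]
    using real_distribution_esd AE_esd[of "\<lambda>x. \<bar>x\<bar> \<le> 1"] le1 by blast
  have "(\<integral>x. x ^ k \<partial>graph_esd c n E) = (\<Sum>e\<leftarrow>es. e ^ k) / real n"
    unfolding graph_esd_def K_def[symmetric] by (rule integral_esd) simp
  also have "(\<Sum>e\<leftarrow>es. e ^ k) = mtrace (K ^\<^sub>m k)"
    by (rule mtrace_pow_eq_sum_list[OF KC es(1), symmetric])
  also have "\<dots> = (\<Sum>i<n. kpow {1..n} (walk_kernel c E) k (Suc i) (Suc i))"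
    unfolding mtrace_def using KC walk_matrix_pow[OF K_eq] by (intro sum.cong) auto
  also have "\<dots> = ktrace {1..n} (kpow {1..n} (walk_kernel c E) k)"
    unfolding ktrace_def by (rule shift)
  finally show "(\<integral>x. x ^ k \<partial>graph_esd c n E) = graph_moment c k n E" by (simp add: graph_moment_def)
qed

text \<open>There are at most \<open>n^2\<close> pairs, each present with probability
  \<open>p / n\<close> and moving the moment by at most \<open>4 k / n\<close>; hence
  \<open>n^2 * (p / n) * (4 k / n)^2\<close>.\<close>

lemma variance_graph_moment:
  assumes c: "c \<ge> 0" and p: "p > 0" and n: "real n > p"
  shows "measure_pmf.variance (erdos_renyi n (p / real n)) (graph_moment c k n) \<le> 16 * real k ^ 2 * p / real n"
proof -
  let ?V = "vertex_pairs n" and ?a = "p / real n" and ?L = "4 * real k / real n"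
  let ?P = "Pi_pmf ?V False (\<lambda>_. bernoulli_pmf ?a)"
  let ?f = "\<lambda>x. graph_moment c k n {e \<in> ?V. x e}"
  have n0: "real n > 0" using n p by linarith
  have a: "0 \<le> ?a" "?a \<le> 1" using n p by auto
  have diff: "\<bar>?f (x(e := True)) - ?f (x(e := False))\<bar> \<le> ?L" if e: "e \<in> ?V" for x e
  proof -
    have "\<bar>ktrace {1..n} (kpow {1..n} (walk_kernel c {e' \<in> ?V. (x(e := True)) e'}) k) -
      ktrace {1..n} (kpow {1..n} (walk_kernel c {e' \<in> ?V. (x(e := False)) e'}) k)\<bar> \<le> 4 * real k"
      using e by (intro ktrace_walk_kernel_edge_diff[OF c, of _ n _ e]) (auto simp: vertex_pairs_def)
    then show ?thesis
      using n0 unfolding graph_moment_def diff_divide_distrib[symmetric] abs_divide by (simp add: divide_right_mono)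
  qed
  have "measure_pmf.variance (erdos_renyi n ?a) (graph_moment c k n) =
    measure_pmf.expectation ?P (\<lambda>x. (?f x)\<^sup>2) - (measure_pmf.expectation ?P ?f)\<^sup>2"
    by (subst measure_pmf.variance_eq) (simp_all add: expectation_erdos_renyi)
  also have "\<dots> \<le> real (card ?V) * (?a * ?L\<^sup>2)"
    by (rule variance_Pi_pmf_bernoulli_le[OF finite_vertex_pairs a diff])
  also have "\<dots> \<le> real n ^ 2 * (?a * ?L\<^sup>2)"
    using card_vertex_pairs_le[of n] a by (intro mult_right_mono mult_nonneg_nonneg) (auto simp flip: of_nat_power)
  also have "\<dots> = 16 * real k ^ 2 * p / real n"
    using n0 by (simp add: power2_eq_square field_simps)
  finally show ?thesis .
qed

lemma prob_graph_moment_deviation: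
  assumes c: "c \<ge> 0" and p: "p > 0" and n: "real n > p" and d: "\<delta> > 0"
  shows "measure_pmf.prob (erdos_renyi n (p / real n))
      {E. \<delta> \<le> \<bar>graph_moment c k n E - measure_pmf.expectation (erdos_renyi n (p / real n)) (graph_moment c k n)\<bar>}
    \<le> (16 * real k ^ 2 * p / \<delta>\<^sup>2) * (1 / real n)"
proof -
  let ?P = "measure_pmf (erdos_renyi n (p / real n))"
  have "measure ?P {E \<in> space ?P. \<delta> \<le> \<bar>graph_moment c k n E - measure_pmf.expectation (erdos_renyi n (p / real n)) (graph_moment c k n)\<bar>}
    \<le> measure_pmf.variance (erdos_renyi n (p / real n)) (graph_moment c k n) / \<delta>\<^sup>2"
    by (rule measure_pmf.Chebyshev_inequality) (use d in auto)
  also have "\<dots> \<le> (16 * real k ^ 2 * p / real n) / \<delta>\<^sup>2"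
    by (intro divide_right_mono variance_graph_moment[OF c p n]) simp
  finally show ?thesis by (simp add: mult_ac)
qed

section \<open>Laws on \<open>[-1, 1]\<close> and their moments\<close>

lemma unit_supported_integrable:
  assumes "unit_supported \<mu>" and g: "continuous_on UNIV g" "\<And>x. \<bar>x\<bar> \<le> 1 \<Longrightarrow> \<bar>g x\<bar> \<le> B"
  shows "integrable \<mu> (g :: real \<Rightarrow> real)"
proof -
  interpret real_distribution \<mu> using assms(1) by (simp add: unit_supported_def)
  have "AE x in \<mu>. \<bar>x\<bar> \<le> 1" using assms(1) by (simp add: unit_supported_def)
  then have "AE x in \<mu>. norm (g x) \<le> B" by eventually_elim (use g in auto)
  moreover have "g \<in> borel_measurable \<mu>"
    using borel_measurable_continuous_onI[OF g(1)] by simp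
  ultimately show ?thesis by (rule integrable_const_bound)
qed

lemma unit_supported_integrable_power:
  "unit_supported \<mu> \<Longrightarrow> integrable \<mu> (\<lambda>x. x ^ k)"
  by (rule unit_supported_integrable[where B = 1]) (auto simp: power_abs power_le_one intro!: continuous_intros)

lemma unit_supported_integral_abs_le:
  assumes \<mu>: "unit_supported \<mu>" and f: "integrable \<mu> f" and le: "\<And>x. \<bar>x\<bar> \<le> 1 \<Longrightarrow> \<bar>f x\<bar> \<le> B"
  shows "\<bar>\<integral>x. f x \<partial>\<mu>\<bar> \<le> (B :: real)"
proof -
  interpret real_distribution \<mu> using \<mu> by (simp add: unit_supported_def)
  have AE: "AE x in \<mu>. \<bar>x\<bar> \<le> 1" using \<mu> by (simp add: unit_supported_def)
  have "\<bar>\<integral>x. f x \<partial>\<mu>\<bar> \<le> (\<integral>x. \<bar>f x\<bar> \<partial>\<mu>)" by (rule integral_abs_bound)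
  also have "\<dots> \<le> (\<integral>x. B \<partial>\<mu>)"
  proof (intro integral_mono_AE)
    show "AE x in \<mu>. \<bar>f x\<bar> \<le> B" using AE by eventually_elim (rule le)
  qed (use f in auto)
  finally show ?thesis using prob_space by simp
qed

text \<open>A quantitative form of Weierstrass approximation. The number of moments and the
  tolerance depend only on \<open>g\<close> and \<epsilon>, not on the measures, so the statement
  can be applied to random measures.\<close>

lemma moments_control_integral:
  fixes g :: "real \<Rightarrow> real"
  assumes g: "continuous_on UNIV g" and \<epsilon>: "\<epsilon> > 0"
  shows "\<exists>m. \<exists>\<delta>>0. \<forall>\<mu> \<nu>. unit_supported \<mu> \<longrightarrow> unit_supported \<nu> \<longrightarrow>
    (\<forall>k\<le>m. \<bar>(\<integral>x. x ^ k \<partial>\<mu>) - (\<integral>x. x ^ k \<partial>\<nu>)\<bar> \<le> \<delta>) \<longrightarrow>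
    \<bar>(\<integral>x. g x \<partial>\<mu>) - (\<integral>x. g x \<partial>\<nu>)\<bar> \<le> \<epsilon>"
proof -
  have "continuous_on {-1..1} g" using g by (rule continuous_on_subset) simp
  then obtain q where q: "real_polynomial_function q" "\<And>x. x \<in> {-1..1} \<Longrightarrow> \<bar>g x - q x\<bar> < \<epsilon> / 3"
    using Stone_Weierstrass_real_polynomial_function[of "{-1..1}" g "\<epsilon> / 3"] \<epsilon> by auto
  obtain a m where am: "q = (\<lambda>x. \<Sum>i\<le>m. a i * x ^ i)" using q(1) by (auto simp: real_polynomial_function_iff_sum)
  \<comment> \<open>The summand 1 only serves to keep \<open>A\<close> positive. Errors of
    \<epsilon>/3 come from approximating under each measure and from the moments, whence the
    tolerance \<epsilon>/(3 A).\<close>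
  define A where "A = 1 + (\<Sum>i\<le>m. \<bar>a i\<bar>)"
  have A: "A > 0" unfolding A_def by (intro add_pos_nonneg sum_nonneg) auto
  have bdd: "bounded (g ` {-1..1})"
    using \<open>continuous_on {-1..1} g\<close> by (intro compact_imp_bounded compact_continuous_image) auto
  then obtain B where "\<forall>y\<in>g ` {-1..1}. norm y \<le> B" unfolding bounded_iff ..
  then have B: "\<And>x. x \<in> {-1..1} \<Longrightarrow> \<bar>g x\<bar> \<le> B" by simp
  show ?thesis
  proof (intro exI[of _ m] exI[of _ "\<epsilon> / (3 * A)"] conjI allI impI)
    show "\<epsilon> / (3 * A) > 0" using \<epsilon> A by simp
    fix \<mu> \<nu> assume \<mu>: "unit_supported \<mu>" and \<nu>: "unit_supported \<nu>"
      and close: "\<forall>k\<le>m. \<bar>(\<integral>x. x ^ k \<partial>\<mu>) - (\<integral>x. x ^ k \<partial>\<nu>)\<bar> \<le> \<epsilon> / (3 * A)"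
    have q_int: "integrable \<rho> q" and q_eq: "(\<integral>x. q x \<partial>\<rho>) = (\<Sum>i\<le>m. a i * (\<integral>x. x ^ i \<partial>\<rho>))"
      if "unit_supported \<rho>" for \<rho>
      unfolding am using unit_supported_integrable_power[OF that] by auto
    have approx: "\<bar>(\<integral>x. g x \<partial>\<rho>) - (\<integral>x. q x \<partial>\<rho>)\<bar> \<le> \<epsilon> / 3" if \<rho>: "unit_supported \<rho>" for \<rho>
    proof -
      have gi: "integrable \<rho> g" by (rule unit_supported_integrable[OF \<rho> g B]) auto
      have "\<bar>\<integral>x. g x - q x \<partial>\<rho>\<bar> \<le> \<epsilon> / 3"
        using q(2) by (intro unit_supported_integral_abs_le[OF \<rho>] Bochner_Integration.integrable_diff gi q_int[OF \<rho>])
          (auto simp: abs_le_iff less_imp_le)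
      then show ?thesis using gi q_int[OF \<rho>] by simp
    qed
    have "(\<integral>x. q x \<partial>\<mu>) - (\<integral>x. q x \<partial>\<nu>) = (\<Sum>i\<le>m. a i * ((\<integral>x. x ^ i \<partial>\<mu>) - (\<integral>x. x ^ i \<partial>\<nu>)))"
      unfolding q_eq[OF \<mu>] q_eq[OF \<nu>] by (simp add: sum_subtractf right_diff_distrib)
    then have "\<bar>(\<integral>x. q x \<partial>\<mu>) - (\<integral>x. q x \<partial>\<nu>)\<bar> \<le> (\<Sum>i\<le>m. \<bar>a i * ((\<integral>x. x ^ i \<partial>\<mu>) - (\<integral>x. x ^ i \<partial>\<nu>))\<bar>)"
      by (simp only: sum_abs)
    also have "\<dots> \<le> (\<Sum>i\<le>m. \<bar>a i\<bar> * (\<epsilon> / (3 * A)))"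
      unfolding abs_mult using close by (intro sum_mono mult_left_mono) auto
    also have "\<dots> = (A - 1) * (\<epsilon> / (3 * A))"
    proof -
      have "(\<Sum>i\<le>m. \<bar>a i\<bar>) = A - 1" by (simp add: A_def)
      then show ?thesis by (simp only: sum_distrib_right[symmetric])
    qed
    also have "\<dots> \<le> A * (\<epsilon> / (3 * A))" using \<epsilon> A by (intro mult_right_mono) auto
    also have "\<dots> = \<epsilon> / 3" using A by simp
    finally have "\<bar>(\<integral>x. q x \<partial>\<mu>) - (\<integral>x. q x \<partial>\<nu>)\<bar> \<le> \<epsilon> / 3" .
    with approx[OF \<mu>] approx[OF \<nu>] show "\<bar>(\<integral>x. g x \<partial>\<mu>) - (\<integral>x. g x \<partial>\<nu>)\<bar> \<le> \<epsilon>" by linarith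
  qed
qed

lemma moments_tendsto_imp_integral_tendsto:
  fixes g :: "real \<Rightarrow> real"
  assumes \<nu>: "\<And>j. unit_supported (\<nu> j)" and \<mu>: "unit_supported \<mu>"
    and mom: "\<And>k. (\<lambda>j. \<integral>x. x ^ k \<partial>\<nu> j) \<longlonglongrightarrow> (\<integral>x. x ^ k \<partial>\<mu>)"
    and g: "continuous_on UNIV g"
  shows "(\<lambda>j. \<integral>x. g x \<partial>\<nu> j) \<longlonglongrightarrow> (\<integral>x. g x \<partial>\<mu>)"
proof (rule tendstoI)
  fix \<epsilon> :: real assume "\<epsilon> > 0"
  then have half: "\<epsilon> / 2 > 0" by simp
  from moments_control_integral[OF g half] obtain m \<delta> where \<delta>: "\<delta> > 0"
    and ctrl: "\<forall>\<mu> \<nu>. unit_supported \<mu> \<longrightarrow> unit_supported \<nu> \<longrightarrow>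
      (\<forall>k\<le>m. \<bar>(\<integral>x. x ^ k \<partial>\<mu>) - (\<integral>x. x ^ k \<partial>\<nu>)\<bar> \<le> \<delta>) \<longrightarrow>
      \<bar>(\<integral>x. g x \<partial>\<mu>) - (\<integral>x. g x \<partial>\<nu>)\<bar> \<le> \<epsilon> / 2" by (elim exE conjE)
  have "\<forall>\<^sub>F j in sequentially. \<forall>k\<in>{..m}. dist (\<integral>x. x ^ k \<partial>\<nu> j) (\<integral>x. x ^ k \<partial>\<mu>) < \<delta>"
    by (intro eventually_ball_finite ballI tendstoD[OF mom] \<delta>) simp
  then show "\<forall>\<^sub>F j in sequentially. dist (\<integral>x. g x \<partial>\<nu> j) (\<integral>x. g x \<partial>\<mu>) < \<epsilon>"
  proof eventually_elim
    case (elim j)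
    have "\<bar>(\<integral>x. g x \<partial>\<nu> j) - (\<integral>x. g x \<partial>\<mu>)\<bar> \<le> \<epsilon> / 2"
    proof (rule ctrl[rule_format, OF \<nu> \<mu>])
      fix k assume "k \<le> m"
      with elim show "\<bar>(\<integral>x. x ^ k \<partial>\<nu> j) - (\<integral>x. x ^ k \<partial>\<mu>)\<bar> \<le> \<delta>" by (auto simp: dist_real_def less_imp_le)
    qed
    then show ?case using \<open>\<epsilon> > 0\<close> by (simp add: dist_real_def)
  qed
qed

lemma moments_tendsto_imp_weak_conv:
  assumes \<nu>: "\<And>j. unit_supported (\<nu> j)" and \<mu>: "unit_supported \<mu>"
    and mom: "\<And>k. (\<lambda>j. \<integral>x. x ^ k \<partial>\<nu> j) \<longlonglongrightarrow> (\<integral>x. x ^ k \<partial>\<mu>)"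
  shows "weak_conv_m \<nu> \<mu>"
proof -
  have rd: "\<And>n. real_distribution (\<nu> n)" "real_distribution \<mu>" using \<nu> \<mu> by (auto simp: unit_supported_def)
  have conv: "(\<lambda>n. integral\<^sup>L (\<nu> n) f) \<longlonglongrightarrow> integral\<^sup>L \<mu> f" if "\<And>x. isCont f x" for f :: "real \<Rightarrow> real"
  proof -
    have "continuous_on UNIV f" using that by (simp add: continuous_at_imp_continuous_on)
    from moments_tendsto_imp_integral_tendsto[where \<nu> = \<nu>, OF \<nu> \<mu> mom this] show ?thesis .
  qed
  show ?thesis
    using integral_bdd_continuous_conv_imp_weak_conv[where M_seq = \<nu> and M = \<mu>, OF rd] conv by blast
qed

text \<open>Applied to a constant sequence, the convergence result gives equal integrals of all
  continuous functions. Cosines and sines then identify the characteristic functions.\<close>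

lemma moments_determine:
  assumes \<nu>: "unit_supported \<nu>" and \<mu>: "unit_supported \<mu>" and mom: "\<And>k. (\<integral>x. x ^ k \<partial>\<nu>) = (\<integral>x. x ^ k \<partial>\<mu>)"
  shows "\<nu> = \<mu>"
proof (rule Levy_uniqueness)
  show rd: "real_distribution \<nu>" "real_distribution \<mu>" using \<nu> \<mu> by (auto simp: unit_supported_def)
  have eq: "(\<integral>x. g x \<partial>\<nu>) = (\<integral>x. g x \<partial>\<mu>)" if g: "continuous_on UNIV g" for g :: "real \<Rightarrow> real"
    using moments_tendsto_imp_integral_tendsto[of "\<lambda>_. \<nu>", OF \<nu> \<mu> _ g] mom LIMSEQ_const_iff by auto
  have char: "char \<rho> t = Complex (\<integral>x. cos (t * x) \<partial>\<rho>) (\<integral>x. sin (t * x) \<partial>\<rho>)" if "real_distribution \<rho>" for \<rho> t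
  proof -
    interpret real_distribution \<rho> by fact
    have int: "complex_integrable \<rho> (\<lambda>x. iexp (t * x))" by (intro integrable_iexp) auto
    have "Re (char \<rho> t) = (\<integral>x. cos (t * x) \<partial>\<rho>)"
      unfolding char_def integral_Re[OF int, symmetric] by (simp add: Re_exp)
    moreover have "Im (char \<rho> t) = (\<integral>x. sin (t * x) \<partial>\<rho>)"
      unfolding char_def integral_Im[OF int, symmetric] by (simp add: Im_exp)
    ultimately show ?thesis by (simp add: complex_eq_iff)
  qed
  show "char \<nu> = char \<mu>"
    by (intro ext) (simp add: char rd eq continuous_intros)
qed

text \<open>Common compact support gives tightness, hence a weak subsequential limit. Powers and the
  support condition are not bounded continuous tests as they stand, so truncated substitutes carry
  them to the limit.\<close>

lemma moment_limit_exists: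
  assumes \<nu>: "\<And>j. unit_supported (\<nu> j)" and mom: "\<And>k. (\<lambda>j. \<integral>x. x ^ k \<partial>\<nu> j) \<longlonglongrightarrow> \<beta> k"
  obtains \<mu> where "unit_supported \<mu>" "\<And>k. (\<integral>x. x ^ k \<partial>\<mu>) = \<beta> k"
proof -
  have rd: "real_distribution (\<nu> j)" and AE: "AE x in \<nu> j. \<bar>x\<bar> \<le> 1" for j
    using \<nu> by (auto simp: unit_supported_def)
  have "tight \<nu>"
    unfolding tight_def
  proof (intro conjI allI impI rd)
    fix \<epsilon> :: real assume \<epsilon>: "\<epsilon> > 0"
    show "\<exists>a b. a < b \<and> (\<forall>n. 1 - \<epsilon> < measure (\<nu> n) {a<..b})"
    \<comment> \<open>The interval is open on the left, so its left endpoint has to lie strictly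
      below -1.\<close>
    proof (rule exI[of _ "-2"], rule exI[of _ 1], intro conjI allI)
      fix n
      interpret real_distribution "\<nu> n" by (rule rd)
      have "AE x in \<nu> n. x \<in> {-2<..1}" using AE[of n] by eventually_elim auto
      then have "measure (\<nu> n) {-2<..1} = 1" by (subst prob_eq_1) auto
      then show "1 - \<epsilon> < measure (\<nu> n) {-2<..1}" using \<epsilon> by simp
    qed simp
  qed
  from tight_imp_convergent_subsubsequence[OF this strict_mono_id] obtain r \<mu> where
    r: "strict_mono (r :: nat \<Rightarrow> nat)" and \<mu>: "real_distribution \<mu>" and wc: "weak_conv_m (\<nu> \<circ> r) \<mu>" by (auto simp: id_def o_def)
  interpret \<mu>: real_distribution \<mu> by (rule \<mu>)
  \<comment> \<open>A bounded continuous function that vanishes exactly on \<open>[-1, 1]\<close>; a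
    zero integral therefore forces the support condition.\<close>
  define h where "h x = min 1 (max 0 (\<bar>x\<bar> - 1))" for x :: real
  have h: "isCont h x" "norm (h x) \<le> 1" "0 \<le> h x" for x
    unfolding h_def by (auto intro!: continuous_intros)
  have conv: "(\<lambda>n. integral\<^sup>L ((\<nu> \<circ> r) n) f) \<longlonglongrightarrow> integral\<^sup>L \<mu> f"
    if "\<And>x. isCont f x" "\<And>x. norm (f x) \<le> B" for f :: "real \<Rightarrow> real" and B
    using weak_conv_imp_integral_bdd_continuous_conv[OF _ \<mu> wc that] rd by simp
  have "integral\<^sup>L ((\<nu> \<circ> r) n) h = 0" for n
  proof -
    have "AE x in \<nu> (r n). h x = 0" using AE[of "r n"] by eventually_elim (simp add: h_def)
    then have "integral\<^sup>L (\<nu> (r n)) h = integral\<^sup>L (\<nu> (r n)) (\<lambda>_. 0)"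
      using real_distribution.events_eq_borel[OF rd, of "r n"]
      by (intro integral_cong_AE) (auto simp: h_def[abs_def] measurable_cong_sets[OF real_distribution.events_eq_borel[OF rd] refl])
    then show ?thesis by simp
  qed
  then have "integral\<^sup>L \<mu> h = 0"
    using conv[OF h(1,2)] by (simp add: LIMSEQ_const_iff)
  moreover have "integrable \<mu> h"
    using h by (intro \<mu>.integrable_const_bound[of _ 1]) (auto simp: h_def[abs_def])
  ultimately have "AE x in \<mu>. h x = 0" using h(3) integral_nonneg_eq_0_iff_AE[of \<mu> h] by auto
  then have supp: "AE x in \<mu>. \<bar>x\<bar> \<le> 1" by eventually_elim (auto simp: h_def min_def max_def split: if_splits)
  then have us: "unit_supported \<mu>" using \<mu> by (simp add: unit_supported_def)
  have "(\<integral>x. x ^ k \<partial>\<mu>) = \<beta> k" for k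
  proof -
    \<comment> \<open>The argument is clipped to \<open>[-1, 1]\<close>: the result is bounded and
      continuous, and agrees with the power on the common support.\<close>
    define f where "f x = (min 1 (max (-1) x)) ^ k" for x :: real
    have f: "isCont f x" "norm (f x) \<le> 1" for x
    proof -
      have "\<bar>min 1 (max (-1) x)\<bar> \<le> 1" by auto
      then show "norm (f x) \<le> 1" by (simp add: f_def power_abs power_le_one)
    qed (auto simp: f_def[abs_def] intro!: continuous_intros)
    have feq: "integral\<^sup>L \<rho> f = (\<integral>x. x ^ k \<partial>\<rho>)" if "unit_supported \<rho>" for \<rho>
    proof -
      have s: "sets \<rho> = sets borel" and "AE x in \<rho>. \<bar>x\<bar> \<le> 1"
        using that by (auto simp: unit_supported_def real_distribution.events_eq_borel)
      from this(2) have "AE x in \<rho>. f x = x ^ k"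
        by eventually_elim (auto simp: f_def min_def max_def)
      then show ?thesis
        by (intro integral_cong_AE) (auto simp: f_def[abs_def] measurable_cong_sets[OF s refl])
    qed
    have "(\<lambda>n. \<integral>x. x ^ k \<partial>\<nu> (r n)) \<longlonglongrightarrow> (\<integral>x. x ^ k \<partial>\<mu>)"
      using conv[OF f] feq[OF \<nu>] feq[OF us] by simp
    moreover have "(\<lambda>n. \<integral>x. x ^ k \<partial>\<nu> (r n)) \<longlonglongrightarrow> \<beta> k"
      using LIMSEQ_subseq_LIMSEQ[OF mom r] by (simp add: o_def)
    ultimately show ?thesis by (rule LIMSEQ_unique)
  qed
  with us show ?thesis by (rule that)
qed

lemma unit_supported_uminus:
  assumes "unit_supported \<mu>"
  shows "unit_supported (distr \<mu> borel uminus)" "(\<integral>x. x ^ k \<partial>distr \<mu> borel uminus) = (-1) ^ k * (\<integral>x. x ^ k \<partial>\<mu>)"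
proof -
  interpret real_distribution \<mu> using assms by (simp add: unit_supported_def)
  have AE: "AE x in \<mu>. \<bar>x\<bar> \<le> 1" using assms by (simp add: unit_supported_def)
  have m: "uminus \<in> \<mu> \<rightarrow>\<^sub>M borel" by simp
  show "unit_supported (distr \<mu> borel uminus)"
    unfolding unit_supported_def real_distribution_def real_distribution_axioms_def
    using AE by (auto intro!: prob_space_distr simp: AE_distr_iff)
  have "(\<integral>x. x ^ k \<partial>distr \<mu> borel uminus) = (\<integral>x. (- x) ^ k \<partial>\<mu>)"
    by (subst integral_distr[OF m]) auto
  also have "\<dots> = (\<integral>x. (-1) ^ k * x ^ k \<partial>\<mu>)"
    by (intro Bochner_Integration.integral_cong refl) (rule power_minus)
  finally show "(\<integral>x. x ^ k \<partial>distr \<mu> borel uminus) = (-1) ^ k * (\<integral>x. x ^ k \<partial>\<mu>)" by simp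
qed

section \<open>Moments of the limit law\<close>

definition gw_moment :: "real \<Rightarrow> real \<Rightarrow> nat \<Rightarrow> real" where
  "gw_moment c p k = (\<integral>N. tree_return c N k [] \<partial>galton_watson (poisson_pmf p))"

lemma gw_moment_odd: "odd k \<Longrightarrow> gw_moment c p k = 0"
  by (simp add: gw_moment_def tree_return_odd)

lemma integrable_tree_return:
  assumes "c \<ge> 0"
  shows "integrable (galton_watson Q) (\<lambda>N. tree_return c N k x)"
proof -
  interpret prob_space "galton_watson Q" by (rule prob_space_galton_watson)
  show ?thesis
    by (rule integrable_const_bound[of _ 1]) (use tree_return_bounds[OF assms] in auto)
qed

text \<open>With positive probability the root has exactly one child, and then the walk has a
  positive probability of stepping to that child and back.\<close>

lemma gw_moment_2_pos:
  assumes c: "c \<ge> 0" and p: "p > 0"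
  shows "gw_moment c p 2 > 0"
proof -
  let ?G = "galton_watson (poisson_pmf p)"
  have pos: "tree_return c N 2 [] > 0" if "N [] = 1" for N
    using that c by (simp add: numeral_2_eq_2 walk_weight_def)
  have nn: "gw_moment c p 2 \<ge> 0"
    unfolding gw_moment_def using tree_return_bounds[OF c] by (intro Bochner_Integration.integral_nonneg) auto
  moreover have "gw_moment c p 2 \<noteq> 0"
  proof
    assume "gw_moment c p 2 = 0"
    then have "AE N in ?G. tree_return c N 2 [] = 0"
      unfolding gw_moment_def using integral_nonneg_eq_0_iff_AE[OF integrable_tree_return[OF c]] tree_return_bounds[OF c] by simp
    then have AE: "AE N in ?G. (of_bool (N [] = 1) :: real) = 0"
      by eventually_elim (use pos in force)
    have "(\<integral>N. of_bool (N [] = 1) \<partial>?G) = (\<integral>N. (0 :: real) \<partial>?G)"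
      by (rule integral_cong_AE) (use AE in auto)
    moreover have "(\<integral>N. of_bool (N [] = 1) \<partial>?G) = (\<integral>m. (of_bool (m = 1) :: real) \<partial>measure_pmf (poisson_pmf p))"
      using galton_watson_integral_prod(2)[of "{[]}" "poisson_pmf p" "\<lambda>_ m. of_bool (m = 1)"]
      by (simp add: measure_pmf.integrable_const_bound[of _ 1])
    moreover have "(\<integral>m. (of_bool (m = 1) :: real) \<partial>measure_pmf (poisson_pmf p)) = pmf (poisson_pmf p) 1"
      by (subst integral_measure_pmf[of "{1}"]) auto
    ultimately show False using p by simp
  qed
  ultimately show ?thesis by simp
qed

section \<open>The limiting spectral distribution\<close>

locale sparse_graphs =
  fixes M :: "'w measure" and G :: "nat \<Rightarrow> 'w \<Rightarrow> nat set set" and c p :: real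
  assumes M: "prob_space M" and c: "c \<ge> 0" and p: "p > 0"
    and G_meas: "\<And>n. real n > p \<Longrightarrow> G n \<in> M \<rightarrow>\<^sub>M count_space UNIV"
    and G_distr: "\<And>n. real n > p \<Longrightarrow> distr M (count_space UNIV) (G n) = measure_pmf (erdos_renyi n (p / real n))"
begin

sublocale prob_space M by (rule M)

lemma sets_graph_event: "real n > p \<Longrightarrow> {w \<in> space M. Q (G n w)} \<in> sets M"
  using measurable_sets[OF G_meas, of n "{E. Q E}"] by (simp add: vimage_def Int_def conj_commute)

lemma prob_graph_event:
  assumes n: "real n > p"
  shows "prob {w \<in> space M. Q (G n w)} = measure_pmf.prob (erdos_renyi n (p / real n)) {E. Q E}"
proof -
  have "measure_pmf.prob (erdos_renyi n (p / real n)) {E. Q E} = prob (G n -` {E. Q E} \<inter> space M)"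
    unfolding G_distr[OF n, symmetric] by (rule measure_distr[OF G_meas[OF n]]) simp
  also have "G n -` {E. Q E} \<inter> space M = {w \<in> space M. Q (G n w)}" by auto
  finally show ?thesis ..
qed

lemma AE_graph_subset:
  assumes n: "real n > p"
  shows "AE w in M. G n w \<subseteq> vertex_pairs n"
proof -
  have "AE E in distr M (count_space UNIV) (G n). E \<subseteq> vertex_pairs n"
    unfolding G_distr[OF n] by (rule AE_pmfI) (rule set_erdos_renyi_subset)
  then show ?thesis by (subst (asm) AE_distr_iff[OF G_meas[OF n]]) auto
qed

definition mean_moment :: "nat \<Rightarrow> nat \<Rightarrow> real" where
  "mean_moment k n = measure_pmf.expectation (erdos_renyi n (p / real n)) (graph_moment c k n)"

lemma mean_moment_tendsto: "mean_moment k \<longlonglongrightarrow> gw_moment c p k"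
  using expectation_trace_limit[OF c p, of k] by (simp add: mean_moment_def[abs_def] graph_moment_def[abs_def] gw_moment_def)

text \<open>Chebyshev bounds the deviation probabilities by a multiple of \<open>1 / s j\<close>,
  which is summable. The first Borel-Cantelli lemma fits because the joint law of graphs of
  different sizes is unspecified. Tolerances \<open>1 / (m + 1)\<close> and exponents
  \<open>k\<close> are countable, so one null set suffices.\<close>

lemma AE_moments_tendsto:
  assumes s: "strict_mono s" "\<And>j. real (s j) > p" and sum: "summable (\<lambda>j. 1 / real (s j))"
  shows "AE w in M. \<forall>k. (\<lambda>j. graph_moment c k (s j) (G (s j) w)) \<longlonglongrightarrow> gw_moment c p k"
proof -
  have ev: "AE w in M. \<forall>\<^sub>F j in sequentially. \<bar>graph_moment c k (s j) (G (s j) w) - mean_moment k (s j)\<bar> < 1 / real (Suc m)" for k m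
  proof -
    define A where "A j = {w \<in> space M. 1 / real (Suc m) \<le> \<bar>graph_moment c k (s j) (G (s j) w) - mean_moment k (s j)\<bar>}" for j
    have A: "A j \<in> sets M" for j
      unfolding A_def by (rule sets_graph_event[OF s(2)])
    let ?C = "16 * real k ^ 2 * p / (1 / real (Suc m))\<^sup>2"
    have le: "prob (A j) \<le> ?C * (1 / real (s j))" for j
      using prob_graph_moment_deviation[where n = "s j" and \<delta> = "1 / real (Suc m)" and k = k, OF c p s(2)]
        prob_graph_event[where n = "s j" and Q = "\<lambda>E. 1 / real (Suc m) \<le> \<bar>graph_moment c k (s j) E - mean_moment k (s j)\<bar>", OF s(2)]
      unfolding A_def mean_moment_def by simp
    have "summable (\<lambda>j. prob (A j))"
      by (rule summable_comparison_test[OF _ summable_mult[OF sum, of ?C]]) (use le in auto)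
    then have "AE w in M. \<forall>\<^sub>F j in sequentially. w \<in> space M - A j"
      by (intro borel_cantelli_AE1 A) (auto simp: emeasure_eq_measure)
    then show ?thesis
    proof eventually_elim
      case (elim w)
      from elim show ?case by eventually_elim (auto simp: A_def not_le)
    qed
  qed
  have "AE w in M. \<forall>k m. \<forall>\<^sub>F j in sequentially. \<bar>graph_moment c k (s j) (G (s j) w) - mean_moment k (s j)\<bar> < 1 / real (Suc m)"
    unfolding AE_all_countable using ev by blast
  then show ?thesis
  proof eventually_elim
    case (elim w)
    show ?case
    proof
      fix k
      have "(\<lambda>j. graph_moment c k (s j) (G (s j) w) - mean_moment k (s j)) \<longlonglongrightarrow> 0"
      proof (rule tendstoI)
        fix \<epsilon> :: real assume "\<epsilon> > 0"
        then obtain m where m: "1 / real (Suc m) < \<epsilon>" using nat_approx_posE by blast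
        have "\<forall>\<^sub>F j in sequentially. \<bar>graph_moment c k (s j) (G (s j) w) - mean_moment k (s j)\<bar> < 1 / real (Suc m)"
          using elim by blast
        then show "\<forall>\<^sub>F j in sequentially. dist (graph_moment c k (s j) (G (s j) w) - mean_moment k (s j)) 0 < \<epsilon>"
          by eventually_elim (use m in \<open>simp add: dist_real_def\<close>)
      qed
      moreover have "(\<lambda>j. mean_moment k (s j)) \<longlonglongrightarrow> gw_moment c p k"
        using LIMSEQ_subseq_LIMSEQ[OF mean_moment_tendsto s(1)] by (simp add: o_def)
      ultimately show "(\<lambda>j. graph_moment c k (s j) (G (s j) w)) \<longlonglongrightarrow> gw_moment c p k"
        using tendsto_add by fastforce
    qed
  qed
qed

lemma AE_graphs_subset:
  fixes s :: "nat \<Rightarrow> nat"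
  assumes "\<And>j. real (s j) > p"
  shows "AE w in M. \<forall>j. G (s j) w \<subseteq> vertex_pairs (s j)"
  unfolding AE_all_countable by (intro allI AE_graph_subset assms)

lemma pos_of_gt_p: "real n > p \<Longrightarrow> n > 0"
  using p by (cases n) auto

text \<open>Almost sure convergence of all moments along one sparse subsequence provides a single
  outcome \<open>w\<close> whose spectral distributions have the required limiting moments. The law
  is extracted from this deterministic sequence.\<close>

lemma limit_law_exists:
  obtains \<mu> where "unit_supported \<mu>" "\<And>k. (\<integral>x. x ^ k \<partial>\<mu>) = gw_moment c p k"
proof -
  note goal_ex = that
  define j0 where "j0 = Suc (nat \<lceil>p\<rceil>)"
  \<comment> \<open>Squares have summable reciprocals, and the shift by \<open>j0\<close> keeps
    every index above \<open>p\<close>.\<close>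
  define s where "s j = (j + j0) ^ 2" for j
  have j0: "real j0 > p" "j0 > 0" unfolding j0_def by linarith+
  have sm: "strict_mono s"
    unfolding s_def by (intro strict_monoI power_strict_mono) auto
  have sp: "real (s j) > p" for j
  proof -
    have "real j0 \<le> real ((j + j0) ^ 2)"
      using self_le_power[of "j + j0" 2] j0 by (intro of_nat_mono) linarith
    then show ?thesis using j0 by (simp add: s_def)
  qed
  have "summable (\<lambda>j. inverse (real j ^ 2))" by (rule inverse_power_summable) simp
  then have "summable (\<lambda>j. inverse (real (j + j0) ^ 2))" by (subst summable_iff_shift)
  then have ss: "summable (\<lambda>j. 1 / real (s j))" by (simp add: s_def inverse_eq_divide)
  have "AE w in M. (\<forall>k. (\<lambda>j. graph_moment c k (s j) (G (s j) w)) \<longlonglongrightarrow> gw_moment c p k) \<and>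
      (\<forall>j. G (s j) w \<subseteq> vertex_pairs (s j))"
    using AE_moments_tendsto[OF sm sp ss] AE_graphs_subset[of s, OF sp] by eventually_elim blast
  then have "\<exists>w. (\<forall>k. (\<lambda>j. graph_moment c k (s j) (G (s j) w)) \<longlonglongrightarrow> gw_moment c p k) \<and>
      (\<forall>j. G (s j) w \<subseteq> vertex_pairs (s j))"
    by (rule eventually_happens'[OF ae_filter_bot])
  then obtain w where "(\<forall>k. (\<lambda>j. graph_moment c k (s j) (G (s j) w)) \<longlonglongrightarrow> gw_moment c p k) \<and>
      (\<forall>j. G (s j) w \<subseteq> vertex_pairs (s j))" ..
  then have w: "\<And>k. (\<lambda>j. graph_moment c k (s j) (G (s j) w)) \<longlonglongrightarrow> gw_moment c p k"
      "\<And>j. G (s j) w \<subseteq> vertex_pairs (s j)" by auto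
  show ?thesis
  proof (rule moment_limit_exists[of "\<lambda>j. graph_esd c (s j) (G (s j) w)" "gw_moment c p"])
    show "unit_supported (graph_esd c (s j) (G (s j) w))" for j
      by (rule unit_supported_graph_esd[OF c pos_of_gt_p[OF sp] w(2)])
    show "(\<lambda>j. \<integral>x. x ^ k \<partial>graph_esd c (s j) (G (s j) w)) \<longlonglongrightarrow> gw_moment c p k" for k
      unfolding moment_graph_esd[OF c pos_of_gt_p[OF sp] w(2)] by (rule w(1))
    show thesis if "unit_supported \<mu>" "\<And>k. (\<integral>x. x ^ k \<partial>\<mu>) = gw_moment c p k" for \<mu>
      by (rule goal_ex[OF that])
  qed
qed

context
  fixes \<mu> assumes us: "unit_supported \<mu>" and mom: "\<And>k. (\<integral>x. x ^ k \<partial>\<mu>) = gw_moment c p k"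
begin

lemma AE_weak_conv:
  assumes s: "strict_mono s" "\<And>j. real (s j) > p" and sum: "summable (\<lambda>j. 1 / real (s j))"
  shows "AE w in M. weak_conv_m (\<lambda>j. graph_esd c (s j) (G (s j) w)) \<mu>"
  using AE_moments_tendsto[OF s sum] AE_graphs_subset[of s, OF s(2)]
proof eventually_elim
  case (elim w)
  have E: "G (s j) w \<subseteq> vertex_pairs (s j)" for j using elim(2) by blast
  show ?case
  proof (rule moments_tendsto_imp_weak_conv[OF _ us])
    show "unit_supported (graph_esd c (s j) (G (s j) w))" for j
      by (rule unit_supported_graph_esd[OF c pos_of_gt_p[OF s(2)] E])
    show "(\<lambda>j. \<integral>x. x ^ k \<partial>graph_esd c (s j) (G (s j) w)) \<longlonglongrightarrow> (\<integral>x. x ^ k \<partial>\<mu>)" for k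
      unfolding moment_graph_esd[OF c pos_of_gt_p[OF s(2)] E] mom using elim(1) by blast
  qed
qed

lemma eventually_gt_p: "\<forall>\<^sub>F n in sequentially. real n > p"
  using eventually_gt_at_top[of "nat \<lceil>p\<rceil>"] by eventually_elim linarith

text \<open>A deviation of the integral forces one of finitely many moments to deviate by more than
  \<delta>. Half of this is available for the bias of the mean, which is eventually smaller, so the
  other half is a fluctuation controlled by Chebyshev and a union bound. The estimate is made under
  the law of the graph, where every set is an event.\<close>

lemma prob_integral_deviation_tendsto:
  fixes g :: "real \<Rightarrow> real" and \<epsilon> :: real
  assumes g: "continuous_on UNIV g" and \<epsilon>: "\<epsilon> > 0"
  shows "(\<lambda>n. prob {w \<in> space M. \<bar>(\<integral>x. g x \<partial>graph_esd c n (G n w)) - (\<integral>x. g x \<partial>\<mu>)\<bar> > \<epsilon>}) \<longlonglongrightarrow> 0"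
proof -
  from moments_control_integral[OF g \<epsilon>] obtain m \<delta> where \<delta>: "\<delta> > 0"
    and ctrl: "\<forall>\<mu> \<nu>. unit_supported \<mu> \<longrightarrow> unit_supported \<nu> \<longrightarrow>
      (\<forall>k\<le>m. \<bar>(\<integral>x. x ^ k \<partial>\<mu>) - (\<integral>x. x ^ k \<partial>\<nu>)\<bar> \<le> \<delta>) \<longrightarrow>
      \<bar>(\<integral>x. g x \<partial>\<mu>) - (\<integral>x. g x \<partial>\<nu>)\<bar> \<le> \<epsilon>" by (elim exE conjE)
  define C where "C = (\<Sum>k\<le>m. 16 * real k ^ 2 * p / (\<delta> / 2)\<^sup>2)"
  have "\<forall>\<^sub>F n in sequentially. \<forall>k\<in>{..m}. dist (mean_moment k n) (gw_moment c p k) < \<delta> / 2"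
    by (intro eventually_ball_finite ballI tendstoD[OF mean_moment_tendsto]) (use \<delta> in auto)
  then have bound: "\<forall>\<^sub>F n in sequentially.
    prob {w \<in> space M. \<bar>(\<integral>x. g x \<partial>graph_esd c n (G n w)) - (\<integral>x. g x \<partial>\<mu>)\<bar> > \<epsilon>} \<le> C * (1 / real n)"
    using eventually_gt_p
  proof eventually_elim
    case (elim n)
    let ?P = "erdos_renyi n (p / real n)"
    let ?B = "\<lambda>k. {E. \<delta> / 2 \<le> \<bar>graph_moment c k n E - mean_moment k n\<bar>}"
    have "measure_pmf.prob ?P {E. \<epsilon> < \<bar>(\<integral>x. g x \<partial>graph_esd c n E) - (\<integral>x. g x \<partial>\<mu>)\<bar>}
      \<le> measure_pmf.prob ?P (\<Union>k\<in>{..m}. ?B k)"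
    proof (rule measure_pmf.finite_measure_mono_AE)
      show "AE E in measure_pmf ?P. E \<in> {E. \<epsilon> < \<bar>(\<integral>x. g x \<partial>graph_esd c n E) - (\<integral>x. g x \<partial>\<mu>)\<bar>} \<longrightarrow> E \<in> (\<Union>k\<in>{..m}. ?B k)"
      proof (rule AE_pmfI, rule impI)
        fix E assume "E \<in> set_pmf ?P" and E: "E \<in> {E. \<epsilon> < \<bar>(\<integral>x. g x \<partial>graph_esd c n E) - (\<integral>x. g x \<partial>\<mu>)\<bar>}"
        then have sub: "E \<subseteq> vertex_pairs n" by (intro set_erdos_renyi_subset)
        note us' = unit_supported_graph_esd[OF c pos_of_gt_p[OF elim(2)] sub]
        have "\<not> (\<forall>k\<le>m. \<bar>graph_moment c k n E - gw_moment c p k\<bar> \<le> \<delta>)"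
          using ctrl[rule_format, OF us' us] E unfolding moment_graph_esd[OF c pos_of_gt_p[OF elim(2)] sub] mom by fastforce
        then obtain k where k: "k \<le> m" "\<bar>graph_moment c k n E - gw_moment c p k\<bar> > \<delta>" by (auto simp: not_le)
        moreover have "\<bar>mean_moment k n - gw_moment c p k\<bar> < \<delta> / 2"
          using elim(1) k(1) by (auto simp: dist_real_def)
        ultimately have "\<delta> / 2 \<le> \<bar>graph_moment c k n E - mean_moment k n\<bar>" by linarith
        then show "E \<in> (\<Union>k\<in>{..m}. ?B k)" using k(1) by blast
      qed
    qed simp
    also have "\<dots> \<le> (\<Sum>k\<le>m. measure_pmf.prob ?P (?B k))"
      by (rule measure_pmf.finite_measure_subadditive_finite) auto
    also have "\<dots> \<le> (\<Sum>k\<le>m. (16 * real k ^ 2 * p / (\<delta> / 2)\<^sup>2) * (1 / real n))"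
      unfolding mean_moment_def using \<delta> by (intro sum_mono prob_graph_moment_deviation[OF c p elim(2)]) simp
    also have "\<dots> = C * (1 / real n)" unfolding C_def by (rule sum_distrib_right[symmetric])
    finally show ?case
      unfolding prob_graph_event[where n = n and Q = "\<lambda>E. \<bar>(\<integral>x. g x \<partial>graph_esd c n E) - (\<integral>x. g x \<partial>\<mu>)\<bar> > \<epsilon>", OF elim(2)] .
  qed
  have "(\<lambda>n. C * (1 / real n)) \<longlonglongrightarrow> C * 0" by (intro tendsto_mult tendsto_const lim_1_over_n)
  then have "(\<lambda>n. C * (1 / real n)) \<longlonglongrightarrow> 0" by simp
  from tendsto_sandwich[OF _ bound tendsto_const this] show ?thesis by simp
qed

text \<open>Reflection changes only the sign of the odd moments, and these vanish; on
  \<open>[-1, 1]\<close> the moments determine the law.\<close>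

lemma limit_law_symmetric: "distr \<mu> borel uminus = \<mu>"
proof (rule moments_determine[OF unit_supported_uminus(1)[OF us] us])
  show "(\<integral>x. x ^ k \<partial>distr \<mu> borel uminus) = (\<integral>x. x ^ k \<partial>\<mu>)" for k
    unfolding unit_supported_uminus(2)[OF us] mom by (cases "even k") (auto simp: gw_moment_odd)
qed

text \<open>The first moment would place the point mass at 0, against the positive second
  moment.\<close>

lemma limit_law_nondegenerate: "measure \<mu> {x} \<noteq> 1"
proof
  assume *: "measure \<mu> {x} = 1"
  interpret \<mu>: real_distribution \<mu> using us by (simp add: unit_supported_def)
  have AE: "AE y in \<mu>. y \<in> {x}" using \<mu>.prob_eq_1[of "{x}"] * by simp
  have power: "(\<integral>y. y ^ k \<partial>\<mu>) = x ^ k" for k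
  proof -
    have "(\<integral>y. y ^ k \<partial>\<mu>) = (\<integral>y. x ^ k \<partial>\<mu>)"
      by (rule integral_cong_AE) (use AE in auto)
    then show ?thesis using \<mu>.prob_space by simp
  qed
  have "x = 0" using power[of 1] mom[of 1] gw_moment_odd[of 1 c p] by simp
  then show False using power[of 2] mom[of 2] gw_moment_2_pos[OF c p] by simp
qed

end

end

theorem theorem5:
  fixes M :: "'w measure" and G :: "nat \<Rightarrow> 'w \<Rightarrow> nat set set"
    and c p :: real
  assumes "prob_space M" and "c \<ge> 0" and "p > 0"
    and "\<And>n. real n > p \<Longrightarrow> G n \<in> M \<rightarrow>\<^sub>M count_space UNIV"
    and "\<And>n. real n > p \<Longrightarrow>
      distr M (count_space UNIV) (G n) = measure_pmf (erdos_renyi n (p / real n))"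
  shows "\<exists>\<mu> :: real measure. real_distribution \<mu> \<and>
    weakly_converges_in_probability M
      (\<lambda>n w. empirical_spectral_distribution (walk_matrix c (adjacency_matrix n (G n w))))
      \<mu> \<and>
    (\<forall>s :: nat \<Rightarrow> nat. strict_mono s \<longrightarrow> (\<forall>j. real (s j) > p) \<longrightarrow>
      summable (\<lambda>j. 1 / real (s j)) \<longrightarrow>
      (AE w in M. weak_conv_m
        (\<lambda>j. empirical_spectral_distribution
          (walk_matrix c (adjacency_matrix (s j) (G (s j) w))))
        \<mu>)) \<and>
    distr \<mu> borel uminus = \<mu> \<and>
    (\<forall>x. measure \<mu> {x} \<noteq> 1) \<and>
    (\<forall>k \<ge> 1. integrable \<mu> (\<lambda>x. x ^ k) \<and>
      integrable (galton_watson (poisson_pmf p))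
        (\<lambda>N. return_probability k (tree_adj N) [] c) \<and>
      (\<integral>x. x ^ k \<partial>\<mu>) =
        (\<integral>N. return_probability k (tree_adj N) [] c \<partial>galton_watson (poisson_pmf p)))"
proof -
  interpret sparse_graphs M G c p by (rule sparse_graphs.intro) (fact assms)+
  obtain \<mu> where us: "unit_supported \<mu>" and mom: "\<And>k. (\<integral>x. x ^ k \<partial>\<mu>) = gw_moment c p k"
    using limit_law_exists by blast
  note [simp] = return_probability_tree[OF c]
  show ?thesis
  proof (intro exI[of _ \<mu>] conjI allI impI)
    show "real_distribution \<mu>" using us by (simp add: unit_supported_def)
    show "weakly_converges_in_probability M
      (\<lambda>n w. empirical_spectral_distribution (walk_matrix c (adjacency_matrix n (G n w)))) \<mu>"
      unfolding weakly_converges_in_probability_def graph_esd_def[symmetric]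
      by (intro allI impI prob_integral_deviation_tendsto[OF us mom])
    show "AE w in M. weak_conv_m (\<lambda>j. empirical_spectral_distribution
        (walk_matrix c (adjacency_matrix (s j) (G (s j) w)))) \<mu>"
      if "strict_mono s" "\<forall>j. real (s j) > p" "summable (\<lambda>j. 1 / real (s j))" for s
      using AE_weak_conv[OF us mom that(1) _ that(3)] that(2) unfolding graph_esd_def by blast
    show "distr \<mu> borel uminus = \<mu>" by (rule limit_law_symmetric[OF us mom])
    show "measure \<mu> {x} \<noteq> 1" for x by (rule limit_law_nondegenerate[OF us mom])
    fix k :: nat assume "k \<ge> 1"
    show "integrable \<mu> (\<lambda>x. x ^ k)" by (rule unit_supported_integrable_power[OF us])
    show "integrable (galton_watson (poisson_pmf p)) (\<lambda>N. return_probability k (tree_adj N) [] c)"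
      by (simp add: integrable_tree_return[OF c])
    show "(\<integral>x. x ^ k \<partial>\<mu>) = (\<integral>N. return_probability k (tree_adj N) [] c \<partial>galton_watson (poisson_pmf p))"
      by (simp add: mom gw_moment_def)
  qed
qed

end
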